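(* Let $d\ge 2$ and let $Z=\{Z(x,t):\ x\in\mathbb{R}^d,\ t\in\mathbb{R}\}$ be a zero-mean, mean-square continuous Gaussian random field, homogeneous and isotropic in space and stationary in time, with $\mathbb{E}[Z^2(x,t)]=1$ and nonnegative covariance function $\mathbb{E}[Z(x,t)Z(y,s)]=C(\|x-y\|,|t-s|)\ge 0$ of the form $$C(z,\tau)=2^{\frac{d-2}{2}+1}\,\Gamma\Big(\frac d2\Big)\int_0^\infty\cos(\mu\tau)\int_0^\infty\frac{J_{\frac{d-2}{2}}(\lambda z)}{(\lambda z)^{\frac{d-2}{2}}}\,\mathcal{G}(d\lambda,d\mu),\qquad z\ge 0,\ \tau\ge 0,$$ for a finite measure $\mathcal{G}$ on $[0,\infty)^2$. Let $T_R(x,t)=Z(x,t)$, $x\in\mathbb{S}_{d-1}(1)$, $t\in\mathbb{R}$, be the restriction of $Z$ to the unit sphere. Assume that: (i) $\sup_{z\in[0,2]}C(z,\tau)\to 0$ as $\tau\to\infty$; (ii) there exists $\delta\in(0,1)$ such that $$\lim_{T\to\infty}\frac{1}{T^\delta}\int_0^T\Big(1-\frac{\tau}{T}\Big)\int_0^2 z^{d-2}C(z,\tau)\Big(1-\frac{z^2}{4}\Big)^{\frac{d-3}{2}}dz\,d\tau=\infty .$$ Let $u\in\mathbb{R}$ be a fixed level and $N_T=\int_0^T\int_{\mathbb{S}_{d-1}(1)}\mathbb{I}_{\{T_R(x,t)\ge u\}}\,d\nu_{d-1}(x)\,dt$. Then the random variable $$\frac{N_T-T(1-\Phi(u))\,|\mathbb{S}_{d-1}(1)|}{\phi(u)\left[\frac{8\pi^{d-\frac12}}{\Gamma(\frac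 d2)\Gamma(\frac{d-1}{2})}\,T\int_0^T\left(1-\frac{\tau}{T}\right)\int_0^2C(z,\tau)\,z^{d-2}\left(1-\frac{z^2}{4}\right)^{\frac{d-3}{2}}dz\,d\tau\right]^{1/2}}$$ has asymptotically a standard normal distribution as $T\to\infty$.
   Context: $\mathbb{S}_{d-1}(1)=\{x\in\mathbb{R}^d:\|x\|=1\}$ with $\|\cdot\|$ the Euclidean norm; $\nu_{d-1}$ is the surface (Riemannian) measure on $\mathbb{S}_{d-1}(1)$, with total mass $|\mathbb{S}_{d-1}(1)|=2\pi^{d/2}/\Gamma(d/2)$. $J_\nu$ is the Bessel function of the first kind of order $\nu$ (the ratio $J_\nu(r)/r^\nu$ is extended continuously to $r=0$). $\phi(w)=\frac{1}{\sqrt{2\pi}}e^{-w^2/2}$ and $\Phi(u)=\int_{-\infty}^u\phi(w)\,dw$. The measure $\mathcal{G}$ is the one obtained from the spectral measure of $Z$ (given by Bochner's theorem) by passing to the radial spatial frequency $\lambda=\|\widetilde\omega\|$ and absolute temporal frequency $\mu=|\widetilde\mu|$, up to normalization. *)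

theory Defs
  imports "HOL-Probability.Probability"
begin

section \<open>Bessel functions of the first kind\<close>

text \<open>The defining series is meant for positive arguments.\<close>

definition bessel_J :: "real \<Rightarrow> real \<Rightarrow> real" where
  "bessel_J \<nu> r =
     (\<Sum>m. (-1) ^ m * rGamma (\<nu> + real m + 1) / fact m * (r / 2) powr (2 * real m + \<nu>))"

text \<open>The value at zero is the continuous extension; see \<open>bessel_ratio_continuous_at_zero\<close>.\<close>

definition bessel_ratio :: "real \<Rightarrow> real \<Rightarrow> real" where
  "bessel_ratio \<nu> r =
     (if r = 0 then 1 / (2 powr \<nu> * Gamma (\<nu> + 1)) else bessel_J \<nu> r / r powr \<nu>)"

lemma bessel_ratio_continuous_at_zero:
  assumes "\<nu> \<ge> 0"
  shows "(bessel_ratio \<nu> \<longlongrightarrow> bessel_ratio \<nu> 0) (at_right 0)"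
proof -
  define a where "a m = (-1) ^ m * rGamma (\<nu> + real m + 1) / fact m" for m :: nat
  have poch: "pochhammer (\<nu> + 1) m \<ge> 1" for m
  proof (induction m)
    case (Suc m)
    have "1 * 1 \<le> pochhammer (\<nu> + 1) m * (\<nu> + 1 + real m)"
      using Suc assms by (intro mult_mono) auto
    then show ?case by (simp add: pochhammer_Suc)
  qed simp
  have rG: "\<bar>rGamma (\<nu> + real m + 1)\<bar> \<le> \<bar>rGamma (\<nu> + 1)\<bar>" for m
  proof -
    have "rGamma (\<nu> + 1) = pochhammer (\<nu> + 1) m * rGamma (\<nu> + real m + 1)"
      using pochhammer_rGamma[of "\<nu> + 1" m] by (simp add: add_ac)
    moreover have "1 * \<bar>rGamma (\<nu> + real m + 1)\<bar>
        \<le> pochhammer (\<nu> + 1) m * \<bar>rGamma (\<nu> + real m + 1)\<bar>"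
      using poch by (intro mult_right_mono) auto
    ultimately show ?thesis
      using poch[of m] by (simp add: abs_mult)
  qed
  have sm: "summable (\<lambda>m. a m * x ^ m)" for x :: real
  proof (rule summable_comparison_test)
    have "summable (\<lambda>m. inverse (fact m) * \<bar>x\<bar> ^ m)"
      by (rule summable_exp)
    then show "summable (\<lambda>m. \<bar>rGamma (\<nu> + 1)\<bar> * (inverse (fact m) * \<bar>x\<bar> ^ m))"
      by (rule summable_mult)
    have "norm (a m * x ^ m) \<le> \<bar>rGamma (\<nu> + 1)\<bar> * (inverse (fact m) * \<bar>x\<bar> ^ m)" for m
    proof -
      have "norm (a m * x ^ m) =
          \<bar>rGamma (\<nu> + real m + 1)\<bar> * (inverse (fact m) * \<bar>x\<bar> ^ m)"
        by (simp add: a_def abs_mult power_abs divide_inverse)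
      also have "\<dots> \<le> \<bar>rGamma (\<nu> + 1)\<bar> * (inverse (fact m) * \<bar>x\<bar> ^ m)"
        using rG by (intro mult_right_mono) auto
      finally show ?thesis .
    qed
    then show "\<exists>N. \<forall>m\<ge>N. norm (a m * x ^ m)
        \<le> \<bar>rGamma (\<nu> + 1)\<bar> * (inverse (fact m) * \<bar>x\<bar> ^ m)"
      by blast
  qed
  define g where "g x = (\<Sum>m. a m * x ^ m)" for x :: real
  have "isCont g 0"
    unfolding g_def by (rule isCont_powser[OF sm[of 1]]) simp
  then have "isCont (\<lambda>r. g ((r / 2)\<^sup>2)) 0"
    by (intro isCont_o2[where f = "\<lambda>r::real. (r / 2)\<^sup>2" and g = g]) simp_all
  then have cont: "isCont (\<lambda>r. g ((r / 2)\<^sup>2) / 2 powr \<nu>) 0"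
    by (intro isCont_divide) simp_all
  have ratio: "bessel_ratio \<nu> r = g ((r / 2)\<^sup>2) / 2 powr \<nu>" if "r > 0" for r
  proof -
    have "a m * (r / 2) powr (2 * real m + \<nu>)
        = a m * ((r / 2)\<^sup>2) ^ m * (r / 2) powr \<nu>" for m
    proof -
      have "(r / 2) powr (2 * real m) = (r / 2) ^ (2 * m)"
        using that powr_realpow[of "r / 2" "2 * m"] by simp
      then show ?thesis
        by (simp only: powr_add power_mult mult.assoc)
    qed
    then have "bessel_J \<nu> r = (\<Sum>m. a m * ((r / 2)\<^sup>2) ^ m * (r / 2) powr \<nu>)"
      unfolding bessel_J_def a_def by (simp only:)
    also have "\<dots> = g ((r / 2)\<^sup>2) * (r / 2) powr \<nu>"
      unfolding g_def by (rule suminf_mult2[OF sm, symmetric])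
    finally show ?thesis
      using that by (simp add: bessel_ratio_def powr_divide)
  qed
  have g0: "g 0 = a 0"
    unfolding g_def by simp
  have "bessel_ratio \<nu> 0 = g ((0 / 2)\<^sup>2) / 2 powr \<nu>"
    using g0 by (simp add: bessel_ratio_def a_def rGamma_inverse_Gamma field_simps)
  moreover have "((\<lambda>r. g ((r / 2)\<^sup>2) / 2 powr \<nu>) \<longlongrightarrow> g ((0 / 2)\<^sup>2) / 2 powr \<nu>) (at_right 0)"
    using cont unfolding isCont_def by (rule filterlim_mono) (auto simp: at_le)
  ultimately show ?thesis
    using ratio by (auto intro: Lim_transform_eventually simp: eventually_at_filter)
qed


section \<open>Surface measure on the unit sphere\<close>

text \<open>
  The Riemannian surface measure, obtained from polar coordinates: the surface measure of
  a set \<open>A\<close> of unit vectors is \<open>d\<close> times the Lebesgue measure of the cone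
  of all \<open>r x\<close> with \<open>0 < r \<le> 1\<close> and \<open>x\<close> in \<open>A\<close>.
  The lemmas below identify it as the rotation invariant measure of total mass
  \<open>2 \<pi>\<^sup>d\<^sup>/\<^sup>2 / \<Gamma>(d/2)\<close>.
\<close>

definition sphere_measure :: "'a::euclidean_space measure" where
  "sphere_measure =
     scale_measure (of_nat DIM('a))
       (distr (restrict_space lborel (cball 0 1 - {0})) (restrict_space borel (sphere 0 1))
         (\<lambda>x. x /\<^sub>R norm x))"

lemma space_sphere_measure [simp]: "space sphere_measure = sphere 0 1"
  by (simp add: sphere_measure_def space_scale_measure space_restrict_space)

lemma sets_sphere_measure [simp, measurable_cong]:
  "sets sphere_measure = sets (restrict_space borel (sphere 0 1))"
  by (simp add: sphere_measure_def)

lemma measurable_sphere_proj: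
  "(\<lambda>x::'a::euclidean_space. x /\<^sub>R norm x)
     \<in> restrict_space lborel (cball 0 1 - {0}) \<rightarrow>\<^sub>M restrict_space borel (sphere 0 1)"
  by (intro measurable_restrict_space2) (auto intro!: measurable_restrict_space1 simp: space_restrict_space)

lemma emeasure_sphere_measure:
  assumes "A \<in> sets (restrict_space borel (sphere (0::'a::euclidean_space) 1))"
  shows "emeasure sphere_measure A =
    of_nat DIM('a) * emeasure lborel {x::'a. 0 < norm x \<and> norm x \<le> 1 \<and> x /\<^sub>R norm x \<in> A}"
proof -
  let ?R = "restrict_space lborel (cball 0 1 - {0::'a})"
  have *: "(\<lambda>x. x /\<^sub>R norm x) -` A \<inter> space ?R
      = {x::'a. 0 < norm x \<and> norm x \<le> 1 \<and> x /\<^sub>R norm x \<in> A}"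
    by (auto simp: space_restrict_space)
  have "emeasure sphere_measure A
      = of_nat DIM('a) * emeasure ?R ((\<lambda>x. x /\<^sub>R norm x) -` A \<inter> space ?R)"
    using assms by (simp add: sphere_measure_def emeasure_distr[OF measurable_sphere_proj])
  also have "emeasure ?R ((\<lambda>x. x /\<^sub>R norm x) -` A \<inter> space ?R)
      = emeasure lborel ((\<lambda>x. x /\<^sub>R norm x) -` A \<inter> space ?R)"
    by (rule emeasure_restrict_space) (auto simp: space_restrict_space)
  finally show ?thesis unfolding * .
qed

lemma emeasure_sphere_measure_space:
  "emeasure sphere_measure (sphere (0::'a::euclidean_space) 1)
     = ennreal (2 * pi powr (DIM('a) / 2) / Gamma (DIM('a) / 2))"
proof -
  let ?d = "real DIM('a)"
  have "{x::'a. 0 < norm x \<and> norm x \<le> 1 \<and> x /\<^sub>R norm x \<in> sphere 0 1} = cball 0 1 - {0}"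
    by auto
  then have "emeasure sphere_measure (sphere (0::'a) 1)
      = of_nat DIM('a) * emeasure lborel (cball (0::'a) 1 - {0})"
    by (subst emeasure_sphere_measure) (auto simp: sets_restrict_space)
  also have "emeasure lborel (cball (0::'a) 1 - {0}) = emeasure lborel (cball (0::'a) 1)"
    by (intro emeasure_Diff_null_set) auto
  also have "of_nat DIM('a) * \<dots> = ennreal (?d * unit_ball_vol ?d)"
    by (simp add: emeasure_cball ennreal_mult ennreal_of_nat_eq_real_of_nat)
  also have "?d * unit_ball_vol ?d = 2 * pi powr (?d / 2) / Gamma (?d / 2)"
  proof -
    have "?d / 2 \<notin> \<int>\<^sub>\<le>\<^sub>0" by auto
    then have "Gamma (?d / 2 + 1) = ?d / 2 * Gamma (?d / 2)"
      by (rule Gamma_plus1)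
    then have "unit_ball_vol ?d = pi powr (?d / 2) / (?d / 2 * Gamma (?d / 2))"
      unfolding unit_ball_vol_def by (simp only:)
    then show ?thesis by simp
  qed
  finally show ?thesis .
qed

lemma sphere_measure_rotation_invariant:
  fixes f :: "real ^ 'n::{finite,wellorder} \<Rightarrow> real ^ 'n::_"
  assumes f: "orthogonal_transformation f"
    and A: "A \<in> sets (restrict_space borel (sphere 0 1))"
  shows "emeasure sphere_measure (f ` A) = emeasure sphere_measure A"
proof -
  define K where "K B = {x :: real ^ 'n::_. 0 < norm x \<and> norm x \<le> 1 \<and> x /\<^sub>R norm x \<in> B}" for B
  have lin: "linear f" and bij: "bij f" and nf: "\<And>x. norm (f x) = norm x"
    using f orthogonal_transformation_bij
    by (auto simp: orthogonal_transformation_linear orthogonal_transformation_norm)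
  have inv: "orthogonal_transformation (inv f)"
    using f by (rule orthogonal_transformation_inv)
  have Asub: "A \<subseteq> sphere 0 1" and Ab: "A \<in> sets borel"
    using A by (auto simp: sets_restrict_space_iff)
  have "inv f \<in> borel_measurable borel"
    using inv by (intro borel_measurable_continuous_onI linear_continuous_on linear_conv_bounded_linear[THEN iffD1])
      (auto simp: orthogonal_transformation_linear)
  moreover have "f ` A = inv f -` A \<inter> space borel"
    using bij by (simp add: bij_image_Collect_eq bij_vimage_eq_inv_image bij_imp_bij_inv inv_inv_eq)
  ultimately have fAb: "f ` A \<in> sets borel"
    using measurable_sets[OF _ Ab] by metis
  have fA: "f ` A \<in> sets (restrict_space borel (sphere 0 1))"
    using fAb Asub nf by (auto simp: sets_restrict_space_iff)
  have K_meas: "K B \<in> sets borel" if "B \<in> sets borel" for B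
  proof -
    have [measurable]: "B \<in> sets borel" by fact
    show ?thesis unfolding K_def by measurable
  qed
  have K_bdd: "bounded (K B)" for B
    by (rule bounded_subset[of "cball 0 1"]) (auto simp: K_def)
  have K_lm: "K B \<in> lmeasurable" if "B \<in> sets borel" for B
    using K_meas[OF that] K_bdd[of B] by (intro bounded_set_imp_lmeasurable) auto
  have K_em: "emeasure lborel (K B) = ennreal (measure lebesgue (K B))" if "B \<in> sets borel" for B
  proof -
    have "emeasure lborel (K B) = emeasure lebesgue (K B)"
      using K_meas[OF that] by simp
    also have "\<dots> = ennreal (measure lebesgue (K B))"
      using K_lm[OF that] by (intro emeasure_eq_measure2)
    finally show ?thesis .
  qed
  have "K (f ` A) = f ` K A"
  proof (intro equalityI subsetI)
    fix y assume y: "y \<in> K (f ` A)"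
    then obtain a where a: "a \<in> A" "y /\<^sub>R norm y = f a" and n: "0 < norm y" "norm y \<le> 1"
      by (auto simp: K_def)
    have "y = norm y *\<^sub>R f a"
      using a(2) n by (metis inverse_eq_divide less_irrefl scaleR_one scaleR_scaleR right_inverse)
    then have "y = f (norm y *\<^sub>R a)"
      by (simp add: linear_scale[OF lin])
    moreover have "norm y *\<^sub>R a \<in> K A"
      using a(1) n Asub by (auto simp: K_def)
    ultimately show "y \<in> f ` K A" by blast
  next
    fix y assume "y \<in> f ` K A"
    then obtain x where "y = f x" and x: "0 < norm x" "norm x \<le> 1" "x /\<^sub>R norm x \<in> A"
      by (auto simp: K_def)
    moreover have "f x /\<^sub>R norm x = f (x /\<^sub>R norm x)"
      by (simp add: linear_scale[OF lin])
    ultimately show "y \<in> K (f ` A)"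
      unfolding K_def by (simp only: mem_Collect_eq nf) blast
  qed
  then have "measure lebesgue (K (f ` A)) = measure lebesgue (K A)"
    using measure_orthogonal_image[OF f K_lm[OF Ab]] by simp
  then have "emeasure lborel (K (f ` A)) = emeasure lborel (K A)"
    using K_em Ab fAb by simp
  then show ?thesis
    by (simp add: emeasure_sphere_measure[OF A] emeasure_sphere_measure[OF fA] K_def)
qed


section \<open>Gaussian random fields\<close>

text \<open>Degenerate (constant) Gaussian variables are included.\<close>

definition gaussian_rv :: "'w measure \<Rightarrow> ('w \<Rightarrow> real) \<Rightarrow> bool" where
  "gaussian_rv M X \<longleftrightarrow>
     X \<in> borel_measurable M \<and>
     (\<exists>m s. 0 \<le> s \<and>
        distr M borel X = (if s = 0 then return borel m else density lborel (normal_density m s)))"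

definition gaussian_field :: "'w measure \<Rightarrow> ('i \<Rightarrow> 'w \<Rightarrow> real) \<Rightarrow> bool" where
  "gaussian_field M X \<longleftrightarrow>
     (\<forall>J a. finite J \<longrightarrow> gaussian_rv M (\<lambda>\<omega>. \<Sum>i\<in>J. a i * X i \<omega>))"

definition mean_square_continuous ::
    "'w measure \<Rightarrow> ('i::topological_space \<Rightarrow> 'w \<Rightarrow> real) \<Rightarrow> bool" where
  "mean_square_continuous M X \<longleftrightarrow>
     (\<forall>i. integrable M (\<lambda>\<omega>. (X i \<omega>)\<^sup>2)) \<and>
     (\<forall>i. ((\<lambda>j. \<integral>\<omega>. (X j \<omega> - X i \<omega>)\<^sup>2 \<partial>M) \<longlongrightarrow> 0) (at i))"


section \<open>The normal distribution function and convergence in distribution\<close>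

definition std_normal_cdf :: "real \<Rightarrow> real" where
  "std_normal_cdf u = (LINT w:{..u}|lborel. std_normal_density w)"

text \<open>
  The counterpart of \<^const>\<open>weak_conv_m\<close>, with random variables indexed along an arbitrary
  filter in place of a sequence of measures. Measurability is required because \<^const>\<open>distr\<close>
  is meaningless without it.
\<close>

definition converges_in_distribution ::
    "'w measure \<Rightarrow> ('t \<Rightarrow> 'w \<Rightarrow> real) \<Rightarrow> real measure \<Rightarrow> 't filter \<Rightarrow> bool" where
  "converges_in_distribution M X N F \<longleftrightarrow>
     (\<forall>\<^sub>F T in F. X T \<in> borel_measurable M) \<and>
     (\<forall>x. isCont (cdf N) x \<longrightarrow> ((\<lambda>T. cdf (distr M borel (X T)) x) \<longlongrightarrow> cdf N x) F)"


section \<open>Sojourn time on the sphere\<close>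

definition sojourn ::
    "('a::euclidean_space \<Rightarrow> real \<Rightarrow> 'w \<Rightarrow> real) \<Rightarrow> real \<Rightarrow> real \<Rightarrow> 'w \<Rightarrow> real" where
  "sojourn Z u T \<omega> =
     (LINT t:{0..T}|lborel. (LINT x|sphere_measure. of_bool (Z x t \<omega> \<ge> u)))"

definition weighted_cov_integral :: "nat \<Rightarrow> (real \<Rightarrow> real \<Rightarrow> real) \<Rightarrow> real \<Rightarrow> real" where
  "weighted_cov_integral d C T =
     (LINT \<tau>:{0..T}|lborel. (1 - \<tau> / T) *
        (LINT z:{0..2}|lborel. z ^ (d - 2) * C z \<tau> * (1 - z\<^sup>2 / 4) powr ((real d - 3) / 2)))"

end

theory Submission
  imports Defs
begin

text \<open>
  Write \<open>1{x \<ge> u} = (1 - \<Phi> u) + \<phi> u * x + R x\<close>. The linear term integrates to an exactly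
  Gaussian variable \<open>Y\<close>, being an \<open>L\<^sup>2\<close> limit of linear combinations of the field, and its variance
  \<open>\<sigma>\<^sup>2\<close> is the quantity under the root: polar integration over the sphere turns the double integral
  of the covariance into the one-dimensional integral over the chord length. Two standard normal
  variables with correlation \<open>\<rho> \<ge> 0\<close> can be written as \<open>\<surd>\<rho> W + \<surd>(1 - \<rho>) A\<close> and \<open>\<surd>\<rho> W + \<surd>(1 - \<rho>) B\<close>
  with \<open>W, A, B\<close> independent, so their remainders have \<open>E (R X * R Y) = E (E (R X | W))\<^sup>2 = O(\<rho>\<^sup>2)\<close>
  by a first-order Taylor expansion of \<open>\<Phi>\<close>; no Hermite expansion is needed. Since the covariance
  decays uniformly, the variance of the integrated remainder is at most \<open>\<epsilon> \<sigma>\<^sup>2 + O(T)\<close>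
  for every \<open>\<epsilon>\<close>, and this is \<open>o(\<sigma>\<^sup>2)\<close> because \<open>\<sigma>\<^sup>2 / T\<close> tends to infinity.
\<close>

section \<open>Polar coordinates\<close>

text \<open>A first-order expansion suffices because conditioning on \<open>W = w\<close> moves the
  level from \<open>u\<close> to \<open>(u - sqrt \<rho> * w) / sqrt (1 - \<rho>)\<close>, a shift
  of order \<open>sqrt \<rho>\<close>, and the linear term subtracted in \<open>R\<close> is exactly
  its first-order effect. The conditional mean of \<open>R\<close> is thus of order
  \<open>\<rho>\<close>, and squaring gives the stated rate. Nonnegativity of the covariance enters
  twice: in the square root of \<open>\<rho>\<close>, and in
  \<open>\<rho>\<^sup>2 \<le> \<epsilon> * \<rho>\<close>, which bounds the contribution of distant
  times by \<open>\<epsilon>\<close> times the variance of \<open>Y\<close> itself. Pairs at bounded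
  time lag give the term \<open>O(T)\<close>. The surface measure is given through cones, without a
  slicing of the sphere by the distance to a point. The law of that distance is therefore identified
  by its moments: Gaussian integrals in polar coordinates yield the recursion that the chord density
  also satisfies, and polynomials are dense.\<close>

lemma emeasure_lborel_cone:
  fixes B :: "'a::euclidean_space set"
  assumes B: "B \<in> sets borel" and r: "r > 0"
  shows "emeasure lborel {x::'a. x \<noteq> 0 \<and> norm x \<le> r \<and> x /\<^sub>R norm x \<in> B}
    = ennreal (r ^ DIM('a)) * emeasure lborel {x::'a. x \<noteq> 0 \<and> norm x \<le> 1 \<and> x /\<^sub>R norm x \<in> B}"
proof -
  let ?K = "\<lambda>r. {x::'a. x \<noteq> 0 \<and> norm x \<le> r \<and> x /\<^sub>R norm x \<in> B}"
  have [measurable]: "B \<in> sets borel" by fact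
  have K [measurable]: "?K r \<in> sets borel" for r
    by measurable
  have "emeasure lborel (?K r)
      = emeasure (density (distr lborel borel (\<lambda>x::'a. 0 + r *\<^sub>R x)) (\<lambda>_. ennreal (\<bar>r\<bar> ^ DIM('a)))) (?K r)"
    using lborel_affine[of r "0::'a"] r by simp
  also have "\<dots> = ennreal (r ^ DIM('a)) * emeasure (distr lborel borel (\<lambda>x::'a. r *\<^sub>R x)) (?K r)"
    using r by (subst emeasure_density) (auto simp: nn_integral_cmult_indicator)
  also have "emeasure (distr lborel borel (\<lambda>x::'a. r *\<^sub>R x)) (?K r) = emeasure lborel ((\<lambda>x. r *\<^sub>R x) -` ?K r)"
    by (subst emeasure_distr) auto
  also have "(\<lambda>x. r *\<^sub>R x) -` ?K r = ?K 1"
    using r by (auto simp: field_simps)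
  finally show ?thesis .
qed

text \<open>The radial factor of Lebesgue measure. It is a density on the whole line, the half-line
  being cut out by the indicator, so that its sigma-algebra is plain \<open>borel\<close>.\<close>

definition radial_measure :: "nat \<Rightarrow> real measure" where
  "radial_measure d = density lborel (\<lambda>r. ennreal (indicator {0..} r * r ^ (d - 1)))"

lemma space_radial_measure [simp]: "space (radial_measure d) = UNIV"
  and sets_radial_measure [simp, measurable_cong]: "sets (radial_measure d) = sets borel"
  by (simp_all add: radial_measure_def)

text \<open>The divisor \<open>d\<close> cancels the factor \<open>DIM('a)\<close> carried by
  \<open>sphere_measure\<close> and leaves the pure scaling \<open>r ^ d\<close> of cones.\<close>

lemma emeasure_radial_measure_atMost:
  assumes d: "d > 0" and r: "r \<ge> 0"
  shows "emeasure (radial_measure d) {..r} = ennreal (r ^ d / d)"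
proof -
  have "emeasure (radial_measure d) {..r} = (\<integral>\<^sup>+s. ennreal (s ^ (d - 1)) * indicator {0..r} s \<partial>lborel)"
    unfolding radial_measure_def
    by (subst emeasure_density) (auto intro!: nn_integral_cong split: split_indicator)
  also have "\<dots> = ennreal (r ^ d / d - 0 ^ d / d)"
  proof (rule nn_integral_FTC_Icc)
    fix s :: real assume "s \<in> {0..r}"
    show "((\<lambda>s. s ^ d / real d) has_field_derivative s ^ (d - 1)) (at s)"
      using d by (auto intro!: derivative_eq_intros)
  qed (use r in auto)
  finally show ?thesis using d by (simp add: zero_power)
qed

lemma sigma_finite_radial_measure: "sigma_finite_measure (radial_measure d)"
proof
  have "emeasure (radial_measure d) {..real i} < \<infinity>" for i
  proof -
    have "emeasure (radial_measure d) {..real i}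
        = (\<integral>\<^sup>+s. ennreal (s ^ (d - 1)) * indicator {0..real i} s \<partial>lborel)"
      unfolding radial_measure_def
      by (subst emeasure_density) (auto intro!: nn_integral_cong split: split_indicator)
    also have "\<dots> \<le> (\<integral>\<^sup>+s. ennreal (real i ^ (d - 1)) * indicator {0..real i} s \<partial>lborel)"
      by (intro nn_integral_mono) (auto intro!: power_mono ennreal_leI split: split_indicator)
    also have "\<dots> < \<infinity>"
      by (simp add: nn_integral_cmult_indicator ennreal_mult_less_top)
    finally show ?thesis .
  qed
  moreover have "(\<Union>i. {..real i}) = UNIV"
    using real_arch_simple by auto
  ultimately show "\<exists>A. countable A \<and> A \<subseteq> sets (radial_measure d) \<and> \<Union> A = space (radial_measure d) \<and>
      (\<forall>a\<in>A. emeasure (radial_measure d) a \<noteq> \<infinity>)"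
    by (intro exI[of _ "range (\<lambda>i. {..real i})"]) (auto simp: less_top)
qed

lemma finite_measure_sphere_measure: "finite_measure (sphere_measure :: 'a::euclidean_space measure)"
  by (rule finite_measureI) (simp add: emeasure_sphere_measure_space)

text \<open>Rectangles \<open>A \<times> B\<close> suffice. For fixed \<open>B\<close> both sides
  are measures in \<open>A\<close>, and they agree on half-lines because dilating the cone over
  \<open>B\<close> by \<open>r\<close> multiplies its volume by \<open>r ^ DIM('a)\<close>. The
  origin is removed since it has no direction.\<close>

theorem lborel_polar:
  "radial_measure DIM('a) \<Otimes>\<^sub>M sphere_measure
    = distr (restrict_space lborel (- {0})) (borel \<Otimes>\<^sub>M restrict_space borel (sphere (0::'a::euclidean_space) 1))
        (\<lambda>x. (norm x, x /\<^sub>R norm x))" (is "?L = distr ?R ?S ?f")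
proof (rule pair_measure_eqI)
  interpret nu: finite_measure "sphere_measure :: 'a measure"
    by (rule finite_measure_sphere_measure)
  show "sigma_finite_measure (radial_measure DIM('a))"
    by (rule sigma_finite_radial_measure)
  show "sigma_finite_measure (sphere_measure :: 'a measure)"
    by unfold_locales
  show "sets ?L = sets (distr ?R ?S ?f)"
    by (simp cong: sets_pair_measure_cong)
  fix A :: "real set" and B :: "'a set"
  assume "A \<in> sets (radial_measure DIM('a))" and Bs: "B \<in> sets sphere_measure"
  then have A: "A \<in> sets borel" and B: "B \<in> sets borel" and Bsub: "B \<subseteq> sphere 0 1"
    by (auto simp: sets_restrict_space_iff)
  have [measurable]: "B \<in> sets borel" by fact
  have f [measurable]: "?f \<in> ?R \<rightarrow>\<^sub>M ?S"
    by (intro measurable_Pair measurable_restrict_space2)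
      (auto intro!: measurable_restrict_space1 simp: space_restrict_space)
  let ?b = "emeasure sphere_measure B"
  let ?N1 = "scale_measure ?b (radial_measure DIM('a))"
  let ?N2 = "distr (restrict_space lborel {x::'a. x \<noteq> 0 \<and> x /\<^sub>R norm x \<in> B}) borel norm"
  have N2: "emeasure ?N2 A' = emeasure lborel {x::'a. x \<noteq> 0 \<and> norm x \<in> A' \<and> x /\<^sub>R norm x \<in> B}"
    if "A' \<in> sets borel" for A'
  proof -
    have [measurable]: "A' \<in> sets borel" by fact
    show ?thesis
      by (subst emeasure_distr, (auto intro!: measurable_restrict_space1)[2])
        (subst emeasure_restrict_space, auto intro!: arg_cong[where f="emeasure lborel"] simp: space_restrict_space)
  qed
  have eq: "emeasure ?N1 {..r} = emeasure ?N2 {..r}" for r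
  proof (cases "r > 0")
    case True
    have "emeasure ?N2 {..r} = emeasure lborel {x::'a. x \<noteq> 0 \<and> norm x \<le> r \<and> x /\<^sub>R norm x \<in> B}"
      by (simp add: N2)
    also have "\<dots> = ennreal (r ^ DIM('a)) * emeasure lborel {x::'a. x \<noteq> 0 \<and> norm x \<le> 1 \<and> x /\<^sub>R norm x \<in> B}"
      by (rule emeasure_lborel_cone[OF B True])
    finally have 1: "emeasure ?N2 {..r} = \<dots>" .
    have "?b = of_nat DIM('a) * emeasure lborel {x::'a. x \<noteq> 0 \<and> norm x \<le> 1 \<and> x /\<^sub>R norm x \<in> B}"
      using emeasure_sphere_measure[of B] Bs by simp
    then have "emeasure ?N1 {..r} = ennreal (real DIM('a)) * emeasure lborel {x::'a. x \<noteq> 0 \<and> norm x \<le> 1 \<and> x /\<^sub>R norm x \<in> B} * ennreal (r ^ DIM('a) / DIM('a))"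
      using True by (simp add: emeasure_radial_measure_atMost ennreal_of_nat_eq_real_of_nat)
    also have "\<dots> = ennreal (real DIM('a)) * ennreal (r ^ DIM('a) / DIM('a)) * emeasure lborel {x::'a. x \<noteq> 0 \<and> norm x \<le> 1 \<and> x /\<^sub>R norm x \<in> B}"
      by (simp add: mult_ac)
    also have "ennreal (real DIM('a)) * ennreal (r ^ DIM('a) / DIM('a)) = ennreal (r ^ DIM('a))"
      using True by (subst ennreal_mult[symmetric]) auto
    finally show ?thesis using 1 by simp
  next
    case False
    then have "emeasure (radial_measure DIM('a)) {..r} \<le> emeasure (radial_measure DIM('a)) {..0}"
      by (intro emeasure_mono) auto
    also have "\<dots> = 0" using emeasure_radial_measure_atMost[of "DIM('a)" 0] by (simp add: zero_power)
    finally have 1: "emeasure (radial_measure DIM('a)) {..r} = 0" by simp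
    have 2: "{x::'a. x \<noteq> 0 \<and> norm x \<le> r \<and> x /\<^sub>R norm x \<in> B} = {}"
      using False by (auto simp: not_less dest: order_trans)
    have "emeasure ?N2 {..r} = 0"
      unfolding N2[OF borel_closed[OF closed_atMost]] atMost_iff 2 by simp
    then show ?thesis using 1 by simp
  qed
  have "?N1 = ?N2"
  proof (rule measure_eqI_generator_eq[where E="range (\<lambda>a. {..a})" and \<Omega>=UNIV and A="\<lambda>i. {..real i}"])
    show "Int_stable (range (\<lambda>a::real. {..a}))"
      by (auto simp: Int_stable_def)
    show "sets ?N1 = sigma_sets UNIV (range (\<lambda>a. {..a}))" "sets ?N2 = sigma_sets UNIV (range (\<lambda>a. {..a}))"
      by (simp_all add: borel_eq_atMost)
    show "(\<Union>i. {..real i}) = UNIV" 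
      using real_arch_simple by auto
    show "emeasure ?N1 {..real i} \<noteq> \<infinity>" for i
      using emeasure_radial_measure_atMost[of "DIM('a)" "real i"] nu.emeasure_finite[of B]
      by (simp add: ennreal_mult_eq_top_iff)
  qed (use eq in auto)
  then have "emeasure ?N1 A = emeasure ?N2 A" by simp
  then have "emeasure (radial_measure DIM('a)) A * ?b = emeasure ?N2 A"
    by (simp add: mult.commute)
  also have "\<dots> = emeasure (distr ?R ?S ?f) (A \<times> B)"
  proof -
    have [measurable]: "A \<in> sets borel" by fact
    have "A \<times> B \<in> sets ?S" using A Bs by auto
    then have "emeasure (distr ?R ?S ?f) (A \<times> B) = emeasure ?R (?f -` (A \<times> B) \<inter> space ?R)"
      by (rule emeasure_distr[OF f])
    also have "?f -` (A \<times> B) \<inter> space ?R = {x::'a. x \<noteq> 0 \<and> norm x \<in> A \<and> x /\<^sub>R norm x \<in> B}"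
      by (auto simp: space_restrict_space)
    also have "emeasure ?R \<dots> = emeasure lborel \<dots>"
      by (rule emeasure_restrict_space) auto
    finally show ?thesis using N2[OF A] by simp
  qed
  finally show "emeasure (radial_measure DIM('a)) A * ?b = emeasure (distr ?R ?S ?f) (A \<times> B)" .
qed

text \<open>Fubini for a product integrand on the product of radial and surface measure;
  \<open>has_bochner_integral\<close> transports integrability and value together.\<close>

lemma has_bochner_integral_polar:
  fixes g :: "real \<Rightarrow> real" and h :: "'a::euclidean_space \<Rightarrow> real"
  assumes [measurable]: "g \<in> borel_measurable borel" "h \<in> borel_measurable borel"
    and g: "has_bochner_integral lborel (\<lambda>r. indicator {0..} r * (g r * r ^ (DIM('a) - 1))) a"
    and h: "integrable sphere_measure h"
  shows "has_bochner_integral lborel (\<lambda>x. g (norm x) * h (x /\<^sub>R norm x)) (a * (\<integral>s. h s \<partial>sphere_measure))"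
proof -
  let ?R = "restrict_space lborel (- {0::'a})"
  let ?S = "borel \<Otimes>\<^sub>M restrict_space borel (sphere (0::'a) 1)"
  let ?f = "\<lambda>x::'a. (norm x, x /\<^sub>R norm x)"
  let ?P = "radial_measure DIM('a) \<Otimes>\<^sub>M (sphere_measure :: 'a measure)"
  interpret nu: finite_measure "sphere_measure :: 'a measure"
    by (rule finite_measure_sphere_measure)
  interpret rm: sigma_finite_measure "radial_measure DIM('a)"
    by (rule sigma_finite_radial_measure)
  interpret pair_sigma_finite "radial_measure DIM('a)" "sphere_measure :: 'a measure" ..
  have [measurable]: "h \<in> borel_measurable sphere_measure"
    using h by auto
  have f [measurable]: "?f \<in> ?R \<rightarrow>\<^sub>M ?S"
    by (intro measurable_Pair measurable_restrict_space2)
      (auto intro!: measurable_restrict_space1 simp: space_restrict_space)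
  have g': "has_bochner_integral (radial_measure DIM('a)) g a"
    unfolding radial_measure_def
    by (rule has_bochner_integral_density) (use g in \<open>auto simp: mult_ac split: split_indicator\<close>)
  have gh: "integrable ?P (\<lambda>(r, s). g r * h s)"
  proof (rule Fubini_integrable)
    show "integrable (radial_measure DIM('a)) (\<lambda>x. \<integral>y. norm (case (x, y) of (r, s) \<Rightarrow> g r * h s) \<partial>sphere_measure)"
      using g' by (auto simp: abs_mult has_bochner_integral_iff)
    show "AE x in radial_measure DIM('a). integrable sphere_measure (\<lambda>y. case (x, y) of (r, s) \<Rightarrow> g r * h s)"
      using h by auto
  qed measurable
  have int: "(\<integral>p. (case p of (r, s) \<Rightarrow> g r * h s) \<partial>?P) = a * (\<integral>s. h s \<partial>sphere_measure)"
    using integral_fst'[OF gh] g' by (simp add: has_bochner_integral_iff)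
  have hb: "has_bochner_integral ?P (\<lambda>(r, s). g r * h s) (a * (\<integral>s. h s \<partial>sphere_measure))"
    using gh int by (simp add: has_bochner_integral_iff)
  have m: "(\<lambda>(r, s). g r * h s) \<in> borel_measurable ?S"
    using borel_measurable_integrable[OF gh] by (simp cong: measurable_cong_sets sets_pair_measure_cong)
  have "has_bochner_integral ?R (\<lambda>x. g (norm x) * h (x /\<^sub>R norm x)) (a * (\<integral>s. h s \<partial>sphere_measure))"
    using hb unfolding lborel_polar has_bochner_integral_iff
    by (simp add: integrable_distr_eq[OF f m] integral_distr[OF f m])
  then have "has_bochner_integral lborel (\<lambda>x. indicator (- {0}) x *\<^sub>R (g (norm x) * h (x /\<^sub>R norm x))) (a * (\<integral>s. h s \<partial>sphere_measure))"
    by (subst (asm) has_bochner_integral_restrict_space) auto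
  \<comment> \<open>The excluded origin is a null set, so the integral extends to the whole space
    unchanged.\<close>
  moreover have "AE x in lborel. x \<noteq> (0::'a)"
    by (rule AE_lborel_singleton)
  then have "AE x in lborel. indicator (- {0}) x *\<^sub>R (g (norm x) * h (x /\<^sub>R norm x)) = g (norm x) * h (x /\<^sub>R norm x)"
    by eventually_elim simp
  ultimately show ?thesis
    by (subst (asm) has_bochner_integral_cong_AE) auto
qed

section \<open>Moments of the surface measure\<close>

text \<open>The value is \<open>Gamma ((n + 1) / 2) / 2\<close>. The moments of the surface measure
  rely on its positivity and its two-step recursion; the value itself cancels.\<close>

definition radial_gauss_moment :: "nat \<Rightarrow> real" where
  "radial_gauss_moment n = (\<integral>r. indicator {0..} r * (exp (- r\<^sup>2) * r ^ n) \<partial>lborel)"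

lemma has_bochner_integral_radial_gauss:
  "has_bochner_integral lborel (\<lambda>r. indicator {0..} r * (exp (- r\<^sup>2) * r ^ n)) (radial_gauss_moment n)"
proof -
  have "integrable lborel (\<lambda>r::real. indicator {0..} r * (exp (- r\<^sup>2) * r ^ n))"
  proof (cases "even n")
    case True
    then obtain k where "n = 2 * k" by (elim evenE)
    then show ?thesis using gaussian_moment_even_pos[of k] by (simp add: has_bochner_integral_iff)
  next
    case False
    then obtain k where "n = 2 * k + 1" by (elim oddE)
    then show ?thesis using gaussian_moment_odd_pos[of k] by (simp add: has_bochner_integral_iff)
  qed
  then show ?thesis by (simp add: radial_gauss_moment_def has_bochner_integral_iff)
qed

lemma radial_gauss_moment_even: "radial_gauss_moment (2 * k) = (sqrt pi / 2) * (fact (2 * k) / (2 ^ (2 * k) * fact k))"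
  and radial_gauss_moment_odd: "radial_gauss_moment (2 * k + 1) = fact k / 2"
  using gaussian_moment_even_pos[of k] gaussian_moment_odd_pos[of k]
  by (simp_all add: radial_gauss_moment_def has_bochner_integral_iff)

lemma radial_gauss_moment_pos: "radial_gauss_moment n > 0"
proof (cases "even n")
  case True
  then obtain k where "n = 2 * k" by (elim evenE)
  then show ?thesis by (simp add: radial_gauss_moment_even)
next
  case False
  then obtain k where "n = 2 * k + 1" by (elim oddE)
  then show ?thesis by (simp only: radial_gauss_moment_odd) simp
qed

text \<open>Analytically an integration by parts; here it is read off from the closed forms for even
  and odd exponents.\<close>

lemma radial_gauss_moment_rec: "radial_gauss_moment (n + 2) = (real n + 1) / 2 * radial_gauss_moment n"
proof (cases "even n")
  case True
  then obtain k where n: "n = 2 * k" by (elim evenE)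
  have "radial_gauss_moment (2 * (k + 1)) = (real (2 * k) + 1) / 2 * radial_gauss_moment (2 * k)"
    unfolding radial_gauss_moment_even by (simp add: divide_simps) (simp add: algebra_simps)
  then show ?thesis using n by simp
next
  case False
  then obtain k where n: "n = 2 * k + 1" by (elim oddE)
  have "radial_gauss_moment (2 * (k + 1) + 1) = (real (2 * k + 1) + 1) / 2 * radial_gauss_moment (2 * k + 1)"
    unfolding radial_gauss_moment_odd by (simp add: field_simps)
  then show ?thesis using n by simp
qed

lemma has_bochner_integral_lborel_translate:
  fixes f :: "'a::euclidean_space \<Rightarrow> real"
  assumes "has_bochner_integral lborel f a"
  shows "has_bochner_integral lborel (\<lambda>x. f (c + x)) a"
proof -
  have [measurable]: "f \<in> borel_measurable borel"
    using assms by (auto simp: has_bochner_integral_iff)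
  have "has_bochner_integral (distr lborel borel ((+) c)) f a"
    using assms by (simp add: lborel_distr_plus)
  then show ?thesis
    by (simp add: has_bochner_integral_iff integrable_distr_eq integral_distr)
qed

text \<open>
  Both the moments of the surface measure in a fixed direction and those of the chord length below
  are determined by the same two-step recursion \<open>(k + 1) m\<^sub>k = (d + k) m\<^sub>k\<^sub>+\<^sub>2\<close>. For the sphere it comes
  from integrating the derivative of \<open>(x \<bullet> y) ^ (k + 1) * exp (- (norm x)\<^sup>2)\<close> along \<open>y\<close>.
\<close>

lemma integral_directional_derivative_eq_0:
  fixes F D :: "'a::euclidean_space \<Rightarrow> real" and y :: 'a
  assumes F: "integrable lborel F" and D: "integrable lborel D" and contD: "continuous_on UNIV D"
    and deriv: "\<And>x s. ((\<lambda>s. F (x + s *\<^sub>R y)) has_field_derivative D (x + s *\<^sub>R y)) (at s)"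
  shows "(\<integral>x. D x \<partial>lborel) = 0"
proof -
  \<comment> \<open>This double integral is evaluated in both orders. Integrating over
    \<open>x\<close> first gives the integral of \<open>D\<close> for every \<open>s\<close>, by
    translation invariance; integrating over \<open>s\<close> first gives
    \<open>F (x + y) - F x\<close>, whose integral is 0 for the same reason.\<close>
  let ?f = "\<lambda>(s, x). indicator {0..1::real} s * D (x + s *\<^sub>R y)"
  have [measurable]: "D \<in> borel_measurable borel"
    using D by auto
  have tr: "has_bochner_integral lborel (\<lambda>x. D (x + s *\<^sub>R y)) (\<integral>x. D x \<partial>lborel)" for s
    using has_bochner_integral_lborel_translate[of D "\<integral>x. D x \<partial>lborel" "s *\<^sub>R y"] D
    by (simp add: has_bochner_integral_iff add.commute)
  have trn: "has_bochner_integral lborel (\<lambda>x. \<bar>D (x + s *\<^sub>R y)\<bar>) (\<integral>x. \<bar>D x\<bar> \<partial>lborel)" for s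
    using has_bochner_integral_lborel_translate[of "\<lambda>x. \<bar>D x\<bar>" "\<integral>x. \<bar>D x\<bar> \<partial>lborel" "s *\<^sub>R y"] D
    by (simp add: has_bochner_integral_iff add.commute)
  have int: "integrable (lborel \<Otimes>\<^sub>M lborel) ?f"
  proof (rule lborel_pair.Fubini_integrable)
    have "(\<integral>x. norm (?f (s, x)) \<partial>lborel) = indicator {0..1} s * (\<integral>x. \<bar>D x\<bar> \<partial>lborel)" for s
      using trn[of s] by (simp add: abs_mult has_bochner_integral_iff)
    then show "integrable lborel (\<lambda>s. \<integral>x. norm (?f (s, x)) \<partial>lborel)" by simp
    show "AE s in lborel. integrable lborel (\<lambda>x. ?f (s, x))"
      using tr by (auto simp: has_bochner_integral_iff)
  qed measurable
  have "(\<integral>s. \<integral>x. ?f (s, x) \<partial>lborel \<partial>lborel) = (\<integral>s. indicator {0..1::real} s * (\<integral>x. D x \<partial>lborel) \<partial>lborel)"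
    using tr by (simp add: has_bochner_integral_iff)
  then have 1: "(\<integral>s. \<integral>x. ?f (s, x) \<partial>lborel \<partial>lborel) = (\<integral>x. D x \<partial>lborel)"
    by simp
  have "(\<integral>s. ?f (s, x) \<partial>lborel) = F (x + y) - F x" for x
  proof -
    have "(\<integral>s. indicator {0..1} s *\<^sub>R D (x + s *\<^sub>R y) \<partial>lborel) = F (x + 1 *\<^sub>R y) - F (x + 0 *\<^sub>R y)"
    proof (rule integral_FTC_Icc)
      show "((\<lambda>s. F (x + s *\<^sub>R y)) has_vector_derivative D (x + s *\<^sub>R y)) (at s within {0..1})" for s
        using deriv[of x s] by (auto simp: has_real_derivative_iff_has_vector_derivative intro: has_vector_derivative_at_within)
      show "continuous_on {0..1} (\<lambda>s. D (x + s *\<^sub>R y))"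
        by (rule continuous_on_compose2[OF contD]) (auto intro!: continuous_intros)
    qed simp
    then show ?thesis by simp
  qed
  then have "(\<integral>x. \<integral>s. ?f (s, x) \<partial>lborel \<partial>lborel) = (\<integral>x. F (x + y) - F x \<partial>lborel)" by simp
  also have "\<dots> = 0"
    using has_bochner_integral_lborel_translate[of F "\<integral>x. F x \<partial>lborel" y] F
    by (subst Bochner_Integration.integral_diff) (auto simp: has_bochner_integral_iff add.commute)
  finally show ?thesis
    using lborel_pair.Fubini_integral[OF int] 1 by simp
qed

definition sphere_moment :: "'a::euclidean_space \<Rightarrow> nat \<Rightarrow> real" where
  "sphere_moment y k = (\<integral>s. (s \<bullet> y) ^ k \<partial>sphere_measure)"

lemma integrable_sphere_measure_continuous:
  fixes f :: "'a::euclidean_space \<Rightarrow> real"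
  assumes "continuous_on (sphere 0 1) f"
  shows "integrable sphere_measure f"
proof -
  interpret finite_measure "sphere_measure :: 'a measure"
    by (rule finite_measure_sphere_measure)
  obtain B where "\<forall>x\<in>sphere 0 1. norm (f x) \<le> B"
    using compact_imp_bounded[OF compact_continuous_image[OF assms compact_sphere]]
    by (auto simp: bounded_iff)
  moreover have "f \<in> borel_measurable sphere_measure"
    using borel_measurable_continuous_on_restrict[OF assms] by (simp cong: measurable_cong_sets)
  ultimately show ?thesis
    by (intro integrable_const_bound[where B=B]) auto
qed

text \<open>\<open>(x \<bullet> y) ^ k\<close> is homogeneous of degree \<open>k\<close>, so polar
  coordinates move \<open>norm x ^ k\<close> into the radial Gaussian integral and leave the moment
  on the sphere.\<close>

lemma has_bochner_integral_gauss_moment: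
  fixes y :: "'a::euclidean_space"
  shows "has_bochner_integral lborel (\<lambda>x. (x \<bullet> y) ^ k * exp (- (norm x)\<^sup>2))
    (radial_gauss_moment (DIM('a) - 1 + k) * sphere_moment y k)"
proof -
  have "has_bochner_integral lborel (\<lambda>x::'a. (exp (- (norm x)\<^sup>2) * norm x ^ k) * ((x /\<^sub>R norm x) \<bullet> y) ^ k)
      (radial_gauss_moment (DIM('a) - 1 + k) * (\<integral>s. (s \<bullet> y) ^ k \<partial>sphere_measure))"
  proof (rule has_bochner_integral_polar)
    show "has_bochner_integral lborel (\<lambda>r. indicator {0..} r * (exp (- r\<^sup>2) * r ^ k * r ^ (DIM('a) - 1))) (radial_gauss_moment (DIM('a) - 1 + k))"
    proof -
      have "exp (- r\<^sup>2) * r ^ k * r ^ (DIM('a) - 1) = exp (- r\<^sup>2) * r ^ (DIM('a) - 1 + k)" for r :: real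
        by (simp only: power_add mult_ac)
      then show ?thesis
        using has_bochner_integral_radial_gauss[of "DIM('a) - 1 + k"] by (simp only:)
    qed
    show "integrable sphere_measure (\<lambda>s::'a. (s \<bullet> y) ^ k)"
      by (intro integrable_sphere_measure_continuous continuous_intros)
  qed measurable
  \<comment> \<open>At the origin the projected vector is 0, and both sides are 0 for
    \<open>k > 0\<close> and 1 for \<open>k = 0\<close>; hence the two case splits.\<close>
  moreover have "(exp (- (norm x)\<^sup>2) * norm x ^ k) * ((x /\<^sub>R norm x) \<bullet> y) ^ k = (x \<bullet> y) ^ k * exp (- (norm x)\<^sup>2)" for x :: 'a
    by (cases "x = 0"; cases "k = 0") (auto simp: power_mult_distrib power_inverse field_simps)
  ultimately show ?thesis by (simp only: sphere_moment_def)
qed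

text \<open>The directional derivative has the terms \<open>(k + 1) * (x \<bullet> y) ^ k\<close>
  and \<open>- 2 * (x \<bullet> y) ^ (k + 2)\<close>, each times the Gaussian. Their radial moments
  have indices differing by 2, and the ratio \<open>(DIM('a) + k) / 2\<close> of these moments
  produces the coefficient on the right.\<close>

lemma sphere_moment_rec:
  fixes y :: "'a::euclidean_space"
  assumes y: "norm y = 1"
  shows "(real k + 1) * sphere_moment y k = (real DIM('a) + real k) * sphere_moment y (k + 2)"
proof -
  let ?G = "\<lambda>k (x::'a). (x \<bullet> y) ^ k * exp (- (norm x)\<^sup>2)"
  let ?m = "\<lambda>k. radial_gauss_moment (DIM('a) - 1 + k) * sphere_moment y k"
  let ?D = "\<lambda>x. (real k + 1) * ?G k x - 2 * ?G (k + 2) x"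
  have m: "has_bochner_integral lborel (?G j) (?m j)" for j
    by (rule has_bochner_integral_gauss_moment)
  have hD: "has_bochner_integral lborel ?D ((real k + 1) * ?m k - 2 * ?m (k + 2))"
    by (intro has_bochner_integral_diff has_bochner_integral_mult_right m)
  have "(\<integral>x. ?D x \<partial>lborel) = 0"
  proof (rule integral_directional_derivative_eq_0[where y = y and F = "?G (Suc k)"])
    show "integrable lborel (?G (Suc k))" using m[of "Suc k"] by (simp add: has_bochner_integral_iff)
    show "integrable lborel ?D" using hD by (simp add: has_bochner_integral_iff)
    show "continuous_on UNIV ?D" by (intro continuous_intros)
    fix x :: 'a and s :: real
    have yy: "y \<bullet> y = 1" using y by (simp add: norm_eq_1)
    have e: "?G j (x + s *\<^sub>R y) = (x \<bullet> y + s) ^ j * exp (- (x \<bullet> x + 2 * s * (x \<bullet> y) + s\<^sup>2))" for j s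
      unfolding power2_norm_eq_inner using yy
      by (simp add: inner_add_left inner_add_right inner_commute power2_eq_square algebra_simps)
    define a where "a = x \<bullet> y"
    have P: "((\<lambda>s. (a + s) ^ Suc k) has_field_derivative (real k + 1) * (a + s) ^ k) (at s)"
      by (rule DERIV_cong[OF DERIV_power[of "\<lambda>s. a + s" 1]]) (auto intro!: derivative_eq_intros)
    have Q: "((\<lambda>s. exp (- (x \<bullet> x + 2 * s * a + s\<^sup>2))) has_field_derivative
        exp (- (x \<bullet> x + 2 * s * a + s\<^sup>2)) * (- 2 * (a + s))) (at s)"
      by (auto intro!: derivative_eq_intros)
    show "((\<lambda>s. ?G (Suc k) (x + s *\<^sub>R y)) has_field_derivative ?D (x + s *\<^sub>R y)) (at s)"
      unfolding e a_def[symmetric] by (rule DERIV_cong[OF DERIV_mult[OF P Q]]) (simp add: algebra_simps)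
  qed
  then have "(real k + 1) * ?m k = 2 * ?m (k + 2)"
    using hD by (simp add: has_bochner_integral_iff)
  moreover have "radial_gauss_moment (DIM('a) - 1 + (k + 2)) = (real DIM('a) + real k) / 2 * radial_gauss_moment (DIM('a) - 1 + k)"
  proof -
    have "DIM('a) - 1 + (k + 2) = (DIM('a) - 1 + k) + 2" by simp
    moreover have "real (DIM('a) - 1 + k) + 1 = real DIM('a) + real k"
      using DIM_positive[where 'a='a] by linarith
    ultimately show ?thesis
      using radial_gauss_moment_rec[of "DIM('a) - 1 + k"] by (simp only:)
  qed
  ultimately have "(real k + 1) * (radial_gauss_moment (DIM('a) - 1 + k) * sphere_moment y k)
      = 2 * ((real DIM('a) + real k) / 2 * radial_gauss_moment (DIM('a) - 1 + k) * sphere_moment y (k + 2))"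
    by (simp only:)
  then have "radial_gauss_moment (DIM('a) - 1 + k) * ((real k + 1) * sphere_moment y k)
      = radial_gauss_moment (DIM('a) - 1 + k) * ((real DIM('a) + real k) * sphere_moment y (k + 2))"
    by (simp only: mult_ac) simp
  then show ?thesis using radial_gauss_moment_pos[of "DIM('a) - 1 + k"] by simp
qed

text \<open>Reflection in the origin preserves Lebesgue measure and changes the sign of the Gaussian
  integral. This is the starting value for odd exponents.\<close>

lemma sphere_moment_1: 
  fixes y :: "'a::euclidean_space"
  shows "sphere_moment y 1 = 0"
proof -
  let ?G = "\<lambda>(x::'a). (x \<bullet> y) * exp (- (norm x)\<^sup>2)"
  have "(\<integral>x. ?G x \<partial>lborel) = (\<integral>x. ?G x \<partial>distr lborel borel uminus)"
    using lborel_affine[of "-1" "0::'a"] by (simp add: density_1)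
  also have "\<dots> = - (\<integral>x. ?G x \<partial>lborel)"
    using integral_distr[of uminus lborel borel ?G] by simp
  finally have "(\<integral>x. ?G x \<partial>lborel) = 0" by simp
  then show ?thesis
    using has_bochner_integral_gauss_moment[of y 1] radial_gauss_moment_pos[of "DIM('a) - 1 + 1"]
    by (simp add: has_bochner_integral_iff)
qed

section \<open>Chord length on the sphere\<close>

text \<open>Up to a constant, the density of the distance from a fixed point of the unit sphere to a
  uniformly distributed one. For \<open>d = 2\<close> it is unbounded near \<open>z = 2\<close>; at
  \<open>z = 2\<close> itself its value is 0, because \<open>0 powr a = 0\<close>.\<close>

definition chord_weight :: "nat \<Rightarrow> real \<Rightarrow> real" where
  "chord_weight d z = z ^ (d - 2) * (1 - z\<^sup>2 / 4) powr ((real d - 3) / 2)"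

lemma borel_measurable_chord_weight [measurable]: "chord_weight d \<in> borel_measurable borel"
  unfolding chord_weight_def by measurable

lemma chord_weight_nonneg: "z \<ge> 0 \<Longrightarrow> chord_weight d z \<ge> 0"
  by (simp add: chord_weight_def)

lemma chord_base: "0 < 1 - z\<^sup>2 / 4" if "0 \<le> z" "z < 2" for z :: real
proof -
  have "z * z < 2 * 2" using that by (intro mult_strict_mono) auto
  then show ?thesis by (simp add: power2_eq_square)
qed

text \<open>The singular dimension. The primitive \<open>2 * arcsin (z / 2)\<close> is continuous up
  to the endpoint although its derivative blows up there, and nonnegativity turns the gauge integral
  into a Lebesgue integral.\<close>

lemma set_integrable_chord_weight_2: "set_integrable lborel {0..2} (chord_weight 2)"
  and integral_chord_weight_2: "(LINT z:{0..2}|lborel. chord_weight 2 z) = pi"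
proof -
  have "(chord_weight 2 has_integral (2 * arcsin (2 / 2) - 2 * arcsin (0 / 2))) {0..2}"
  proof (rule fundamental_theorem_of_calculus_interior)
    show "continuous_on {0..2} (\<lambda>z. 2 * arcsin (z / 2))"
      by (intro continuous_intros) auto
    fix z :: real assume z: "z \<in> {0<..<2}"
    have "chord_weight 2 z = (1 - z\<^sup>2 / 4) powr - (1 / 2)"
      by (simp add: chord_weight_def)
    also have "\<dots> = inverse (sqrt (1 - (z / 2)\<^sup>2))"
      using z chord_base[of z] by (simp only: powr_minus powr_half_sqrt) (simp add: powr_half_sqrt power_divide)
    finally have "chord_weight 2 z = 1 / sqrt (1 - (z / 2)\<^sup>2)"
      by (simp only: inverse_eq_divide)
    moreover have "((\<lambda>z. 2 * arcsin (z / 2)) has_real_derivative 1 / sqrt (1 - (z / 2)\<^sup>2)) (at z)"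
    proof -
      have "((\<lambda>z. arcsin (z / 2)) has_real_derivative inverse (sqrt (1 - (z / 2)\<^sup>2)) * (1 / 2)) (at z)"
        using z by (intro DERIV_chain2[OF DERIV_arcsin] derivative_eq_intros refl) auto
      from DERIV_cmult[OF this, of 2] show ?thesis by (simp add: inverse_eq_divide)
    qed
    ultimately show "((\<lambda>z. 2 * arcsin (z / 2)) has_vector_derivative chord_weight 2 z) (at z)"
      by (simp add: has_real_derivative_iff_has_vector_derivative)
  qed simp
  then have I: "(chord_weight 2 has_integral pi) {0..2}" by simp
  then have "set_integrable lebesgue {0..2} (chord_weight 2)"
    by (intro nonnegative_absolutely_integrable_1) (auto intro: chord_weight_nonneg has_integral_integrable)
  then show i: "set_integrable lborel {0..2} (chord_weight 2)"
    unfolding set_integrable_def by (subst (asm) integrable_completion) auto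
  show "(LINT z:{0..2}|lborel. chord_weight 2 z) = pi"
    using set_borel_integral_eq_integral(2)[OF i] I by (simp add: integral_unique)
qed

text \<open>The weight for \<open>d = 2\<close> dominates all others up to a factor:
  \<open>z ^ (d - 2) \<le> 2 ^ (d - 2)\<close>, and on a base in \<open>(0, 1]\<close> the power
  decreases when the exponent rises from \<open>- 1 / 2\<close> to
  \<open>(d - 3) / 2\<close>.\<close>

lemma set_integrable_chord_weight_mult:
  assumes d: "d \<ge> 2" and [measurable]: "f \<in> borel_measurable borel"
    and B: "\<And>z. z \<in> {0..2} \<Longrightarrow> \<bar>f z\<bar> \<le> B"
  shows "set_integrable lborel {0..2} (\<lambda>z. f z * chord_weight d z)"
proof -
  have B0: "B \<ge> 0" using B[of 0] by auto
  have le: "chord_weight d z \<le> 2 ^ (d - 2) * chord_weight 2 z" if z: "z \<in> {0..2}" for z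
  proof (cases "z = 2")
    case False
    have 1: "z ^ (d - 2) \<le> 2 ^ (d - 2)" using z by (intro power_mono) auto
    have "(1 - z\<^sup>2 / 4) powr ((real d - 3) / 2) \<le> (1 - z\<^sup>2 / 4) powr (- 1 / 2)"
      using z False d chord_base[of z] by (intro powr_mono') auto
    then show ?thesis unfolding chord_weight_def using 1 z by (intro mult_mono) auto
  \<comment> \<open>At \<open>z = 2\<close> both sides vanish, again by
    \<open>0 powr a = 0\<close>.\<close>
  qed (simp add: chord_weight_def)
  have "set_integrable lborel {0..2} (\<lambda>z. B * 2 ^ (d - 2) * chord_weight 2 z)"
    using set_integrable_chord_weight_2 by simp
  then show ?thesis unfolding set_integrable_def
  proof (rule Bochner_Integration.integrable_bound)
    show "AE z in lborel. norm (indicator {0..2} z *\<^sub>R (f z * chord_weight d z))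
        \<le> norm (indicator {0..2} z *\<^sub>R (B * 2 ^ (d - 2) * chord_weight 2 z))"
    proof (rule AE_I2)
      fix z :: real
      have "\<bar>f z\<bar> * chord_weight d z \<le> B * (2 ^ (d - 2) * chord_weight 2 z)" if "z \<in> {0..2}"
        using B[OF that] le[OF that] chord_weight_nonneg[of z] that B0 by (intro mult_mono) auto
      then show "norm (indicator {0..2} z *\<^sub>R (f z * chord_weight d z))
        \<le> norm (indicator {0..2} z *\<^sub>R (B * 2 ^ (d - 2) * chord_weight 2 z))"
        using chord_weight_nonneg[of z] B0 by (auto simp: abs_mult mult.assoc split: split_indicator)
    qed
  qed measurable
qed

text \<open>Unit vectors at distance \<open>z\<close> have inner product
  \<open>1 - z\<^sup>2 / 2\<close>, so this is the counterpart of \<open>sphere_moment\<close> in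
  the chord variable.\<close>

definition chord_moment :: "nat \<Rightarrow> nat \<Rightarrow> real" where
  "chord_moment d k = (LINT z:{0..2}|lborel. (1 - z\<^sup>2 / 2) ^ k * chord_weight d z)"

lemma chord_cos_bound: "\<bar>1 - z\<^sup>2 / 2\<bar> \<le> 1" if "z \<in> {0..2}" for z :: real
proof -
  have "z * z \<le> 2 * 2" using that by (intro mult_mono) auto
  then show ?thesis by (auto simp: power2_eq_square abs_le_iff)
qed

lemma set_integrable_chord_moment:
  assumes d: "d \<ge> 2"
  shows "set_integrable lborel {0..2} (\<lambda>z. (1 - z\<^sup>2 / 2) ^ k * chord_weight d z)"
proof (rule set_integrable_chord_weight_mult[OF d])
  fix z :: real assume "z \<in> {0..2}"
  then show "\<bar>(1 - z\<^sup>2 / 2) ^ k\<bar> \<le> 1"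
    unfolding power_abs by (intro power_le_one chord_cos_bound abs_ge_zero)
qed measurable

text \<open>The substitution \<open>s = 1 - z\<^sup>2 / 2\<close> turns the chord weight into \<open>(1 - s\<^sup>2) powr ((d - 3) / 2) ds\<close>.\<close>

lemma chord_deriv:
  assumes d: "d \<ge> 2" and z: "z \<in> {0<..<2}"
  shows "((\<lambda>z. (z\<^sup>2 * (1 - z\<^sup>2 / 4)) powr ((real d - 1) / 2)) has_real_derivative
    (real d - 1) * (1 - z\<^sup>2 / 2) * chord_weight d z) (at z)"
    and "(z\<^sup>2 * (1 - z\<^sup>2 / 4)) powr ((real d - 1) / 2) = chord_weight d z * z * (1 - z\<^sup>2 / 4)"
proof -
  have b: "1 - z\<^sup>2 / 4 > 0" using z chord_base[of z] by auto
  define e where "e = (real d - 3) / 2"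
  have de: "(real d - 1) / 2 = e + 1" by (simp add: e_def field_simps)
  have zp: "(z\<^sup>2) powr e * z = z ^ (d - 2)"
  proof -
    have "(z\<^sup>2) powr e = z powr (2 * e)"
      using z by (simp add: powr_powr flip: powr_numeral)
    then have "(z\<^sup>2) powr e * z = z powr (2 * e + 1)"
      using z by (simp add: powr_add)
    also have "2 * e + 1 = real (d - 2)" using d by (simp add: e_def of_nat_diff field_simps)
    finally show ?thesis using z by (simp add: powr_realpow)
  qed
  \<comment> \<open>With \<open>s = 1 - z\<^sup>2 / 2\<close> the base is
    \<open>1 - s\<^sup>2\<close>, and the extra factor \<open>z\<close> is the Jacobian of the
    substitution.\<close>
  have cw: "(z\<^sup>2 * (1 - z\<^sup>2 / 4)) powr e * z = chord_weight d z"
    unfolding chord_weight_def e_def[symmetric] zp[symmetric] using z b by (simp add: powr_mult)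
  have pos: "z\<^sup>2 * (1 - z\<^sup>2 / 4) > 0" using z b by simp
  have "((\<lambda>z. (z\<^sup>2 * (1 - z\<^sup>2 / 4)) powr (e + 1)) has_real_derivative
      (e + 1) * (z\<^sup>2 * (1 - z\<^sup>2 / 4)) powr e * (2 * z * (1 - z\<^sup>2 / 4) + z\<^sup>2 * (- (2 * z / 4)))) (at z)"
    using pos by (auto intro!: derivative_eq_intros DERIV_powr[THEN DERIV_cong] simp: )
  also have "(e + 1) * (z\<^sup>2 * (1 - z\<^sup>2 / 4)) powr e * (2 * z * (1 - z\<^sup>2 / 4) + z\<^sup>2 * (- (2 * z / 4)))
      = 2 * (e + 1) * (1 - z\<^sup>2 / 2) * ((z\<^sup>2 * (1 - z\<^sup>2 / 4)) powr e * z)"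
    by (simp add: algebra_simps power2_eq_square)
  also have "2 * (e + 1) = real d - 1" by (simp add: e_def field_simps)
  finally show "((\<lambda>z. (z\<^sup>2 * (1 - z\<^sup>2 / 4)) powr ((real d - 1) / 2)) has_real_derivative
    (real d - 1) * (1 - z\<^sup>2 / 2) * chord_weight d z) (at z)"
    unfolding de cw .
  show "(z\<^sup>2 * (1 - z\<^sup>2 / 4)) powr ((real d - 1) / 2) = chord_weight d z * z * (1 - z\<^sup>2 / 4)"
    unfolding de cw[symmetric] powr_add using pos by (simp add: power2_eq_square)
qed

text \<open>The base vanishes at both endpoints, where continuity of \<open>powr\<close> relies on
  the exponent being positive.\<close>

lemma continuous_on_chord:
  assumes d: "d \<ge> 2"
  shows "continuous_on {0..2} (\<lambda>z::real. (z\<^sup>2 * (1 - z\<^sup>2 / 4)) powr ((real d - 1) / 2))"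
proof (rule continuous_on_powr')
  have "z\<^sup>2 * (1 - z\<^sup>2 / 4) \<ge> 0" if "z \<in> {0..2}" for z :: real
    using that chord_base[of z] by (cases "z = 2") auto
  then show "\<forall>z\<in>{0..2}. (0::real) \<le> z\<^sup>2 * (1 - z\<^sup>2 / 4) \<and> (z\<^sup>2 * (1 - z\<^sup>2 / 4) = 0 \<longrightarrow> 0 < (real d - 1) / 2)"
    using d by auto
qed (intro continuous_intros; simp)+

text \<open>By \<open>chord_deriv\<close> the integrand is, up to the factor \<open>d - 1\<close>,
  the derivative of a function that vanishes at both ends.\<close>

lemma chord_moment_1:
  assumes d: "d \<ge> 2" shows "chord_moment d 1 = 0"
proof -
  let ?P = "\<lambda>z::real. (z\<^sup>2 * (1 - z\<^sup>2 / 4)) powr ((real d - 1) / 2)"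
  have "((\<lambda>z. (real d - 1) * (1 - z\<^sup>2 / 2) * chord_weight d z) has_integral (?P 2 - ?P 0)) {0..2}"
    by (rule fundamental_theorem_of_calculus_interior)
      (auto simp flip: has_real_derivative_iff_has_vector_derivative intro!: chord_deriv d continuous_on_chord)
  then have "((\<lambda>z. (real d - 1) * ((1 - z\<^sup>2 / 2) ^ 1 * chord_weight d z)) has_integral 0) {0..2}"
    by (simp add: mult.assoc)
  then have "integral {0..2} (\<lambda>z. (1 - z\<^sup>2 / 2) ^ 1 * chord_weight d z) = 0"
    using d by (auto simp: has_integral_mult_right_iff dest!: integral_unique)
  then show ?thesis
    unfolding chord_moment_def
    using set_borel_integral_eq_integral(2)[OF set_integrable_chord_moment[OF d, of 1]] by simp
qed

text \<open>In the variable \<open>s = 1 - z\<^sup>2 / 2\<close> this integrates the derivative of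
  \<open>(1 - s\<^sup>2) powr ((d - 1) / 2) * s ^ (k + 1)\<close>; the boundary terms
  vanish.\<close>

lemma chord_moment_rec:
  assumes d: "d \<ge> 2"
  shows "(real k + 1) * chord_moment d k = (real d + real k) * chord_moment d (k + 2)"
proof -
  let ?P = "\<lambda>z::real. (z\<^sup>2 * (1 - z\<^sup>2 / 4)) powr ((real d - 1) / 2)"
  let ?s = "\<lambda>z::real. 1 - z\<^sup>2 / 2"
  let ?m = "\<lambda>k z. ?s z ^ k * chord_weight d z"
  let ?D = "\<lambda>z. (real d + real k) * ?m (k + 2) z - (real k + 1) * ?m k z"
  have "(?D has_integral (?P 2 * ?s 2 ^ Suc k - ?P 0 * ?s 0 ^ Suc k)) {0..2}"
  proof (rule fundamental_theorem_of_calculus_interior)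
    show "continuous_on {0..2} (\<lambda>z. ?P z * ?s z ^ Suc k)"
      by (intro continuous_on_mult continuous_on_chord d) (intro continuous_intros; simp)
    fix z :: real assume z: "z \<in> {0<..<2}"
    have "(?s has_real_derivative - z) (at z)" by (auto intro!: derivative_eq_intros)
    then have "((\<lambda>z. ?s z ^ Suc k) has_real_derivative (real k + 1) * ?s z ^ k * (- z)) (at z)"
      by (rule DERIV_cong[OF DERIV_power]) simp
    note DERIV_mult[OF chord_deriv(1)[OF d z] this]
    \<comment> \<open>The factor \<open>- z\<close> from the chain rule is what makes this work:
      \<open>?P z * z\<close> equals the weight times \<open>1 - s\<^sup>2\<close>, so only powers
      of \<open>s\<close> against the weight remain.\<close>
    moreover have "(real d - 1) * ?s z * chord_weight d z * ?s z ^ Suc k + (real k + 1) * ?s z ^ k * (- z) * ?P z = ?D z"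
    proof -
      have "z\<^sup>2 * (1 - z\<^sup>2 / 4) = 1 - (?s z)\<^sup>2"
        by (simp add: power2_eq_square algebra_simps)
      then have "?P z * z = chord_weight d z * (1 - (?s z)\<^sup>2)"
        unfolding chord_deriv(2)[OF d z] by (simp add: power2_eq_square algebra_simps)
      moreover have "K * S * (- z) * P = - K * S * (P * z)" for K S P :: real
        by simp
      ultimately have "(real k + 1) * ?s z ^ k * (- z) * ?P z = - (real k + 1) * ?s z ^ k * (chord_weight d z * (1 - (?s z)\<^sup>2))"
        by (simp only:)
      moreover have "(real d - 1) * S * W * S ^ Suc k + - (real k + 1) * S ^ k * (W * (1 - S\<^sup>2)) =
        (real d + real k) * (S ^ (k + 2) * W) - (real k + 1) * (S ^ k * W)" for S W :: real
        by (simp add: algebra_simps power2_eq_square)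
      ultimately show ?thesis by (simp only:)
    qed
    ultimately show "((\<lambda>z. ?P z * ?s z ^ Suc k) has_vector_derivative ?D z) (at z)"
      by (simp only: has_real_derivative_iff_has_vector_derivative)
  qed simp
  then have "integral {0..2} ?D = 0" by (simp add: integral_unique)
  moreover have si: "set_integrable lborel {0..2} (\<lambda>z. (real d + real k) * ?m (k + 2) z)" "set_integrable lborel {0..2} (\<lambda>z. (real k + 1) * ?m k z)"
    by (intro set_integrable_mult_right impI set_integrable_chord_moment d)+
  ultimately have "(LINT z:{0..2}|lborel. ?D z) = 0"
    using set_borel_integral_eq_integral(2)[OF set_integral_diff(1)[OF si]] by simp
  then show ?thesis
    unfolding set_integral_diff(2)[OF si] by (simp add: chord_moment_def)
qed

text \<open>The value is the Beta function at \<open>1 / 2\<close> and \<open>(d - 1) / 2\<close>.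
  Raising the dimension by 2 multiplies the weight by \<open>1 - s\<^sup>2\<close>, so with
  \<open>e = d - 2\<close> the new mass is the old mass minus the old second moment, that is the old
  mass times \<open>1 - 1 / e\<close>. This matches the functional equation of Gamma in numerator
  and denominator.\<close>

lemma chord_moment_0:
  assumes d: "d \<ge> 2"
  shows "chord_moment d 0 = sqrt pi * Gamma ((real d - 1) / 2) / Gamma (real d / 2)"
  using d
proof (induction d rule: less_induct)
  case (less d)
  consider "d = 2" | "d = 3" | "d \<ge> 4" using less.prems by linarith
  then show ?case
  proof cases
    case 1
    then show ?thesis using integral_chord_weight_2 by (simp add: chord_moment_def Gamma_one_half_real)
  next
    case 2
    have "(LINT z:{0..2}|lborel. chord_weight 3 z) = (LINT z:{0..2}|lborel. z)"
      unfolding set_lebesgue_integral_def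
    proof (rule integral_cong_AE)
      \<comment> \<open>Only almost everywhere: at \<open>z = 2\<close> the weight is 0, since
        \<open>0 powr 0 = 0\<close>, while the right-hand side is 2.\<close>
      have "AE z in lborel. z \<noteq> (2::real)" by (rule AE_lborel_singleton)
      then show "AE z in lborel. indicator {0..2} z *\<^sub>R chord_weight 3 z = indicator {0..2} z *\<^sub>R z"
      proof eventually_elim
        case (elim z)
        then show ?case using chord_base[of z] by (auto simp: chord_weight_def split: split_indicator)
      qed
    qed auto
    also have "\<dots> = 2"
      using integral_power[of 0 2 1] by (simp add: set_lebesgue_integral_def mult.commute)
    finally have c0: "chord_moment d 0 = 2" using 2 by (simp add: chord_moment_def)
    have G: "Gamma (3 / 2 :: real) = sqrt pi / 2"
      using Gamma_plus1[of "1 / 2 :: real"] nonpos_Ints_nonpos[of "1 / 2 :: real"]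
      by (auto simp: Gamma_one_half_real)
    moreover have "sqrt pi / Gamma (3 / 2) = 2" unfolding G by simp
    ultimately show ?thesis using c0 2 by simp
  next
    case 3
    define e where "e = d - 2"
    have e: "e \<ge> 2" "e < d" "d = e + 2" using 3 by (auto simp: e_def)
    \<comment> \<open>The difference of the two powers is
      \<open>1 - s\<^sup>2 = z\<^sup>2 * (1 - z\<^sup>2 / 4)\<close>, exactly one step of both
      factors of the weight.\<close>
    have eq: "chord_weight d z = (1 - z\<^sup>2 / 2) ^ 0 * chord_weight e z - (1 - z\<^sup>2 / 2) ^ 2 * chord_weight e z" if "z \<in> {0..2}" for z
    proof (cases "z = 2")
      case True
      then show ?thesis by (simp add: chord_weight_def)
    next
      case False
      then have b: "1 - z\<^sup>2 / 4 > 0" using chord_base[of z] that by auto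
      have "(1 - z\<^sup>2 / 4) powr ((real d - 3) / 2) = (1 - z\<^sup>2 / 4) powr ((real e - 3) / 2 + 1)"
        using e by simp (simp add: field_simps)
      also have "\<dots> = (1 - z\<^sup>2 / 4) powr ((real e - 3) / 2) * (1 - z\<^sup>2 / 4)"
        using b by (simp add: powr_add)
      finally have p: "(1 - z\<^sup>2 / 4) powr ((real d - 3) / 2) = \<dots>" .
      have "d - 2 = (e - 2) + 2" using e by simp
      then have q: "z ^ (d - 2) = z ^ (e - 2) * z\<^sup>2"
        by (simp only: power_add)
      show ?thesis unfolding chord_weight_def p q by (simp add: power2_eq_square algebra_simps)
    qed
    have "chord_moment d 0 = (LINT z:{0..2}|lborel. (1 - z\<^sup>2 / 2) ^ 0 * chord_weight e z - (1 - z\<^sup>2 / 2) ^ 2 * chord_weight e z)"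
      unfolding chord_moment_def by (intro set_lebesgue_integral_cong) (use eq in auto)
    also have "\<dots> = chord_moment e 0 - chord_moment e 2"
      unfolding chord_moment_def by (intro set_integral_diff set_integrable_chord_moment e)
    also have "chord_moment e 2 = chord_moment e 0 / e"
      using chord_moment_rec[OF e(1), of 0] e(1) by (simp add: field_simps numeral_2_eq_2)
    also have "chord_moment e 0 - chord_moment e 0 / e = (real e - 1) / e * (sqrt pi * Gamma ((real e - 1) / 2) / Gamma (real e / 2))"
    proof -
      have "A - A / e = (real e - 1) / e * A" for A :: real
        using e(1) by (simp add: field_simps)
      then show ?thesis unfolding less.IH[OF e(2,1)] .
    qed
    also have "\<dots> = sqrt pi * (((real e - 1) / 2) * Gamma ((real e - 1) / 2)) / ((real e / 2) * Gamma (real e / 2))"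
    proof -
      have "(real e - 1) / e * (a * b / c) = a * ((real e - 1) / 2 * b) / (real e / 2 * c)" for a b c :: real
        by simp
      then show ?thesis .
    qed
    also have "((real e - 1) / 2) * Gamma ((real e - 1) / 2) = Gamma ((real e - 1) / 2 + 1)"
      using e(1) by (intro Gamma_plus1[symmetric]) (auto dest: nonpos_Ints_nonpos)
    also have "(real e - 1) / 2 + 1 = (real d - 1) / 2" using e by (simp add: field_simps)
    also have "(real e / 2) * Gamma (real e / 2) = Gamma (real e / 2 + 1)"
      using e(1) by (intro Gamma_plus1[symmetric]) (auto dest: nonpos_Ints_nonpos)
    also have "real e / 2 + 1 = real d / 2" using e by simp
    finally show ?thesis .
  qed
qed

text \<open>Both sequences obey the same two-step recursion, so the exponents 0 and 1 decide. The
  constant is the area of the unit sphere one dimension lower, and for \<open>k = 0\<close> it is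
  checked against the total mass.\<close>

lemma sphere_moment_eq_chord_moment:
  fixes y :: "'a::euclidean_space"
  assumes d: "DIM('a) \<ge> 2" and y: "norm y = 1"
  shows "sphere_moment y k = 2 * pi powr ((real DIM('a) - 1) / 2) / Gamma ((real DIM('a) - 1) / 2) * chord_moment DIM('a) k"
proof (induction k rule: induct_nat_012)
  case 0
  have G: "Gamma ((real DIM('a) - 1) / 2) > 0" using d by (intro Gamma_real_pos) auto
  have "sphere_moment y 0 = 2 * pi powr (DIM('a) / 2) / Gamma (DIM('a) / 2)"
    using emeasure_sphere_measure_space[where 'a='a]
    by (simp add: sphere_moment_def measure_def)
  also have "pi powr (DIM('a) / 2) = pi powr ((real DIM('a) - 1) / 2) * pi powr (1 / 2)"
    unfolding powr_add[symmetric] by (simp add: diff_divide_distrib)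
  also have "pi powr (1 / 2) = sqrt pi" by (simp add: powr_half_sqrt)
  finally show ?case using G by (simp add: chord_moment_0[OF d])
next
  case 1
  then show ?case using sphere_moment_1[of y] chord_moment_1[OF d] by simp
next
  case (ge2 k)
  have "(real DIM('a) + real k) * sphere_moment y (k + 2) = (real k + 1) * sphere_moment y k"
    using sphere_moment_rec[OF y, of k] by simp
  also have "\<dots> = 2 * pi powr ((real DIM('a) - 1) / 2) / Gamma ((real DIM('a) - 1) / 2) * ((real k + 1) * chord_moment DIM('a) k)"
    by (subst ge2.IH(1)) (simp only: mult_ac)
  also have "\<dots> = (real DIM('a) + real k) * (2 * pi powr ((real DIM('a) - 1) / 2) / Gamma ((real DIM('a) - 1) / 2) * chord_moment DIM('a) (k + 2))"
    unfolding chord_moment_rec[OF d] by (simp only: mult_ac)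
  finally have "(real DIM('a) + real k) * sphere_moment y (k + 2) = \<dots>" .
  moreover have "real DIM('a) + real k \<noteq> 0" using d by linarith
  ultimately have "sphere_moment y (k + 2) = 2 * pi powr ((real DIM('a) - 1) / 2) / Gamma ((real DIM('a) - 1) / 2) * chord_moment DIM('a) (k + 2)"
    by (metis mult_left_cancel)
  then show ?case by simp
qed

text \<open>As a function of the cosine \<open>s = x \<bullet> y\<close> the integrand is continuous
  on \<open>{-1..1}\<close>. For polynomials in \<open>s\<close> the claim is the equality of
  moments; Weierstrass approximation extends it, since both sides are bounded by the supremum norm
  times a finite mass.\<close>

theorem sphere_integral_dist:
  fixes y :: "'a::euclidean_space" and f :: "real \<Rightarrow> real"
  assumes d: "DIM('a) \<ge> 2" and y: "norm y = 1" and f: "continuous_on {0..2} f"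
  shows "(\<integral>x. f (norm (x - y)) \<partial>sphere_measure)
    = 2 * pi powr ((real DIM('a) - 1) / 2) / Gamma ((real DIM('a) - 1) / 2)
      * (LINT z:{0..2}|lborel. f z * chord_weight DIM('a) z)"
    (is "?I = ?c * ?J")
proof -
  interpret finite_measure "sphere_measure :: 'a measure"
    by (rule finite_measure_sphere_measure)
  have nxy: "norm (x - y) = sqrt (2 - 2 * (x \<bullet> y))" and xy: "x \<bullet> y \<in> {-1..1}" if "x \<in> sphere 0 1" for x
  proof -
    have "(norm (x - y))\<^sup>2 = 2 - 2 * (x \<bullet> y)"
      using that y by (simp add: power2_norm_eq_inner inner_diff_left inner_diff_right norm_eq_1 inner_commute)
    then show "norm (x - y) = sqrt (2 - 2 * (x \<bullet> y))" by (metis norm_ge_zero real_sqrt_unique)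
    show "x \<bullet> y \<in> {-1..1}" using Cauchy_Schwarz_ineq2[of x y] that y by (auto simp: abs_le_iff)
  qed
  define F where "F s = f (sqrt (2 - 2 * s))" for s
  have s2: "sqrt (2 - 2 * s) \<in> {0..2}" if "s \<in> {-1..1}" for s :: real
    using that real_sqrt_le_mono[of "2 - 2 * s" 4] by auto
  have contF: "continuous_on {-1..1} F"
    unfolding F_def by (rule continuous_on_compose2[OF f]) (use s2 in \<open>auto intro!: continuous_intros\<close>)
  have zF: "f z = F (1 - z\<^sup>2 / 2)" and zs: "1 - z\<^sup>2 / 2 \<in> {-1..1}" if "z \<in> {0..2}" for z
  proof -
    show "f z = F (1 - z\<^sup>2 / 2)" using that by (simp add: F_def)
    show "1 - z\<^sup>2 / 2 \<in> {-1..1}" using chord_cos_bound[OF that] by auto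
  qed
  have I: "?I = (\<integral>x. F (x \<bullet> y) \<partial>sphere_measure)"
    by (intro Bochner_Integration.integral_cong) (auto simp: F_def nxy)
  have J: "?J = (LINT z:{0..2}|lborel. F (1 - z\<^sup>2 / 2) * chord_weight DIM('a) z)"
    by (intro set_lebesgue_integral_cong) (auto simp: zF)
  define c where "c = ?c"
  have c: "c \<ge> 0" unfolding c_def using d by (intro divide_nonneg_nonneg mult_nonneg_nonneg Gamma_real_nonneg) auto
  define w where "w = (LINT z:{0..2}|lborel. chord_weight DIM('a) z)"
  have intF: "integrable sphere_measure (\<lambda>x. F (x \<bullet> y))"
    by (intro integrable_sphere_measure_continuous continuous_on_compose2[OF contF])
      (use xy in \<open>auto intro!: continuous_intros\<close>)
  \<comment> \<open>Clamping the argument extends \<open>F\<close> continuously to the whole line,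
    which provides the Borel measurability needed for integrability.\<close>
  define F' where "F' s = F (min 1 (max (-1) s))" for s
  have F': "F' s = F s" if "s \<in> {-1..1}" for s using that by (simp add: F'_def)
  have cF': "continuous_on UNIV F'" unfolding F'_def
    by (intro continuous_on_compose2[OF contF] continuous_intros) auto
  then have [measurable]: "F' \<in> borel_measurable borel"
    by (rule borel_measurable_continuous_onI)
  obtain B where B: "\<And>s. s \<in> {-1..1} \<Longrightarrow> \<bar>F s\<bar> \<le> B"
    using compact_imp_bounded[OF compact_continuous_image[OF contF compact_Icc]]
    unfolding bounded_iff by (auto simp del: atLeastAtMost_iff)
  have "set_integrable lborel {0..2} (\<lambda>z. F' (1 - z\<^sup>2 / 2) * chord_weight DIM('a) z)"
    by (rule set_integrable_chord_weight_mult[OF d, where B=B]) (use B zs F' in auto)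
  then have siF: "set_integrable lborel {0..2} (\<lambda>z. F (1 - z\<^sup>2 / 2) * chord_weight DIM('a) z)"
    by (subst (asm) set_integrable_cong) (use zs F' in auto)
  have siw: "set_integrable lborel {0..2} (chord_weight DIM('a))"
    using set_integrable_chord_moment[OF d, of 0] by simp
  have w0: "w \<ge> 0"
    unfolding w_def set_lebesgue_integral_def
    by (intro integral_nonneg_AE AE_I2) (auto split: split_indicator intro: chord_weight_nonneg)
  have "\<bar>?I - c * ?J\<bar> \<le> e * (measure sphere_measure (sphere (0::'a) 1) + c * w)" if e: "e > 0" for e
  proof -
    \<comment> \<open>For the polynomial both sides agree exactly, so the discrepancy consists of
      two approximation errors, each at most \<open>e\<close> times the corresponding mass.\<close>
    obtain g where "real_polynomial_function g" and g: "\<And>s. s \<in> {-1..1} \<Longrightarrow> \<bar>F s - g s\<bar> < e"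
      using Stone_Weierstrass_real_polynomial_function[OF compact_Icc contF e] by metis
    then obtain a n where ga: "g = (\<lambda>s. \<Sum>i\<le>n. a i * s ^ i)"
      by (auto simp: real_polynomial_function_iff_sum)
    have ig: "integrable sphere_measure (\<lambda>x. g (x \<bullet> y))"
      unfolding ga by (intro integrable_sphere_measure_continuous continuous_intros)
    have im: "set_integrable lborel {0..2} (\<lambda>z. a i * ((1 - z\<^sup>2 / 2) ^ i * chord_weight DIM('a) z))" for i
      by (intro set_integrable_mult_right impI set_integrable_chord_moment d)
    have isg: "set_integrable lborel {0..2} (\<lambda>z. g (1 - z\<^sup>2 / 2) * chord_weight DIM('a) z)"
      using im unfolding ga sum_distrib_right mult.assoc set_integrable_def scaleR_sum_right
      by (intro Bochner_Integration.integrable_sum)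
    have G1: "(\<integral>x. g (x \<bullet> y) \<partial>sphere_measure) = (\<Sum>i\<le>n. a i * sphere_moment y i)"
      unfolding ga sphere_moment_def
      by (subst Bochner_Integration.integral_sum)
        (auto intro!: integrable_sphere_measure_continuous continuous_intros)
    have G2: "(LINT z:{0..2}|lborel. g (1 - z\<^sup>2 / 2) * chord_weight DIM('a) z) = (\<Sum>i\<le>n. a i * chord_moment DIM('a) i)"
    proof -
      have "(LINT z:{0..2}|lborel. g (1 - z\<^sup>2 / 2) * chord_weight DIM('a) z)
          = (\<Sum>i\<le>n. LINT z:{0..2}|lborel. a i * ((1 - z\<^sup>2 / 2) ^ i * chord_weight DIM('a) z))"
        using im unfolding ga sum_distrib_right mult.assoc set_integrable_def set_lebesgue_integral_def scaleR_sum_right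
        by (intro Bochner_Integration.integral_sum)
      then show ?thesis by (simp add: chord_moment_def)
    qed
    have G: "(\<integral>x. g (x \<bullet> y) \<partial>sphere_measure) = c * (LINT z:{0..2}|lborel. g (1 - z\<^sup>2 / 2) * chord_weight DIM('a) z)"
      unfolding G1 G2 c_def sphere_moment_eq_chord_moment[OF d y] sum_distrib_left
      by (intro sum.cong) (simp_all only: mult_ac)
    have "\<bar>?I - (\<integral>x. g (x \<bullet> y) \<partial>sphere_measure)\<bar> = \<bar>\<integral>x. F (x \<bullet> y) - g (x \<bullet> y) \<partial>sphere_measure\<bar>"
      unfolding I using intF ig by simp
    also have "\<dots> \<le> (\<integral>x. \<bar>F (x \<bullet> y) - g (x \<bullet> y)\<bar> \<partial>sphere_measure)"
      by (rule integral_abs_bound)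
    also have "\<dots> \<le> (\<integral>x. e \<partial>(sphere_measure :: 'a measure))"
      using g xy by (intro integral_mono integrable_abs Bochner_Integration.integrable_diff intF ig) (auto intro: less_imp_le)
    finally have 1: "\<bar>?I - (\<integral>x. g (x \<bullet> y) \<partial>sphere_measure)\<bar> \<le> e * measure sphere_measure (sphere (0::'a) 1)"
      by (simp add: mult.commute)
    have "\<bar>?J - (LINT z:{0..2}|lborel. g (1 - z\<^sup>2 / 2) * chord_weight DIM('a) z)\<bar>
        = \<bar>LINT z:{0..2}|lborel. F (1 - z\<^sup>2 / 2) * chord_weight DIM('a) z - g (1 - z\<^sup>2 / 2) * chord_weight DIM('a) z\<bar>"
      unfolding J set_integral_diff(2)[OF siF isg] ..
    also have "\<dots> \<le> (LINT z:{0..2}|lborel. \<bar>F (1 - z\<^sup>2 / 2) * chord_weight DIM('a) z - g (1 - z\<^sup>2 / 2) * chord_weight DIM('a) z\<bar>)"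
      using set_integral_norm_bound[OF set_integral_diff(1)[OF siF isg]] by simp
    also have "\<dots> \<le> (LINT z:{0..2}|lborel. e * chord_weight DIM('a) z)"
    proof (rule set_integral_mono)
      show "set_integrable lborel {0..2} (\<lambda>z. \<bar>F (1 - z\<^sup>2 / 2) * chord_weight DIM('a) z - g (1 - z\<^sup>2 / 2) * chord_weight DIM('a) z\<bar>)"
        by (intro set_integrable_abs set_integral_diff siF isg)
      show "set_integrable lborel {0..2} (\<lambda>z. e * chord_weight DIM('a) z)"
        using siw by simp
      fix z :: real assume z: "z \<in> {0..2}"
      then show "\<bar>F (1 - z\<^sup>2 / 2) * chord_weight DIM('a) z - g (1 - z\<^sup>2 / 2) * chord_weight DIM('a) z\<bar> \<le> e * chord_weight DIM('a) z"
        using g[OF zs[OF z]] chord_weight_nonneg[of z]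
        unfolding left_diff_distrib[symmetric] abs_mult by (intro mult_mono) auto
    qed
    finally have 2: "\<bar>?J - (LINT z:{0..2}|lborel. g (1 - z\<^sup>2 / 2) * chord_weight DIM('a) z)\<bar> \<le> e * w"
      by (simp add: w_def)
    have "?I - c * ?J = (?I - (\<integral>x. g (x \<bullet> y) \<partial>sphere_measure)) - c * (?J - (LINT z:{0..2}|lborel. g (1 - z\<^sup>2 / 2) * chord_weight DIM('a) z))"
      unfolding G by (simp add: algebra_simps)
    also have "\<bar>\<dots>\<bar> \<le> e * measure sphere_measure (sphere (0::'a) 1) + c * (e * w)"
    proof -
      have "\<bar>p - c * q\<bar> \<le> \<bar>p\<bar> + c * \<bar>q\<bar>" for p q :: real
        using abs_triangle_ineq4[of p "c * q"] c by (simp add: abs_mult)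
      then show ?thesis
        using 1 mult_left_mono[OF 2 c] by (rule order_trans[OF _ add_mono])
    qed
    finally show ?thesis by (simp add: algebra_simps)
  qed
  define K where "K = measure sphere_measure (sphere (0::'a) 1) + c * w"
  have K: "K \<ge> 0" using c w0 by (simp add: K_def)
  have "\<bar>?I - c * ?J\<bar> \<le> 0"
  proof (rule field_le_epsilon)
    fix e :: real assume "e > 0"
    then have "\<bar>?I - c * ?J\<bar> \<le> e / (K + 1) * K"
      using K \<open>\<And>e. e > 0 \<Longrightarrow> \<bar>?I - c * ?J\<bar> \<le> e * _\<close>[of "e / (K + 1)"] by (simp add: K_def)
    also have "\<dots> \<le> e" using K \<open>e > 0\<close> by (simp add: divide_simps)
    finally show "\<bar>?I - c * ?J\<bar> \<le> 0 + e" by simp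
  qed
  then show ?thesis by (simp add: c_def)
qed

text \<open>After the substitution \<open>\<tau> = t - s\<close>, the set of \<open>t\<close> in
  \<open>{0..T}\<close> with \<open>t - \<tau>\<close> in \<open>{0..T}\<close> has length
  \<open>T - \<bar>\<tau>\<bar>\<close>, or 0 for larger lags; the integrand is even in
  \<open>\<tau>\<close>, which gives the factor 2.\<close>

lemma double_integral_abs_diff:
  fixes g :: "real \<Rightarrow> real"
  assumes T: "T \<ge> 0" and [measurable]: "g \<in> borel_measurable borel" and B: "\<And>\<tau>. \<bar>g \<tau>\<bar> \<le> B"
  shows "(LINT t:{0..T}|lborel. LINT s:{0..T}|lborel. g \<bar>t - s\<bar>) = 2 * (LINT \<tau>:{0..T}|lborel. (T - \<tau>) * g \<tau>)"
proof -
  let ?i = "\<lambda>t. indicator {0..T} t :: real"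
  let ?f = "\<lambda>(t, \<tau>). ?i t * (?i (t - \<tau>) * g \<bar>\<tau>\<bar>)"
  have supp: "norm (?f p) \<le> indicator ({0..T} \<times> {-T..T}) p * B" for p
    using B[of "\<bar>snd p\<bar>"] by (cases p) (auto split: split_indicator simp: abs_mult)
  have int: "integrable (lborel \<Otimes>\<^sub>M lborel) ?f"
  proof (rule Bochner_Integration.integrable_bound)
    have "emeasure (lborel \<Otimes>\<^sub>M lborel) ({0..T} \<times> {-T..T}) < \<infinity>"
      using T by (subst lborel.emeasure_pair_measure_Times) (auto simp: ennreal_mult_less_top)
    then show "integrable (lborel \<Otimes>\<^sub>M lborel) (\<lambda>p. indicator ({0..T} \<times> {-T..T}) p * B)"
      by (intro integrable_mult_left impI integrable_real_indicator) auto
    show "AE p in lborel \<Otimes>\<^sub>M lborel. norm (?f p) \<le> norm (indicator ({0..T} \<times> {-T..T}) p * B)"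
      by (intro AE_I2 order_trans[OF supp]) (simp only: real_norm_def abs_ge_self)
  qed measurable
  have "(LINT t:{0..T}|lborel. LINT s:{0..T}|lborel. g \<bar>t - s\<bar>) = (\<integral>t. (\<integral>\<tau>. ?f (t, \<tau>) \<partial>lborel) \<partial>lborel)"
    unfolding set_lebesgue_integral_def
  proof (intro Bochner_Integration.integral_cong refl)
    fix t :: real
    have "(\<integral>s. ?i s *\<^sub>R g \<bar>t - s\<bar> \<partial>lborel) = (\<integral>\<tau>. ?i (t - \<tau>) * g \<bar>\<tau>\<bar> \<partial>lborel)"
      by (subst lborel_integral_real_affine[where c="-1" and t=t]) auto
    then show "?i t *\<^sub>R (\<integral>s. ?i s *\<^sub>R g \<bar>t - s\<bar> \<partial>lborel) = (\<integral>\<tau>. ?f (t, \<tau>) \<partial>lborel)" by simp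
  qed
  also have "\<dots> = (\<integral>\<tau>. (\<integral>t. ?f (t, \<tau>) \<partial>lborel) \<partial>lborel)"
    using lborel_pair.Fubini_integral[of "\<lambda>t \<tau>. ?f (t, \<tau>)"] int by simp
  also have "\<dots> = (\<integral>\<tau>. max 0 (T - \<bar>\<tau>\<bar>) * g \<bar>\<tau>\<bar> \<partial>lborel)"
  proof (intro Bochner_Integration.integral_cong refl)
    fix \<tau> :: real
    have "(\<integral>t. ?f (t, \<tau>) \<partial>lborel) = (\<integral>t. indicator {max 0 \<tau>..min T (T + \<tau>)} t * g \<bar>\<tau>\<bar> \<partial>lborel)"
      by (intro Bochner_Integration.integral_cong) (auto split: split_indicator)
    also have "\<dots> = max 0 (T - \<bar>\<tau>\<bar>) * g \<bar>\<tau>\<bar>"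
    proof -
      have "measure lborel {max 0 \<tau>..min T (T + \<tau>)} = max 0 (T - \<bar>\<tau>\<bar>)"
        by (cases "max 0 \<tau> \<le> min T (T + \<tau>)") (use T in \<open>auto simp: max_def min_def split: if_splits\<close>)
      then show ?thesis by simp
    qed
    finally show "(\<integral>t. ?f (t, \<tau>) \<partial>lborel) = max 0 (T - \<bar>\<tau>\<bar>) * g \<bar>\<tau>\<bar>" .
  qed
  also have "\<dots> = 2 * (LINT \<tau>:{0..T}|lborel. (T - \<tau>) * g \<tau>)"
  proof -
    have si: "integrable lborel (\<lambda>\<tau>. indicator {0..} \<tau> *\<^sub>R (max 0 (T - \<bar>\<tau>\<bar>) * g \<bar>\<tau>\<bar>))"
    proof (rule Bochner_Integration.integrable_bound)
      show "integrable lborel (\<lambda>\<tau>. indicator {0..T} \<tau> *\<^sub>R (T * B))"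
        using T by (intro integrable_scaleR_left impI integrable_real_indicator) auto
      have "\<bar>max 0 (T - \<tau>)\<bar> * \<bar>g \<tau>\<bar> \<le> T * B" if "0 \<le> \<tau>" for \<tau>
        using B[of \<tau>] that T by (intro mult_mono) auto
      then show "AE \<tau> in lborel. norm (indicator {0..} \<tau> *\<^sub>R (max 0 (T - \<bar>\<tau>\<bar>) * g \<bar>\<tau>\<bar>)) \<le> norm (indicator {0..T} \<tau> *\<^sub>R (T * B))"
      proof (intro AE_I2)
        fix \<tau> :: real
        assume le: "\<And>\<tau>. 0 \<le> \<tau> \<Longrightarrow> \<bar>max 0 (T - \<tau>)\<bar> * \<bar>g \<tau>\<bar> \<le> T * B"
        show "norm (indicator {0..} \<tau> *\<^sub>R (max 0 (T - \<bar>\<tau>\<bar>) * g \<bar>\<tau>\<bar>)) \<le> norm (indicator {0..T} \<tau> *\<^sub>R (T * B))"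
          using le[of \<tau>] B[of 0] by (cases "\<tau> \<in> {0..T}") (auto simp: abs_mult split: split_indicator intro: order_trans[OF _ abs_ge_self])
      qed
    qed measurable
    have eq: "(\<integral>\<tau>. indicator {0..} \<tau> *\<^sub>R (max 0 (T - \<bar>\<tau>\<bar>) * g \<bar>\<tau>\<bar>) \<partial>lborel) = (LINT \<tau>:{0..T}|lborel. (T - \<tau>) * g \<tau>)"
      unfolding set_lebesgue_integral_def
      by (intro Bochner_Integration.integral_cong) (auto split: split_indicator)
    have "has_bochner_integral lborel (\<lambda>\<tau>. max 0 (T - \<bar>\<tau>\<bar>) * g \<bar>\<tau>\<bar>) (2 *\<^sub>R (LINT \<tau>:{0..T}|lborel. (T - \<tau>) * g \<tau>))"
      by (rule has_bochner_integral_even_function) (use si eq in \<open>auto simp: has_bochner_integral_iff\<close>)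
    then show ?thesis by (simp add: has_bochner_integral_iff)
  qed
  finally show ?thesis .
qed

section \<open>Integrals of random fields\<close>

text \<open>Cauchy-Schwarz against the constant 1, from expanding the nonnegative integral of
  \<open>(m * f - I)\<^sup>2\<close> with \<open>m\<close> the total mass and \<open>I\<close> the
  integral of \<open>f\<close>.\<close>

lemma (in finite_measure) power2_integral_le:
  fixes f :: "'a \<Rightarrow> real"
  assumes f: "integrable M f" and f2: "integrable M (\<lambda>x. (f x)\<^sup>2)"
  shows "(\<integral>x. f x \<partial>M)\<^sup>2 \<le> measure M (space M) * (\<integral>x. (f x)\<^sup>2 \<partial>M)"
proof -
  let ?m = "measure M (space M)" and ?I = "\<integral>x. f x \<partial>M"
  show ?thesis
  proof (cases "?m = 0")
    case True
    then have "AE x in M. f x = 0"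
      by (intro AE_I[where N="space M"]) (auto simp: emeasure_eq_measure)
    then have "?I = (\<integral>x. 0 \<partial>M)" by (intro integral_cong_AE) (use f in auto)
    then show ?thesis using True by simp
  next
    case False
    then have m: "?m > 0" using measure_nonneg[of M "space M"] by linarith
    have "0 \<le> (\<integral>x. (?m * f x - ?I)\<^sup>2 \<partial>M)" by simp
    also have "(\<lambda>x. (?m * f x - ?I)\<^sup>2) = (\<lambda>x. ?m\<^sup>2 * (f x)\<^sup>2 - 2 * ?m * ?I * f x + ?I\<^sup>2)"
      by (auto simp: power2_eq_square algebra_simps)
    also have "(\<integral>x. ?m\<^sup>2 * (f x)\<^sup>2 - 2 * ?m * ?I * f x + ?I\<^sup>2 \<partial>M) = ?m\<^sup>2 * (\<integral>x. (f x)\<^sup>2 \<partial>M) - 2 * ?m * ?I * ?I + ?I\<^sup>2 * ?m"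
      using f f2 by simp
    also have "\<dots> = ?m * (?m * (\<integral>x. (f x)\<^sup>2 \<partial>M) - ?I\<^sup>2)"
      by (simp add: power2_eq_square algebra_simps)
    finally show ?thesis using m by (simp add: zero_le_mult_iff)
  qed
qed

lemma integrable_mult_of_squares:
  fixes f g :: "'a \<Rightarrow> real"
  assumes [measurable]: "f \<in> borel_measurable M" "g \<in> borel_measurable M"
    and "integrable M (\<lambda>x. (f x)\<^sup>2)" "integrable M (\<lambda>x. (g x)\<^sup>2)"
  shows "integrable M (\<lambda>x. f x * g x)"
proof (rule Bochner_Integration.integrable_bound)
  show "integrable M (\<lambda>x. (f x)\<^sup>2 + (g x)\<^sup>2)" using assms by simp
  have "\<bar>a * b\<bar> \<le> a\<^sup>2 + b\<^sup>2" for a b :: real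
  proof -
    have "2 * (\<bar>a\<bar> * \<bar>b\<bar>) \<le> a\<^sup>2 + b\<^sup>2" using sum_squares_bound[of "\<bar>a\<bar>" "\<bar>b\<bar>"] by simp
    moreover have "0 \<le> \<bar>a\<bar> * \<bar>b\<bar>" by simp
    ultimately show ?thesis unfolding abs_mult by linarith
  qed
  then show "AE x in M. norm (f x * g x) \<le> norm ((f x)\<^sup>2 + (g x)\<^sup>2)" by (simp add: abs_of_nonneg)
qed measurable

lemma integrable_add_squares:
  fixes f g :: "'a \<Rightarrow> real"
  assumes [measurable]: "f \<in> borel_measurable M" "g \<in> borel_measurable M"
    and "integrable M (\<lambda>x. (f x)\<^sup>2)" "integrable M (\<lambda>x. (g x)\<^sup>2)"
  shows "integrable M (\<lambda>x. (a * f x + b * g x)\<^sup>2)"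
proof -
  have "(\<lambda>x. (a * f x + b * g x)\<^sup>2) = (\<lambda>x. a\<^sup>2 * (f x)\<^sup>2 + 2 * a * b * (f x * g x) + b\<^sup>2 * (g x)\<^sup>2)"
    by (auto simp: power2_eq_square algebra_simps)
  then show ?thesis using assms integrable_mult_of_squares[OF assms] by simp
qed

text \<open>Used for the field itself and for its nonlinear remainder. A finite index measure and a
  uniform bound on second moments are what Fubini needs for exchanging expectation and integration
  over the index.\<close>

locale field_integral = M: finite_measure M + N: finite_measure N
  for M :: "'w measure" and N :: "'p measure" +
  fixes X :: "'p \<Rightarrow> 'w \<Rightarrow> real" and B :: real
  assumes X_meas [measurable]: "(\<lambda>(p, \<omega>). X p \<omega>) \<in> borel_measurable (N \<Otimes>\<^sub>M M)"
    and X_int: "\<And>p. p \<in> space N \<Longrightarrow> integrable M (\<lambda>\<omega>. (X p \<omega>)\<^sup>2)"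
    and X_le: "\<And>p. p \<in> space N \<Longrightarrow> (\<integral>\<omega>. (X p \<omega>)\<^sup>2 \<partial>M) \<le> B"
begin

sublocale pair_sigma_finite N M ..

text \<open>The integral is not divided by the mass of \<open>N\<close>.\<close>

definition mean_field :: "'w \<Rightarrow> real" where "mean_field \<omega> = (\<integral>p. X p \<omega> \<partial>N)"

lemma X_section [measurable]: "p \<in> space N \<Longrightarrow> X p \<in> borel_measurable M"
  using measurable_Pair2[OF X_meas] by simp

lemma mean_field_meas [measurable]: "mean_field \<in> borel_measurable M"
  unfolding mean_field_def by measurable

lemma integrable_pair_square: "integrable (N \<Otimes>\<^sub>M M) (\<lambda>(p, \<omega>). (X p \<omega>)\<^sup>2)"
proof (rule Fubini_integrable)
  show "integrable N (\<lambda>p. \<integral>\<omega>. norm (case (p, \<omega>) of (p, \<omega>) \<Rightarrow> (X p \<omega>)\<^sup>2) \<partial>M)"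
    using X_le by (intro N.integrable_const_bound[where B=B]) auto
qed (use X_int in auto)

lemma integrable_pair_mult:
  assumes [measurable]: "W \<in> borel_measurable M" and W: "integrable M (\<lambda>\<omega>. (W \<omega>)\<^sup>2)"
  shows "integrable (N \<Otimes>\<^sub>M M) (\<lambda>(p, \<omega>). X p \<omega> * W \<omega>)"
proof -
  have "integrable (N \<Otimes>\<^sub>M M) (\<lambda>x. (W (snd x))\<^sup>2)"
  proof (rule Fubini_integrable)
    show "AE x in N. integrable M (\<lambda>y. (W (snd (x, y)))\<^sup>2)" using W by simp
  qed (auto intro: N.integrable_const)
  moreover have "integrable (N \<Otimes>\<^sub>M M) (\<lambda>x. (X (fst x) (snd x))\<^sup>2)"
    using integrable_pair_square by (simp add: case_prod_beta')
  ultimately show ?thesis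
    unfolding case_prod_beta' by (intro integrable_mult_of_squares) (auto simp: case_prod_beta'[symmetric])
qed

lemma AE_integrable_section: "AE \<omega> in M. integrable N (\<lambda>p. X p \<omega>) \<and> integrable N (\<lambda>p. (X p \<omega>)\<^sup>2)"
proof -
  have "integrable (N \<Otimes>\<^sub>M M) (\<lambda>(p, \<omega>). X p \<omega> * 1)"
    by (rule integrable_pair_mult) auto
  then have 1: "AE \<omega> in M. integrable N (\<lambda>p. X p \<omega>)"
    using AE_integrable_snd[of "\<lambda>p \<omega>. X p \<omega>"] by simp
  have 2: "AE \<omega> in M. integrable N (\<lambda>p. (X p \<omega>)\<^sup>2)"
    using AE_integrable_snd[of "\<lambda>p \<omega>. (X p \<omega>)\<^sup>2"] integrable_pair_square by simp
  show ?thesis using 1 2 by eventually_elim simp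
qed

lemma integrable_mean_field_square: "integrable M (\<lambda>\<omega>. (mean_field \<omega>)\<^sup>2)"
proof (rule Bochner_Integration.integrable_bound)
  show "integrable M (\<lambda>\<omega>. measure N (space N) * (\<integral>p. (X p \<omega>)\<^sup>2 \<partial>N))"
    using integrable_snd[of "\<lambda>p \<omega>. (X p \<omega>)\<^sup>2"] integrable_pair_square by simp
  show "AE \<omega> in M. norm ((mean_field \<omega>)\<^sup>2) \<le> norm (measure N (space N) * (\<integral>p. (X p \<omega>)\<^sup>2 \<partial>N))"
    using AE_integrable_section
    by eventually_elim (auto simp: mean_field_def intro!: N.power2_integral_le order_trans[OF _ abs_ge_self])
qed measurable

lemma expectation_mean_field_mult:
  assumes [measurable]: "W \<in> borel_measurable M" and W: "integrable M (\<lambda>\<omega>. (W \<omega>)\<^sup>2)"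
  shows "(\<integral>\<omega>. mean_field \<omega> * W \<omega> \<partial>M) = (\<integral>p. (\<integral>\<omega>. X p \<omega> * W \<omega> \<partial>M) \<partial>N)"
proof -
  have "(\<integral>p. (\<integral>\<omega>. X p \<omega> * W \<omega> \<partial>M) \<partial>N) = (\<integral>\<omega>. (\<integral>p. X p \<omega> * W \<omega> \<partial>N) \<partial>M)"
    using Fubini_integral[of "\<lambda>p \<omega>. X p \<omega> * W \<omega>"] integrable_pair_mult[OF assms] by simp
  then show ?thesis by (simp add: mean_field_def)
qed

lemma integrable_expectation_mult:
  assumes [measurable]: "W \<in> borel_measurable M" and W: "integrable M (\<lambda>\<omega>. (W \<omega>)\<^sup>2)"
  shows "integrable N (\<lambda>p. \<integral>\<omega>. X p \<omega> * W \<omega> \<partial>M)"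
  using integrable_fst'[OF integrable_pair_mult[OF assms]] by simp

text \<open>The exchange of integrals is applied twice, with \<open>W\<close> first the integrated
  field and then a single \<open>X p\<close>; this avoids a product of three measure spaces.\<close>

lemma expectation_mean_field_square:
  "(\<integral>\<omega>. (mean_field \<omega>)\<^sup>2 \<partial>M) = (\<integral>p. (\<integral>q. (\<integral>\<omega>. X p \<omega> * X q \<omega> \<partial>M) \<partial>N) \<partial>N)"
proof -
  have "(\<integral>\<omega>. (mean_field \<omega>)\<^sup>2 \<partial>M) = (\<integral>p. (\<integral>\<omega>. X p \<omega> * mean_field \<omega> \<partial>M) \<partial>N)"
    using expectation_mean_field_mult[OF mean_field_meas integrable_mean_field_square] by (simp add: power2_eq_square)
  also have "\<dots> = (\<integral>p. (\<integral>q. (\<integral>\<omega>. X p \<omega> * X q \<omega> \<partial>M) \<partial>N) \<partial>N)"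
  proof (intro Bochner_Integration.integral_cong refl)
    fix p assume p: "p \<in> space N"
    show "(\<integral>\<omega>. X p \<omega> * mean_field \<omega> \<partial>M) = (\<integral>q. (\<integral>\<omega>. X p \<omega> * X q \<omega> \<partial>M) \<partial>N)"
      using expectation_mean_field_mult[OF X_section[OF p] X_int[OF p]] by (simp add: mult.commute)
  qed
  finally show ?thesis .
qed

end

section \<open>Mean-square estimates and Gaussian characteristic functions\<close>

lemma expectation_Cauchy_Schwarz:
  fixes f g :: "'a \<Rightarrow> real"
  assumes [measurable]: "f \<in> borel_measurable M" "g \<in> borel_measurable M"
    and f: "integrable M (\<lambda>x. (f x)\<^sup>2)" and g: "integrable M (\<lambda>x. (g x)\<^sup>2)"
  shows "(\<integral>x. f x * g x \<partial>M)\<^sup>2 \<le> (\<integral>x. (f x)\<^sup>2 \<partial>M) * (\<integral>x. (g x)\<^sup>2 \<partial>M)"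
proof -
  let ?A = "\<integral>x. (f x)\<^sup>2 \<partial>M" and ?B = "\<integral>x. f x * g x \<partial>M" and ?D = "\<integral>x. (g x)\<^sup>2 \<partial>M"
  have fg: "integrable M (\<lambda>x. f x * g x)" by (rule integrable_mult_of_squares) (use f g in auto)
  have q: "0 \<le> ?A - 2 * l * ?B + l\<^sup>2 * ?D" for l
  proof -
    have "0 \<le> (\<integral>x. (f x - l * g x)\<^sup>2 \<partial>M)" by simp
    also have "(\<lambda>x. (f x - l * g x)\<^sup>2) = (\<lambda>x. (f x)\<^sup>2 - 2 * l * (f x * g x) + l\<^sup>2 * (g x)\<^sup>2)"
      by (auto simp: power2_eq_square algebra_simps)
    also have "(\<integral>x. (f x)\<^sup>2 - 2 * l * (f x * g x) + l\<^sup>2 * (g x)\<^sup>2 \<partial>M) = ?A - 2 * l * ?B + l\<^sup>2 * ?D"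
      using f g fg by simp
    finally show ?thesis .
  qed
  have D: "?D \<ge> 0" by simp
  show ?thesis
  proof (cases "?D = 0")
    case True
    have "?B = 0"
    proof (rule ccontr)
      assume B: "?B \<noteq> 0"
      \<comment> \<open>With \<open>?D = 0\<close> the quadratic is affine in \<open>l\<close>, and
        this choice gives it the value -1.\<close>
      from q[of "(?A + 1) / (2 * ?B)"] True B show False by (simp add: field_simps)
    qed
    then show ?thesis using True by simp
  next
    case False
    then have "0 \<le> ?D * (?A - 2 * (?B / ?D) * ?B + (?B / ?D)\<^sup>2 * ?D)"
      using q[of "?B / ?D"] D by (intro mult_nonneg_nonneg) auto
    also have "\<dots> = ?A * ?D - ?B\<^sup>2"
      using False by (simp add: power2_eq_square field_simps)
    finally show ?thesis by simp
  qed
qed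

lemma cmod_iexp_diff_le: "cmod (iexp a - iexp b) \<le> \<bar>a - b\<bar>"
proof -
  have "iexp a - iexp b = iexp b * (iexp (a - b) - 1)"
    by (simp add: algebra_simps flip: exp_add)
  then have "cmod (iexp a - iexp b) = cmod (iexp (a - b) - 1)"
    by (simp add: norm_mult)
  also have "\<dots> \<le> \<bar>a - b\<bar>" using iexp_approx1[of "a - b" 0] by simp
  finally show ?thesis .
qed

lemma char_distr_eq_expectation:
  assumes [measurable]: "X \<in> borel_measurable M"
  shows "char (distr M borel X) t = (CLINT \<omega>|M. iexp (t * X \<omega>))"
  unfolding char_def by (subst integral_distr) auto

text \<open>A point mass is the case of variance 0 and is treated directly; otherwise the variable
  is rescaled to the standard normal law.\<close>

lemma (in prob_space) gaussian_rv_char: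
  assumes X: "gaussian_rv M X" and int: "integrable M (\<lambda>\<omega>. (X \<omega>)\<^sup>2)" and mean: "expectation X = 0"
  shows "char (distr M borel X) t = exp (- (expectation (\<lambda>\<omega>. (X \<omega>)\<^sup>2) * t\<^sup>2) / 2)"
proof -
  obtain m s where [measurable]: "X \<in> borel_measurable M" and s: "s \<ge> 0"
    and d: "distr M borel X = (if s = 0 then return borel m else density lborel (normal_density m s))"
    using X by (auto simp: gaussian_rv_def)
  have m: "expectation X = (\<integral>x. x \<partial>distr M borel X)" 
    and v: "expectation (\<lambda>\<omega>. (X \<omega>)\<^sup>2) = (\<integral>x. x\<^sup>2 \<partial>distr M borel X)"
    by (subst integral_distr; simp)+
  show ?thesis
  proof (cases "s = 0")
    case True
    then have "m = 0" using m d mean by (simp add: integral_return)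
    then have "distr M borel X = return borel 0" using d True by simp
    then show ?thesis using v by (simp add: char_def integral_return)
  next
    case False
    then have s: "s > 0" using s by simp
    have dX: "distributed M lborel X (normal_density m s)"
      using d False by (simp add: distributed_def cong: distr_cong)
    have "(\<integral>x. x \<partial>distr M borel X) = (\<integral>x. normal_density m s x * x \<partial>lborel)"
      using d False by (simp add: integral_density)
    then have "m = 0" using m mean integral_normal_moment_nz_1[OF s, of m] by simp
    then have dX: "distributed M lborel X (normal_density 0 s)" using dX by simp
    have v: "expectation (\<lambda>\<omega>. (X \<omega>)\<^sup>2) = s\<^sup>2"
      using v d False s \<open>m = 0\<close> integral_normal_moment_even[OF s, of 0 1]
      by (simp add: integral_density)
    have "distributed M lborel (\<lambda>x. (X x - 0) / s) std_normal_density"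
      using dX by (subst (asm) normal_standard_normal_convert[OF s])
    then have "distr M borel (\<lambda>x. X x / s) = std_normal_distribution"
      by (simp add: distributed_def cong: distr_cong)
    then have "exp (- ((t * s)\<^sup>2) / 2) = char (distr M borel (\<lambda>x. X x / s)) (t * s)"
      by (simp add: char_std_normal_distribution)
    also have "\<dots> = char (distr M borel X) t"
      using s by (simp add: char_distr_eq_expectation)
    finally show ?thesis by (simp add: v power_mult_distrib mult.commute)
  qed
qed

section \<open>The Gaussian law of an integrated field\<close>

locale gaussian_integral = field_integral M N X B + M: prob_space M
  for M :: "'w measure" and N :: "'p measure" and X :: "'p \<Rightarrow> 'w \<Rightarrow> real" and B :: real +
  assumes gauss: "gaussian_field M X" and centered: "\<And>p. p \<in> space N \<Longrightarrow> M.expectation (X p) = 0"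
    and mass_pos: "measure N (space N) > 0"
begin

lemma combination_meas [measurable]:
  assumes "finite J" shows "(\<lambda>\<omega>. \<Sum>i\<in>J. a i * X i \<omega>) \<in> borel_measurable M"
  using gauss assms by (auto simp: gaussian_field_def gaussian_rv_def)

lemma integrable_combination_square:
  assumes "finite J" "J \<subseteq> space N"
  shows "integrable M (\<lambda>\<omega>. (\<Sum>i\<in>J. a i * X i \<omega>)\<^sup>2)"
  using assms
proof (induction J)
  case (insert p J)
  have "integrable M (\<lambda>\<omega>. (a p * X p \<omega> + 1 * (\<Sum>i\<in>J. a i * X i \<omega>))\<^sup>2)"
    using insert by (intro integrable_add_squares X_section X_int combination_meas) auto
  then show ?case using insert.hyps by simp
qed simp

text \<open>
  Greedy choice of sampling points (Maurey's argument): averaged over \<open>p\<close>, the increment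
  \<open>m X p - mean_field\<close> is orthogonal to everything chosen so far, so some \<open>p\<close> does not
  increase the error by more than a constant.
\<close>

lemma greedy_sample:
  obtains K where "\<And>n. \<exists>J a. finite J \<and> J \<subseteq> space N \<and>
    M.expectation (\<lambda>\<omega>. ((\<Sum>i\<in>J. a i * X i \<omega>) - real n * mean_field \<omega>)\<^sup>2) \<le> real n * K"
proof -
  define m where "m = measure N (space N)"
  define V where "V = M.expectation (\<lambda>\<omega>. (mean_field \<omega>)\<^sup>2)"
  \<comment> \<open>Bounds the second moment of one increment uniformly in the sampling point, by
    \<open>(x - y)\<^sup>2 \<le> 2 * x\<^sup>2 + 2 * y\<^sup>2\<close>.\<close>
  define K where "K = 2 * m\<^sup>2 * B + 2 * V"
  have "\<exists>J a. finite J \<and> J \<subseteq> space N \<and>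
    M.expectation (\<lambda>\<omega>. ((\<Sum>i\<in>J. a i * X i \<omega>) - real n * mean_field \<omega>)\<^sup>2) \<le> real n * K" for n
  proof (induction n)
    case 0
    show ?case by (intro exI[of _ "{}"]) simp
  next
    case (Suc n)
    then obtain J a where J: "finite J" "J \<subseteq> space N"
      and le: "M.expectation (\<lambda>\<omega>. ((\<Sum>i\<in>J. a i * X i \<omega>) - real n * mean_field \<omega>)\<^sup>2) \<le> real n * K"
      by blast
    define S where "S \<omega> = (\<Sum>i\<in>J. a i * X i \<omega>) - real n * mean_field \<omega>" for \<omega>
    have S [measurable]: "S \<in> borel_measurable M" unfolding S_def using J by measurable
    have "integrable M (\<lambda>\<omega>. (1 * (\<Sum>i\<in>J. a i * X i \<omega>) + (- real n) * mean_field \<omega>)\<^sup>2)"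
      using J by (intro integrable_add_squares integrable_combination_square integrable_mean_field_square) auto
    then have S2: "integrable M (\<lambda>\<omega>. (S \<omega>)\<^sup>2)" by (simp add: S_def)
    have iXS: "integrable M (\<lambda>\<omega>. X p \<omega> * S \<omega>)" if "p \<in> space N" for p
      by (rule integrable_mult_of_squares) (use that S2 X_int in auto)
    have iYS: "integrable M (\<lambda>\<omega>. mean_field \<omega> * S \<omega>)"
      by (rule integrable_mult_of_squares) (use S2 integrable_mean_field_square in auto)
    \<comment> \<open>The inner product of the increment at \<open>p\<close> with the current error
      \<open>S\<close>. Its integral over \<open>p\<close> is 0 because \<open>m\<close> is the
      total mass, and on a space of positive mass it then cannot be positive everywhere.\<close>
    define g where "g p = m * M.expectation (\<lambda>\<omega>. X p \<omega> * S \<omega>) - M.expectation (\<lambda>\<omega>. mean_field \<omega> * S \<omega>)" for p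
    have ig: "integrable N g" unfolding g_def using integrable_expectation_mult[OF S S2] by simp
    have "(\<integral>p. g p \<partial>N) = 0"
      unfolding g_def using integrable_expectation_mult[OF S S2] expectation_mean_field_mult[OF S S2]
      by (simp add: m_def)
    have "\<exists>p\<in>space N. g p \<le> 0"
    proof (rule ccontr)
      assume "\<not> ?thesis"
      then have "(\<integral>p. 0 \<partial>N) < (\<integral>p. g p \<partial>N)"
        using ig mass_pos by (intro N.integral_less_AE_space) (auto simp: N.emeasure_eq_measure not_le)
      then show False using \<open>(\<integral>p. g p \<partial>N) = 0\<close> by simp
    qed
    then obtain p where p: "p \<in> space N" and gp: "g p \<le> 0" by blast
    define J' where "J' = insert p J"
    \<comment> \<open>Points are kept as a set, so a point chosen again has its weight increased by
      \<open>m\<close>.\<close>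
    define a' where "a' i = (if i \<in> J then a i else 0) + (if i = p then m else 0)" for i
    have sum': "(\<Sum>i\<in>J'. a' i * X i \<omega>) = (\<Sum>i\<in>J. a i * X i \<omega>) + m * X p \<omega>" for \<omega>
    proof -
      have "(\<Sum>i\<in>J'. a' i * X i \<omega>) = (\<Sum>i\<in>J'. (if i \<in> J then a i else 0) * X i \<omega>) + (\<Sum>i\<in>J'. (if i = p then m else 0) * X i \<omega>)"
        by (simp add: a'_def distrib_right sum.distrib)
      also have "(\<Sum>i\<in>J'. (if i \<in> J then a i else 0) * X i \<omega>) = (\<Sum>i\<in>J. a i * X i \<omega>)"
        using J by (intro sum.mono_neutral_cong_right) (auto simp: J'_def)
      also have "(\<Sum>i\<in>J'. (if i = p then m else 0) * X i \<omega>) = (\<Sum>i\<in>{p}. m * X i \<omega>)"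
        using J by (intro sum.mono_neutral_cong_right) (auto simp: J'_def)
      finally show ?thesis by simp
    qed
    define D where "D \<omega> = m * X p \<omega> - mean_field \<omega>" for \<omega>
    have D [measurable]: "D \<in> borel_measurable M" unfolding D_def using p by measurable
    have "integrable M (\<lambda>\<omega>. (m * X p \<omega> + (- 1) * mean_field \<omega>)\<^sup>2)"
      using p by (intro integrable_add_squares X_int integrable_mean_field_square) auto
    then have D2: "integrable M (\<lambda>\<omega>. (D \<omega>)\<^sup>2)" by (simp add: D_def)
    have "M.expectation (\<lambda>\<omega>. (D \<omega>)\<^sup>2) \<le> M.expectation (\<lambda>\<omega>. 2 * m\<^sup>2 * (X p \<omega>)\<^sup>2 + 2 * (mean_field \<omega>)\<^sup>2)"
    proof (rule integral_mono[OF D2])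
      show "integrable M (\<lambda>\<omega>. 2 * m\<^sup>2 * (X p \<omega>)\<^sup>2 + 2 * (mean_field \<omega>)\<^sup>2)"
        using X_int[OF p] integrable_mean_field_square by simp
      have sq: "(x - y)\<^sup>2 \<le> 2 * x\<^sup>2 + 2 * y\<^sup>2" for x y :: real
        using zero_le_power2[of "x + y"] by (simp add: power2_eq_square algebra_simps)
      show "(D \<omega>)\<^sup>2 \<le> 2 * m\<^sup>2 * (X p \<omega>)\<^sup>2 + 2 * (mean_field \<omega>)\<^sup>2" for \<omega>
        using sq[of "m * X p \<omega>" "mean_field \<omega>"] by (simp add: D_def power_mult_distrib)
    qed
    also have "\<dots> = 2 * m\<^sup>2 * M.expectation (\<lambda>\<omega>. (X p \<omega>)\<^sup>2) + 2 * V"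
      using X_int[OF p] integrable_mean_field_square by (simp add: V_def)
    also have "\<dots> \<le> K" unfolding K_def using X_le[OF p] by (simp add: mult_left_mono)
    finally have DK: "M.expectation (\<lambda>\<omega>. (D \<omega>)\<^sup>2) \<le> K" .
    have "(\<lambda>\<omega>. ((\<Sum>i\<in>J'. a' i * X i \<omega>) - real (Suc n) * mean_field \<omega>)\<^sup>2)
        = (\<lambda>\<omega>. (S \<omega>)\<^sup>2 + 2 * (m * (X p \<omega> * S \<omega>) - mean_field \<omega> * S \<omega>) + (D \<omega>)\<^sup>2)"
      by (simp add: sum' S_def D_def power2_eq_square algebra_simps fun_eq_iff)
    then have "M.expectation (\<lambda>\<omega>. ((\<Sum>i\<in>J'. a' i * X i \<omega>) - real (Suc n) * mean_field \<omega>)\<^sup>2)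
        = M.expectation (\<lambda>\<omega>. (S \<omega>)\<^sup>2) + 2 * g p + M.expectation (\<lambda>\<omega>. (D \<omega>)\<^sup>2)"
      using S2 iXS[OF p] iYS D2 by (simp add: g_def)
    also have "\<dots> \<le> real n * K + 2 * 0 + K"
      using le gp DK by (intro add_mono) (auto simp: S_def)
    finally have "M.expectation (\<lambda>\<omega>. ((\<Sum>i\<in>J'. a' i * X i \<omega>) - real (Suc n) * mean_field \<omega>)\<^sup>2) \<le> real (Suc n) * K"
      by (simp add: algebra_simps)
    moreover have "finite J'" "J' \<subseteq> space N" using J p by (auto simp: J'_def)
    ultimately show ?case by blast
  qed
  then show ?thesis by (rule that)
qed

text \<open>Linear combinations of the field are exactly Gaussian and centered. Mean-square
  convergence carries over both to their variances and, since
  \<open>cmod (iexp a - iexp b) \<le> \<bar>a - b\<bar>\<close>, to their characteristic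
  functions.\<close>

theorem mean_field_char:
  "char (distr M borel mean_field) t = exp (- (M.expectation (\<lambda>\<omega>. (mean_field \<omega>)\<^sup>2) * t\<^sup>2) / 2)"
proof -
  obtain K where K: "\<And>n. \<exists>J a. finite J \<and> J \<subseteq> space N \<and>
    M.expectation (\<lambda>\<omega>. ((\<Sum>i\<in>J. a i * X i \<omega>) - real n * mean_field \<omega>)\<^sup>2) \<le> real n * K"
    using greedy_sample by blast
  define P where "P n J a \<longleftrightarrow> finite J \<and> J \<subseteq> space N \<and>
    M.expectation (\<lambda>\<omega>. ((\<Sum>i\<in>J. a i * X i \<omega>) - mean_field \<omega>)\<^sup>2) \<le> K / real (Suc n)" for n J a
  \<comment> \<open>Dividing the greedy sum by the number of steps divides the squared error by its
    square, so an error growing linearly becomes \<open>K / Suc n\<close>.\<close>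
  have "\<exists>J a. P n J a" for n
  proof -
    obtain J a where J: "finite J" "J \<subseteq> space N" 
      and le: "M.expectation (\<lambda>\<omega>. ((\<Sum>i\<in>J. a i * X i \<omega>) - real (Suc n) * mean_field \<omega>)\<^sup>2) \<le> real (Suc n) * K"
      using K by blast
    let ?a = "\<lambda>i. a i / real (Suc n)"
    have "(\<Sum>i\<in>J. ?a i * X i \<omega>) - mean_field \<omega> = ((\<Sum>i\<in>J. a i * X i \<omega>) - real (Suc n) * mean_field \<omega>) / real (Suc n)" for \<omega>
      by (simp add: diff_divide_distrib sum_divide_distrib)
    then have "M.expectation (\<lambda>\<omega>. ((\<Sum>i\<in>J. ?a i * X i \<omega>) - mean_field \<omega>)\<^sup>2)
        = M.expectation (\<lambda>\<omega>. ((\<Sum>i\<in>J. a i * X i \<omega>) - real (Suc n) * mean_field \<omega>)\<^sup>2) / (real (Suc n))\<^sup>2"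
      by (simp only: power_divide integral_divide_zero)
    also have "\<dots> \<le> real (Suc n) * K / (real (Suc n))\<^sup>2"
      by (intro divide_right_mono le) simp
    also have "\<dots> = K / real (Suc n)" by (simp add: power2_eq_square)
    finally have "P n J ?a" unfolding P_def using J by blast
    then show ?thesis by blast
  qed
  then obtain J a where "\<And>n. P n (J n) (a n)" by metis
  then have J: "\<And>n. finite (J n)" "\<And>n. J n \<subseteq> space N"
    and le: "\<And>n. M.expectation (\<lambda>\<omega>. ((\<Sum>i\<in>J n. a n i * X i \<omega>) - mean_field \<omega>)\<^sup>2) \<le> K / real (Suc n)"
    by (simp_all only: P_def)
  define S where "S n \<omega> = (\<Sum>i\<in>J n. a n i * X i \<omega>)" for n \<omega>
  have gS: "gaussian_rv M (S n)" for n
    using gauss J unfolding gaussian_field_def S_def by blast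
  then have S [measurable]: "S n \<in> borel_measurable M" for n by (auto simp: gaussian_rv_def)
  have S2: "integrable M (\<lambda>\<omega>. (S n \<omega>)\<^sup>2)" for n
    unfolding S_def using J by (intro integrable_combination_square)
  have iX: "integrable M (X p)" if "p \<in> space N" for p
    by (rule M.square_integrable_imp_integrable) (use that X_int in auto)
  have S0: "M.expectation (S n) = 0" for n
  proof -
    have "M.expectation (S n) = (\<Sum>i\<in>J n. a n i * M.expectation (X i))"
      unfolding S_def using J[of n] iX by (subst Bochner_Integration.integral_sum) auto
    also have "\<dots> = 0" using J[of n] centered by (intro sum.neutral) auto
    finally show ?thesis .
  qed
  define V where "V = M.expectation (\<lambda>\<omega>. (mean_field \<omega>)\<^sup>2)"
  define D where "D n \<omega> = S n \<omega> - mean_field \<omega>" for n \<omega>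
  have D [measurable]: "D n \<in> borel_measurable M" for n unfolding D_def by measurable
  have D2: "integrable M (\<lambda>\<omega>. (D n \<omega>)\<^sup>2)" for n
  proof -
    have "integrable M (\<lambda>\<omega>. (1 * S n \<omega> + (- 1) * mean_field \<omega>)\<^sup>2)"
      by (intro integrable_add_squares S2 integrable_mean_field_square) auto
    then show ?thesis by (simp add: D_def)
  qed
  define e where "e n = M.expectation (\<lambda>\<omega>. (D n \<omega>)\<^sup>2)" for n
  have e: "e \<longlonglongrightarrow> 0"
  proof (rule tendsto_sandwich[where f = "\<lambda>_. 0" and h = "\<lambda>n. K / real (Suc n)"])
    show "(\<lambda>n. K / real (Suc n)) \<longlonglongrightarrow> 0" 
      using LIMSEQ_Suc[OF lim_const_over_n[of K]] .
  qed (use le in \<open>auto simp: e_def D_def S_def\<close>)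
  have iDY: "integrable M (\<lambda>\<omega>. D n \<omega> * mean_field \<omega>)" for n
    by (rule integrable_mult_of_squares) (use D2 integrable_mean_field_square in auto)
  \<comment> \<open>The cross term in the variance of \<open>S n\<close>; Cauchy-Schwarz bounds it
    by the vanishing error \<open>e n\<close>.\<close>
  define c where "c n = M.expectation (\<lambda>\<omega>. D n \<omega> * mean_field \<omega>)" for n
  have "(c n)\<^sup>2 \<le> e n * V" for n
    unfolding c_def e_def V_def by (rule expectation_Cauchy_Schwarz) (use D2 integrable_mean_field_square in auto)
  then have cb: "\<bar>c n\<bar> \<le> sqrt (e n * V)" for n by (intro real_le_rsqrt) simp
  have "(\<lambda>n. sqrt (e n * V)) \<longlonglongrightarrow> sqrt (0 * V)"
    by (intro tendsto_intros e)
  then have sqV: "(\<lambda>n. sqrt (e n * V)) \<longlonglongrightarrow> 0" by simp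
  have c: "c \<longlonglongrightarrow> 0"
    by (rule Lim_null_comparison[OF _ sqV]) (simp add: cb)
  have VS: "M.expectation (\<lambda>\<omega>. (S n \<omega>)\<^sup>2) = e n + 2 * c n + V" for n
  proof -
    have "(\<lambda>\<omega>. (S n \<omega>)\<^sup>2) = (\<lambda>\<omega>. (D n \<omega>)\<^sup>2 + 2 * (D n \<omega> * mean_field \<omega>) + (mean_field \<omega>)\<^sup>2)"
      by (auto simp: D_def power2_eq_square algebra_simps)
    then show ?thesis using D2 iDY integrable_mean_field_square by (simp add: e_def c_def V_def)
  qed
  have "(\<lambda>n. exp (- ((e n + 2 * c n + V) * t\<^sup>2) / 2)) \<longlonglongrightarrow> exp (- ((0 + 2 * 0 + V) * t\<^sup>2) / 2)"
    by (intro tendsto_intros e c) simp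
  then have "(\<lambda>n. complex_of_real (exp (- ((e n + 2 * c n + V) * t\<^sup>2) / 2))) \<longlonglongrightarrow> complex_of_real (exp (- (V * t\<^sup>2) / 2))"
    by (intro tendsto_of_real) simp
  then have lim1: "(\<lambda>n. char (distr M borel (S n)) t) \<longlonglongrightarrow> exp (- (V * t\<^sup>2) / 2)"
    unfolding VS[symmetric] using M.gaussian_rv_char[OF gS S2 S0] by simp
  have "norm (char (distr M borel (S n)) t - char (distr M borel mean_field) t) \<le> \<bar>t\<bar> * sqrt (e n)" for n
  proof -
    have int: "integrable M (\<lambda>\<omega>. iexp (t * f \<omega>))" if [measurable]: "f \<in> borel_measurable M" for f
      by (rule M.integrable_const_bound[where B=1]) auto
    have iD: "integrable M (D n)"
      by (rule M.square_integrable_imp_integrable) (use D2 in auto)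
    have "char (distr M borel (S n)) t - char (distr M borel mean_field) t = (CLINT \<omega>|M. iexp (t * S n \<omega>) - iexp (t * mean_field \<omega>))"
      unfolding char_distr_eq_expectation[OF S] char_distr_eq_expectation[OF mean_field_meas]
      by (rule Bochner_Integration.integral_diff[symmetric]; rule int; measurable)
    also have "norm \<dots> \<le> (\<integral>\<omega>. norm (iexp (t * S n \<omega>) - iexp (t * mean_field \<omega>)) \<partial>M)"
      by (rule integral_norm_bound)
    also have "\<dots> \<le> (\<integral>\<omega>. \<bar>t\<bar> * \<bar>D n \<omega>\<bar> \<partial>M)"
    proof (rule integral_mono)
      show "integrable M (\<lambda>\<omega>. norm (iexp (t * S n \<omega>) - iexp (t * mean_field \<omega>)))"
        by (intro integrable_norm Bochner_Integration.integrable_diff int) auto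
      show "integrable M (\<lambda>\<omega>. \<bar>t\<bar> * \<bar>D n \<omega>\<bar>)" using iD by simp
      show "norm (iexp (t * S n \<omega>) - iexp (t * mean_field \<omega>)) \<le> \<bar>t\<bar> * \<bar>D n \<omega>\<bar>" for \<omega>
        using cmod_iexp_diff_le[of "t * S n \<omega>" "t * mean_field \<omega>"]
        by (simp add: D_def abs_mult flip: right_diff_distrib)
    qed
    also have "\<dots> = \<bar>t\<bar> * (\<integral>\<omega>. \<bar>D n \<omega>\<bar> \<partial>M)" by simp
    also have "(\<integral>\<omega>. \<bar>D n \<omega>\<bar> \<partial>M) \<le> sqrt (e n)"
      using M.power2_integral_le[of "\<lambda>\<omega>. \<bar>D n \<omega>\<bar>"] iD D2
      by (intro real_le_rsqrt) (simp add: e_def M.prob_space)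
    finally show ?thesis by (simp add: mult_left_mono)
  qed
  note cd = this
  have "(\<lambda>n. \<bar>t\<bar> * sqrt (e n)) \<longlonglongrightarrow> \<bar>t\<bar> * sqrt 0"
    by (intro tendsto_intros e)
  then have sqe: "(\<lambda>n. \<bar>t\<bar> * sqrt (e n)) \<longlonglongrightarrow> 0" by simp
  have "(\<lambda>n. char (distr M borel (S n)) t - char (distr M borel mean_field) t) \<longlonglongrightarrow> 0"
    by (rule Lim_null_comparison[OF _ sqe]) (simp add: cd)
  from tendsto_diff[OF lim1 this] have "(\<lambda>n. char (distr M borel mean_field) t) \<longlonglongrightarrow> exp (- (V * t\<^sup>2) / 2)"
    by simp
  then show ?thesis unfolding V_def by (simp add: LIMSEQ_const_iff)
qed

theorem mean_field_distr_normal: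
  assumes V: "M.expectation (\<lambda>\<omega>. (mean_field \<omega>)\<^sup>2) = \<sigma>\<^sup>2" and \<sigma>: "\<sigma> > 0"
  shows "distr M borel (\<lambda>\<omega>. mean_field \<omega> / \<sigma>) = std_normal_distribution"
proof (rule Levy_uniqueness)
  show "real_distribution (distr M borel (\<lambda>\<omega>. mean_field \<omega> / \<sigma>))"
    by (rule M.real_distribution_distr) simp
  show "real_distribution std_normal_distribution"
    by (rule real_dist_normal_dist)
  show "char (distr M borel (\<lambda>\<omega>. mean_field \<omega> / \<sigma>)) = char std_normal_distribution"
  proof
    fix t
    have "char (distr M borel (\<lambda>\<omega>. mean_field \<omega> / \<sigma>)) t = char (distr M borel mean_field) (t / \<sigma>)"
      by (simp add: char_distr_eq_expectation)
    also have "\<dots> = exp (- (t\<^sup>2) / 2)"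
      using \<sigma> by (simp add: mean_field_char V power_divide)
    finally show "char (distr M borel (\<lambda>\<omega>. mean_field \<omega> / \<sigma>)) t = char std_normal_distribution t"
      by (simp add: char_std_normal_distribution)
  qed
qed

end

section \<open>Bivariate normal distributions\<close>

lemma (in prob_space) prob_space_weighted:
  fixes w :: "'a \<Rightarrow> real"
  assumes [measurable]: "w \<in> borel_measurable M" and w: "\<And>\<omega>. 1 \<le> w \<omega>" "\<And>\<omega>. w \<omega> \<le> 3"
  shows "1 \<le> expectation w" and "prob_space (density M (\<lambda>\<omega>. ennreal (w \<omega> / expectation w)))"
proof -
  have w0: "0 \<le> w \<omega>" for \<omega> using w(1)[of \<omega>] by linarith
  have iw: "integrable M w"
    by (rule integrable_const_bound[where B=3]) (use w w0 in auto)
  have "expectation (\<lambda>_. 1) \<le> expectation w"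
    by (intro integral_mono iw) (use w in auto)
  then show c: "1 \<le> expectation w" by (simp add: prob_space)
  show "prob_space (density M (\<lambda>\<omega>. ennreal (w \<omega> / expectation w)))"
  proof (rule prob_spaceI)
    have "emeasure (density M (\<lambda>\<omega>. ennreal (w \<omega> / expectation w))) (space M) = (\<integral>\<^sup>+\<omega>. ennreal (w \<omega> / expectation w) \<partial>M)"
      by (subst emeasure_density) (auto intro!: nn_integral_cong)
    also have "\<dots> = ennreal (expectation (\<lambda>\<omega>. w \<omega> / expectation w))"
      using w0 c iw by (intro nn_integral_eq_integral) auto
    also have "\<dots> = 1" using c by simp
    finally show "emeasure (density M (\<lambda>\<omega>. ennreal (w \<omega> / expectation w))) (space (density M (\<lambda>\<omega>. ennreal (w \<omega> / expectation w)))) = 1"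
      by simp
  qed
qed

text \<open>Dividing the weights by their means makes them probability densities, so uniqueness on
  the line applies to the tilted laws. The bounds 1 and 3 accommodate \<open>2 + cos\<close>,
  \<open>2 + sin\<close> and \<open>1 + indicator\<close>.\<close>

lemma weighted_char_uniqueness:
  fixes w :: "'a \<Rightarrow> real" and w' :: "'b \<Rightarrow> real"
  assumes M: "prob_space M" and M': "prob_space M'"
    and [measurable]: "w \<in> borel_measurable M" "w' \<in> borel_measurable M'" "X \<in> borel_measurable M" "X' \<in> borel_measurable M'"
    and w: "\<And>\<omega>. 1 \<le> w \<omega>" "\<And>\<omega>. w \<omega> \<le> 3" and w': "\<And>\<omega>. 1 \<le> w' \<omega>" "\<And>\<omega>. w' \<omega> \<le> 3"
    and eq: "\<And>t. (CLINT \<omega>|M. w \<omega> * iexp (t * X \<omega>)) = (CLINT \<omega>|M'. w' \<omega> * iexp (t * X' \<omega>))"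
    and A [measurable]: "A \<in> sets borel"
  shows "(\<integral>\<omega>. w \<omega> * indicator A (X \<omega>) \<partial>M) = (\<integral>\<omega>. w' \<omega> * indicator A (X' \<omega>) \<partial>M')"
proof -
  interpret M: prob_space M by fact
  interpret M': prob_space M' by fact
  let ?c = "M.expectation w"
  \<comment> \<open>At \<open>t = 0\<close> the hypothesis equates the two normalising
    constants.\<close>
  have "complex_of_real ?c = complex_of_real (M'.expectation w')"
    using eq[of 0] by simp
  then have cc: "M'.expectation w' = ?c" by (simp only: of_real_eq_iff)
  have c: "?c \<ge> 1" by (rule M.prob_space_weighted) (use w in auto)
  have w0: "0 \<le> w \<omega>" "0 \<le> w' \<omega>'" for \<omega> \<omega>' using w(1)[of \<omega>] w'(1)[of \<omega>'] by auto
  let ?D = "density M (\<lambda>\<omega>. ennreal (w \<omega> / ?c))" and ?D' = "density M' (\<lambda>\<omega>. ennreal (w' \<omega> / ?c))"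
  interpret D: prob_space ?D by (rule M.prob_space_weighted) (use w in auto)
  interpret D': prob_space ?D' unfolding cc[symmetric] by (rule M'.prob_space_weighted) (use w' in auto)
  have "distr ?D borel X = distr ?D' borel X'"
  proof (rule Levy_uniqueness)
    show "real_distribution (distr ?D borel X)" "real_distribution (distr ?D' borel X')"
      by (auto intro!: D.real_distribution_distr D'.real_distribution_distr)
    show "char (distr ?D borel X) = char (distr ?D' borel X')"
    proof
      fix t
      have "char (distr ?D borel X) t = (CLINT \<omega>|M. (w \<omega> / ?c) *\<^sub>R iexp (t * X \<omega>))"
        using w0 c by (subst char_distr_eq_expectation) (auto intro!: integral_density)
      also have "\<dots> = (CLINT \<omega>|M. w \<omega> * iexp (t * X \<omega>)) / ?c"
        by (simp add: scaleR_conv_of_real flip: Bochner_Integration.integral_divide_zero)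
      also have "\<dots> = (CLINT \<omega>|M'. (w' \<omega> / ?c) *\<^sub>R iexp (t * X' \<omega>))"
        unfolding eq by (simp add: scaleR_conv_of_real flip: Bochner_Integration.integral_divide_zero)
      also have "\<dots> = char (distr ?D' borel X') t"
        using w0 c by (subst char_distr_eq_expectation) (auto intro!: integral_density[symmetric])
      finally show "char (distr ?D borel X) t = char (distr ?D' borel X') t" .
    qed
  qed
  moreover have "(\<integral>x. indicator A x \<partial>distr ?D borel X) = (\<integral>\<omega>. (w \<omega> / ?c) *\<^sub>R indicator A (X \<omega>) \<partial>M :: real)"
    using w0 c by (subst integral_distr, simp, simp, subst integral_density) auto
  moreover have "(\<integral>x. indicator A x \<partial>distr ?D' borel X') = (\<integral>\<omega>. (w' \<omega> / ?c) *\<^sub>R indicator A (X' \<omega>) \<partial>M' :: real)"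
    using w0 c by (subst integral_distr, simp, simp, subst integral_density) auto
  ultimately have "(\<integral>\<omega>. (w \<omega> / ?c) *\<^sub>R indicator A (X \<omega>) \<partial>M) = (\<integral>\<omega>. (w' \<omega> / ?c) *\<^sub>R indicator A (X' \<omega>) \<partial>M' :: real)"
    by (simp only:)
  then have "(\<integral>\<omega>. w \<omega> * indicator A (X \<omega>) \<partial>M) / ?c = (\<integral>\<omega>. w' \<omega> * indicator A (X' \<omega>) \<partial>M') / ?c"
    by (simp del: div_0 flip: Bochner_Integration.integral_divide_zero)
  then show ?thesis using c by simp
qed

lemma integral_combination3:
  fixes f g h :: "'a \<Rightarrow> complex"
  assumes "integrable M f" "integrable M g" "integrable M h"
  shows "(\<integral>x. c * f x + g x / k + h x / l \<partial>M) = c * (\<integral>x. f x \<partial>M) + (\<integral>x. g x \<partial>M) / k + (\<integral>x. h x \<partial>M) / l"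
  using assms by simp

lemma integral_add_Re_Im:
  fixes f :: "'a \<Rightarrow> complex" and g h :: "'a \<Rightarrow> real"
  assumes "integrable M f" "integrable M g" "integrable M h"
  shows "(\<integral>x. f x + complex_of_real (g x) + \<i> * complex_of_real (h x) \<partial>M)
    = (\<integral>x. f x \<partial>M) + complex_of_real (\<integral>x. g x \<partial>M) + \<i> * complex_of_real (\<integral>x. h x \<partial>M)"
  using assms by simp

lemma iexp_add: "iexp (u + v) = iexp u * iexp v"
  by (simp add: exp_add distrib_left)

text \<open>Writing cosine and sine through exponentials expresses the weighted characteristic
  function by the joint one at \<open>(a, 0)\<close>, \<open>(a, b)\<close> and
  \<open>(a, - b)\<close>. The summand \<open>0 * Y \<omega>\<close> keeps all three in the same
  form.\<close>

lemma (in prob_space) integral_cos_iexp: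
  assumes [measurable]: "X \<in> borel_measurable M" "Y \<in> borel_measurable M"
  shows "(CLINT \<omega>|M. complex_of_real (2 + cos (b * Y \<omega>)) * iexp (a * X \<omega>))
      = 2 * (CLINT \<omega>|M. iexp (a * X \<omega> + 0 * Y \<omega>)) + (CLINT \<omega>|M. iexp (a * X \<omega> + b * Y \<omega>)) / 2
        + (CLINT \<omega>|M. iexp (a * X \<omega> + (- b) * Y \<omega>)) / 2"
    (is ?cos)
    and "(CLINT \<omega>|M. complex_of_real (2 + sin (b * Y \<omega>)) * iexp (a * X \<omega>))
      = 2 * (CLINT \<omega>|M. iexp (a * X \<omega> + 0 * Y \<omega>)) + (CLINT \<omega>|M. iexp (a * X \<omega> + b * Y \<omega>)) / (2 * \<i>)
        + (CLINT \<omega>|M. iexp (a * X \<omega> + (- b) * Y \<omega>)) / (- (2 * \<i>))"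
    (is ?sin)
proof -
  have i: "integrable M (\<lambda>\<omega>. iexp (f \<omega>))" if [measurable]: "f \<in> borel_measurable M" for f
    by (rule integrable_const_bound[where B=1]) auto
  have sp: "complex_of_real (2 + cos (b * y)) * iexp (a * x)
      = 2 * iexp (a * x + 0 * y) + iexp (a * x + b * y) / 2 + iexp (a * x + (- b) * y) / 2" for a b x y
  proof -
    have "complex_of_real (cos (b * y)) = (iexp (b * y) + iexp ((- b) * y)) / 2"
      by (simp add: cos_exp_eq flip: cos_of_real)
    moreover have "(2 + (P + Q) / 2) * R = 2 * (R * 1) + R * P / 2 + R * Q / 2" for P Q R :: complex
      by (simp add: field_simps)
    ultimately show ?thesis unfolding iexp_add by (simp only: of_real_add mult_zero_left of_real_0 mult_zero_right exp_zero of_real_numeral)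
  qed
  have sn: "complex_of_real (2 + sin (b * y)) * iexp (a * x)
      = 2 * iexp (a * x + 0 * y) + iexp (a * x + b * y) / (2 * \<i>) + iexp (a * x + (- b) * y) / (- (2 * \<i>))" for a b x y
  proof -
    have "complex_of_real (sin (b * y)) = (iexp (b * y) - iexp ((- b) * y)) / (2 * \<i>)"
      by (simp add: sin_exp_eq flip: sin_of_real)
    moreover have "(2 + (P - Q) / (2 * \<i>)) * R = 2 * (R * 1) + R * P / (2 * \<i>) + R * Q / (- (2 * \<i>))" for P Q R
      by (simp add: field_simps)
    ultimately show ?thesis unfolding iexp_add by (simp only: of_real_add mult_zero_left of_real_0 mult_zero_right exp_zero of_real_numeral)
  qed
  show ?cos unfolding sp by (rule integral_combination3; rule i; measurable)
  show ?sin unfolding sn by (rule integral_combination3; rule i; measurable)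
qed

text \<open>
  Uniqueness in two dimensions is reduced to uniqueness on the line by testing against the weights
  \<open>2 + cos (b Y)\<close>, \<open>2 + sin (b Y)\<close> and \<open>1 + 1\<^sub>A(X)\<close>; the added constants make them positive
  densities of probability measures.
\<close>

theorem distr_pair_eqI_char:
  fixes X Y :: "'a \<Rightarrow> real" and X' Y' :: "'b \<Rightarrow> real"
  assumes M: "prob_space M" and M': "prob_space M'"
    and X [measurable]: "X \<in> borel_measurable M" and Y [measurable]: "Y \<in> borel_measurable M"
    and X' [measurable]: "X' \<in> borel_measurable M'" and Y' [measurable]: "Y' \<in> borel_measurable M'"
    and eq: "\<And>a b. (CLINT \<omega>|M. iexp (a * X \<omega> + b * Y \<omega>)) = (CLINT \<omega>|M'. iexp (a * X' \<omega> + b * Y' \<omega>))"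
  shows "distr M (borel \<Otimes>\<^sub>M borel) (\<lambda>\<omega>. (X \<omega>, Y \<omega>)) = distr M' (borel \<Otimes>\<^sub>M borel) (\<lambda>\<omega>. (X' \<omega>, Y' \<omega>))"
proof -
  interpret M: prob_space M by fact
  interpret M': prob_space M' by fact
  have i: "integrable M (\<lambda>\<omega>. iexp (f \<omega>))" if [measurable]: "f \<in> borel_measurable M" for f
    by (rule M.integrable_const_bound[where B=1]) auto
  have i': "integrable M' (\<lambda>\<omega>. iexp (f \<omega>))" if [measurable]: "f \<in> borel_measurable M'" for f
    by (rule M'.integrable_const_bound[where B=1]) auto
  have b3: "1 \<le> 2 + cos z" "2 + cos z \<le> 3" "1 \<le> 2 + sin z" "2 + sin z \<le> 3" for z :: real
    using cos_ge_minus_one[of z] cos_le_one[of z] sin_ge_minus_one[of z] sin_le_one[of z] by linarith+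
  have C: "(\<integral>\<omega>. (2 + cos (b * Y \<omega>)) * indicator A (X \<omega>) \<partial>M) = (\<integral>\<omega>. (2 + cos (b * Y' \<omega>)) * indicator A (X' \<omega>) \<partial>M')"
    if [measurable]: "A \<in> sets borel" for A b
  proof (rule weighted_char_uniqueness[OF M M'])
    fix a
    show "(CLINT \<omega>|M. complex_of_real (2 + cos (b * Y \<omega>)) * iexp (a * X \<omega>)) = (CLINT \<omega>|M'. complex_of_real (2 + cos (b * Y' \<omega>)) * iexp (a * X' \<omega>))"
      unfolding M.integral_cos_iexp(1)[OF X Y] M'.integral_cos_iexp(1)[OF X' Y'] eq ..
  qed (use b3 in auto)
  have S: "(\<integral>\<omega>. (2 + sin (b * Y \<omega>)) * indicator A (X \<omega>) \<partial>M) = (\<integral>\<omega>. (2 + sin (b * Y' \<omega>)) * indicator A (X' \<omega>) \<partial>M')"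
    if [measurable]: "A \<in> sets borel" for A b
  proof (rule weighted_char_uniqueness[OF M M'])
    fix a
    show "(CLINT \<omega>|M. complex_of_real (2 + sin (b * Y \<omega>)) * iexp (a * X \<omega>)) = (CLINT \<omega>|M'. complex_of_real (2 + sin (b * Y' \<omega>)) * iexp (a * X' \<omega>))"
      unfolding M.integral_cos_iexp(2)[OF X Y] M'.integral_cos_iexp(2)[OF X' Y'] eq ..
  qed (use b3 in auto)
  have bi: "integrable M (\<lambda>\<omega>. g \<omega> * indicator A (X \<omega>))" if [measurable]: "A \<in> sets borel" "g \<in> borel_measurable M" and "\<And>\<omega>. \<bar>g \<omega>\<bar> \<le> 1" for g :: "'a \<Rightarrow> real" and A
    by (rule M.integrable_const_bound[where B=1]) (use that in \<open>auto split: split_indicator\<close>)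
  have bi': "integrable M' (\<lambda>\<omega>. g \<omega> * indicator A (X' \<omega>))" if [measurable]: "A \<in> sets borel" "g \<in> borel_measurable M'" and "\<And>\<omega>. \<bar>g \<omega>\<bar> \<le> 1" for g :: "'b \<Rightarrow> real" and A
    by (rule M'.integrable_const_bound[where B=1]) (use that in \<open>auto split: split_indicator\<close>)
  have P: "(\<integral>\<omega>. indicator A (X \<omega>) \<partial>M) = (\<integral>\<omega>. indicator A (X' \<omega>) \<partial>M' :: real)" if [measurable]: "A \<in> sets borel" for A
    using C[OF that, of 0] by simp
  have C': "(\<integral>\<omega>. cos (b * Y \<omega>) * indicator A (X \<omega>) \<partial>M) = (\<integral>\<omega>. cos (b * Y' \<omega>) * indicator A (X' \<omega>) \<partial>M')"
    if [measurable]: "A \<in> sets borel" for A b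
    using C[OF that, of b] P[OF that] bi[OF that, of "\<lambda>_. 1"] bi'[OF that, of "\<lambda>_. 1"] bi[OF that, of "\<lambda>\<omega>. cos (b * Y \<omega>)"] bi'[OF that, of "\<lambda>\<omega>. cos (b * Y' \<omega>)"]
    by (simp add: distrib_right)
  have S': "(\<integral>\<omega>. sin (b * Y \<omega>) * indicator A (X \<omega>) \<partial>M) = (\<integral>\<omega>. sin (b * Y' \<omega>) * indicator A (X' \<omega>) \<partial>M')"
    if [measurable]: "A \<in> sets borel" for A b
    using S[OF that, of b] P[OF that] bi[OF that, of "\<lambda>_. 1"] bi'[OF that, of "\<lambda>_. 1"] bi[OF that, of "\<lambda>\<omega>. sin (b * Y \<omega>)"] bi'[OF that, of "\<lambda>\<omega>. sin (b * Y' \<omega>)"]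
    by (simp add: distrib_right)
  \<comment> \<open>Now the roles are exchanged: with \<open>j\<close> the indicator of
    \<open>X\<close> in \<open>A\<close>, the characteristic function of \<open>Y\<close> under the
    weight \<open>1 + j\<close> splits into the integrals already known from \<open>C'\<close> and
    \<open>S'\<close>.\<close>
  have E: "complex_of_real (1 + j) * iexp (b * y) = iexp (b * y) + complex_of_real (cos (b * y) * j) + \<i> * complex_of_real (sin (b * y) * j)" for j b y
    by (simp add: distrib_right distrib_left mult_ac) (simp add: exp_Euler algebra_simps flip: cos_of_real sin_of_real)
  have eq0: "(CLINT \<omega>|M. iexp (b * Y \<omega>)) = (CLINT \<omega>|M'. iexp (b * Y' \<omega>))" for b
    using eq[of 0 b] by simp
  have J: "(\<integral>\<omega>. (1 + indicator A (X \<omega>)) * indicator B (Y \<omega>) \<partial>M) = (\<integral>\<omega>. (1 + indicator A (X' \<omega>)) * indicator B (Y' \<omega>) \<partial>M' :: real)"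
    if [measurable]: "A \<in> sets borel" "B \<in> sets borel" for A B
  proof (rule weighted_char_uniqueness[OF M M'])
    fix b
    have L: "(CLINT \<omega>|M. complex_of_real (1 + indicator A (X \<omega>)) * iexp (b * Y \<omega>))
      = (CLINT \<omega>|M. iexp (b * Y \<omega>)) + complex_of_real (\<integral>\<omega>. cos (b * Y \<omega>) * indicator A (X \<omega>) \<partial>M) + \<i> * complex_of_real (\<integral>\<omega>. sin (b * Y \<omega>) * indicator A (X \<omega>) \<partial>M)"
      unfolding E by (rule integral_add_Re_Im; (rule i bi)?; (measurable | simp)?)
    have R: "(CLINT \<omega>|M'. complex_of_real (1 + indicator A (X' \<omega>)) * iexp (b * Y' \<omega>))
      = (CLINT \<omega>|M'. iexp (b * Y' \<omega>)) + complex_of_real (\<integral>\<omega>. cos (b * Y' \<omega>) * indicator A (X' \<omega>) \<partial>M') + \<i> * complex_of_real (\<integral>\<omega>. sin (b * Y' \<omega>) * indicator A (X' \<omega>) \<partial>M')"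
      unfolding E by (rule integral_add_Re_Im; (rule i' bi')?; (measurable | simp)?)
    show "(CLINT \<omega>|M. complex_of_real (1 + indicator A (X \<omega>)) * iexp (b * Y \<omega>)) = (CLINT \<omega>|M'. complex_of_real (1 + indicator A (X' \<omega>)) * iexp (b * Y' \<omega>))"
      unfolding L R eq0 C'[OF that(1)] S'[OF that(1)] ..
  qed (auto split: split_indicator)
  have rect: "M.prob {\<omega>\<in>space M. X \<omega> \<in> A \<and> Y \<omega> \<in> B} = M'.prob {\<omega>\<in>space M'. X' \<omega> \<in> A \<and> Y' \<omega> \<in> B}"
    if [measurable]: "A \<in> sets borel" "B \<in> sets borel" for A B
  proof -
    \<comment> \<open>Subtracting the instance with the empty set removes the constant 1 of the
      weight and leaves the probability of a rectangle.\<close>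
    have "(\<integral>\<omega>. (1 + indicator A (X \<omega>)) * indicator B (Y \<omega>) \<partial>M) - (\<integral>\<omega>. (1 + indicator {} (X \<omega>)) * indicator B (Y \<omega>) \<partial>M)
        = (\<integral>\<omega>. indicator {\<omega>\<in>space M. X \<omega> \<in> A \<and> Y \<omega> \<in> B} \<omega> \<partial>M :: real)"
    proof (subst Bochner_Integration.integral_diff[symmetric])
      show "integrable M (\<lambda>\<omega>. (1 + indicator A (X \<omega>)) * indicator B (Y \<omega>) :: real)" "integrable M (\<lambda>\<omega>. (1 + indicator {} (X \<omega>)) * indicator B (Y \<omega>) :: real)"
        by (rule M.integrable_const_bound[where B=2]; auto split: split_indicator)+
    qed (rule Bochner_Integration.integral_cong, auto split: split_indicator)
    moreover have "(\<integral>\<omega>. (1 + indicator A (X' \<omega>)) * indicator B (Y' \<omega>) \<partial>M') - (\<integral>\<omega>. (1 + indicator {} (X' \<omega>)) * indicator B (Y' \<omega>) \<partial>M')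
        = (\<integral>\<omega>. indicator {\<omega>\<in>space M'. X' \<omega> \<in> A \<and> Y' \<omega> \<in> B} \<omega> \<partial>M' :: real)"
    proof (subst Bochner_Integration.integral_diff[symmetric])
      show "integrable M' (\<lambda>\<omega>. (1 + indicator A (X' \<omega>)) * indicator B (Y' \<omega>) :: real)" "integrable M' (\<lambda>\<omega>. (1 + indicator {} (X' \<omega>)) * indicator B (Y' \<omega>) :: real)"
        by (rule M'.integrable_const_bound[where B=2]; auto split: split_indicator)+
    qed (rule Bochner_Integration.integral_cong, auto split: split_indicator)
    ultimately show ?thesis using J[OF that] J[of "{}" B] that by simp
  qed
  let ?L = "distr M (borel \<Otimes>\<^sub>M borel) (\<lambda>\<omega>. (X \<omega>, Y \<omega>))" and ?R = "distr M' (borel \<Otimes>\<^sub>M borel) (\<lambda>\<omega>. (X' \<omega>, Y' \<omega>))"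
  let ?E = "{a \<times> b |a b. a \<in> sets (borel :: real measure) \<and> b \<in> sets (borel :: real measure)}"
  show ?thesis
  proof (rule measure_eqI_generator_eq[where E="?E" and \<Omega>=UNIV and A="\<lambda>_::nat. UNIV"])
    show "Int_stable ?E" by (rule Int_stable_pair_measure_generator)
    show "sets ?L = sigma_sets UNIV ?E" "sets ?R = sigma_sets UNIV ?E"
      by (simp_all add: sets_pair_measure)
    have "prob_space ?L" by (rule M.prob_space_distr) measurable
    then show "emeasure ?L UNIV \<noteq> \<infinity>"
      by (simp add: finite_measure.emeasure_finite prob_space.finite_measure)
    show "range (\<lambda>_::nat. UNIV :: (real \<times> real) set) \<subseteq> ?E"
      using UNIV_Times_UNIV[where 'a=real and 'b=real] by (auto intro!: exI[of _ UNIV])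
    fix Z assume "Z \<in> ?E"
    then obtain A B where Z: "Z = A \<times> B" and [measurable]: "A \<in> sets borel" "B \<in> sets borel" by auto
    have "emeasure ?L Z = M.prob {\<omega>\<in>space M. X \<omega> \<in> A \<and> Y \<omega> \<in> B}"
      unfolding Z by (subst emeasure_distr) (auto simp: M.emeasure_eq_measure intro!: arg_cong[where f="M.prob"])
    moreover have "emeasure ?R Z = M'.prob {\<omega>\<in>space M'. X' \<omega> \<in> A \<and> Y' \<omega> \<in> B}"
      unfolding Z by (subst emeasure_distr) (auto simp: M'.emeasure_eq_measure intro!: arg_cong[where f="M'.prob"])
    ultimately show "emeasure ?L Z = emeasure ?R Z" using rect by simp
  qed auto
qed

section \<open>First-order expansion of the normal distribution function\<close>

lemma std_normal_density_le_1: "std_normal_density x \<le> 1"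
proof -
  have "1 \<le> sqrt (2 * pi)" using pi_ge_two by simp
  moreover have "exp (- (x\<^sup>2 / 2)) \<le> 1" by simp
  ultimately have "exp (- (x\<^sup>2 / 2)) \<le> sqrt (2 * pi)" by linarith
  then show ?thesis by (simp add: std_normal_density_def divide_simps)
qed

text \<open>Mean value theorem: the derivative is \<open>- z * std_normal_density z\<close>, and
  \<open>\<bar>z\<bar> \<le> 1 + z\<^sup>2 / 2 \<le> exp (z\<^sup>2 / 2)\<close> bounds it by 1 in
  modulus.\<close>

lemma std_normal_density_lipschitz: "\<bar>std_normal_density x - std_normal_density y\<bar> \<le> \<bar>x - y\<bar>"
proof -
  have d: "(std_normal_density has_real_derivative - z * std_normal_density z) (at z)" for z
  proof -
    define c where "c = 1 / sqrt (2 * pi)"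
    have e: "std_normal_density = (\<lambda>x. c * exp (- x\<^sup>2 / 2))"
      by (auto simp: std_normal_density_def c_def)
    show ?thesis unfolding e by (auto intro!: derivative_eq_intros)
  qed
  have b: "\<bar>- z * std_normal_density z\<bar> \<le> 1" for z :: real
  proof -
    have "0 \<le> (\<bar>z\<bar> - 1)\<^sup>2" by simp
    then have "\<bar>z\<bar> \<le> 1 + z\<^sup>2 / 2" by (simp add: power2_eq_square algebra_simps)
    also have "\<dots> \<le> exp (z\<^sup>2 / 2)" by (rule exp_ge_add_one_self)
    also have "\<dots> \<le> sqrt (2 * pi) * exp (z\<^sup>2 / 2)" using pi_ge_two by simp
    finally show ?thesis by (simp add: std_normal_density_def abs_mult exp_minus divide_simps)
  qed
  have *: "\<bar>std_normal_density b - std_normal_density a\<bar> \<le> \<bar>b - a\<bar>" if ab: "a < b" for a b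
  proof -
    obtain z where "std_normal_density b - std_normal_density a = (b - a) * (- z * std_normal_density z)"
      using MVT2[OF ab, of std_normal_density "\<lambda>z. - z * std_normal_density z"] d by auto
    then have "\<bar>std_normal_density b - std_normal_density a\<bar> = \<bar>b - a\<bar> * \<bar>- z * std_normal_density z\<bar>"
      by (simp only: abs_mult)
    also have "\<dots> \<le> \<bar>b - a\<bar> * 1" by (intro mult_left_mono b) simp
    finally show ?thesis by simp
  qed
  show ?thesis using *[of x y] *[of y x] by (cases x y rule: linorder_cases) (auto simp: abs_minus_commute)
qed

lemma set_integrable_std_normal: "A \<in> sets borel \<Longrightarrow> set_integrable lborel A std_normal_density"
  unfolding set_integrable_def by (intro integrable_mult_indicator) (auto intro: integrable_std_normal_moment[of 0, simplified])

lemma std_normal_cdf_diff_aux: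
  assumes "a \<le> b" and c: "c = a \<or> c = b"
  shows "\<bar>std_normal_cdf b - std_normal_cdf a - std_normal_density c * (b - a)\<bar> \<le> (b - a)\<^sup>2"
proof -
  have "{..b} = {..a} \<union> {a<..b}" using assms(1) by auto
  then have "std_normal_cdf b = std_normal_cdf a + (LINT w:{a<..b}|lborel. std_normal_density w)"
    unfolding std_normal_cdf_def
    by (simp only:) (rule set_integral_Un; auto intro: set_integrable_std_normal)
  moreover have "(LINT w:{a<..b}|lborel. std_normal_density c) = std_normal_density c * (b - a)"
    using assms(1) by (simp add: set_lebesgue_integral_def)
  moreover have si: "set_integrable lborel {a<..b} (\<lambda>_. k)" for k :: real
    using assms(1) unfolding set_integrable_def by (intro integrable_scaleR_left impI integrable_real_indicator) auto
  ultimately have "std_normal_cdf b - std_normal_cdf a - std_normal_density c * (b - a)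
      = (LINT w:{a<..b}|lborel. std_normal_density w - std_normal_density c)"
    by (simp add: set_integral_diff set_integrable_std_normal)
  also have "\<bar>\<dots>\<bar> \<le> (LINT w:{a<..b}|lborel. \<bar>std_normal_density w - std_normal_density c\<bar>)"
    using set_integral_norm_bound[of lborel "{a<..b}" "\<lambda>w. std_normal_density w - std_normal_density c"]
    by (simp add: set_integral_diff set_integrable_std_normal si)
  also have "\<dots> \<le> (LINT w:{a<..b}|lborel. b - a)"
  proof (rule set_integral_mono)
    show "set_integrable lborel {a<..b} (\<lambda>w. \<bar>std_normal_density w - std_normal_density c\<bar>)"
      by (intro set_integrable_abs set_integral_diff set_integrable_std_normal si) auto
    show "set_integrable lborel {a<..b} (\<lambda>w. b - a)" by (rule si)
    fix w assume "w \<in> {a<..b}"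
    then show "\<bar>std_normal_density w - std_normal_density c\<bar> \<le> b - a"
      using c by (intro order_trans[OF std_normal_density_lipschitz]) auto
  qed
  also have "\<dots> = (b - a)\<^sup>2"
    using assms(1) by (simp add: set_lebesgue_integral_def power2_eq_square)
  finally show ?thesis .
qed

lemma std_normal_cdf_taylor:
  "\<bar>std_normal_cdf v - std_normal_cdf u - std_normal_density u * (v - u)\<bar> \<le> (v - u)\<^sup>2"
proof (cases "u \<le> v")
  case True
  then show ?thesis using std_normal_cdf_diff_aux[of u v u] by simp
next
  case False
  then have "\<bar>std_normal_cdf u - std_normal_cdf v - std_normal_density u * (u - v)\<bar> \<le> (u - v)\<^sup>2"
    using std_normal_cdf_diff_aux[of v u u] by simp
  moreover have "\<bar>std_normal_cdf v - std_normal_cdf u - std_normal_density u * (v - u)\<bar>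
      = \<bar>std_normal_cdf u - std_normal_cdf v - std_normal_density u * (u - v)\<bar>"
    by (subst abs_minus_cancel[symmetric]) (simp add: algebra_simps)
  ultimately show ?thesis by (simp add: power2_commute)
qed

lemma prob_std_normal_atLeast: "measure std_normal_distribution {v..} = 1 - std_normal_cdf v"
proof -
  interpret real_distribution std_normal_distribution by (rule real_dist_normal_dist)
  have m: "measure std_normal_distribution A = (LINT w:A|lborel. std_normal_density w)" if [measurable]: "A \<in> sets borel" for A
  proof -
    have "measure std_normal_distribution A = (\<integral>x. indicator A x \<partial>std_normal_distribution)" by simp
    also have "\<dots> = (LINT w:A|lborel. std_normal_density w)"
      unfolding set_lebesgue_integral_def
      by (subst integral_density) (auto simp: mult.commute)
    finally show ?thesis .
  qed
  have "measure std_normal_distribution {v} = 0"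
    unfolding m[OF borel_singleton[OF sets.empty_sets]] set_lebesgue_integral_def
    by (rule integral_eq_zero_AE) (use AE_lborel_singleton[of v] in \<open>auto elim!: eventually_mono\<close>)
  moreover have "measure std_normal_distribution ({v<..} \<union> {v}) = measure std_normal_distribution {v<..} + measure std_normal_distribution {v}"
    by (intro finite_measure_Union) auto
  moreover have "{v<..} \<union> {v} = {v..}" by auto
  moreover have "measure std_normal_distribution {v<..} = 1 - measure std_normal_distribution {..v}"
    using prob_compl[of "{..v}"] by (simp add: Compl_eq_Diff_UNIV[symmetric])
  moreover have "measure std_normal_distribution {..v} = std_normal_cdf v"
    by (simp add: m std_normal_cdf_def)
  ultimately show ?thesis by simp
qed

section \<open>The nonlinear remainder under the standard normal law\<close>

lemma std_normal_integral:
  "has_bochner_integral lborel (\<lambda>x. std_normal_density x * f x) a \<Longrightarrow> f \<in> borel_measurable borel \<Longrightarrow>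
    has_bochner_integral std_normal_distribution f (a :: real)"
  by (rule has_bochner_integral_density) auto

lemma std_normal_first_moment: "has_bochner_integral std_normal_distribution (\<lambda>x. x) 0"
  using std_normal_moment_odd[of 0] by (intro std_normal_integral) auto

lemma std_normal_integrable_power: "integrable std_normal_distribution (\<lambda>x. x ^ k)"
proof -
  have "has_bochner_integral lborel (\<lambda>x. std_normal_density x * x ^ k) (\<integral>x. std_normal_density x * x ^ k \<partial>lborel)"
    using integrable_std_normal_moment by (rule has_bochner_integral_integrable)
  from std_normal_integral[OF this] show ?thesis by (auto simp: has_bochner_integral_iff)
qed

text \<open>The indicator minus its projection, in the space of square integrable functions of a
  standard normal variable, onto the span of 1 and \<open>x\<close>. The coefficient of
  \<open>x\<close> is the mean of \<open>X\<close> on the event \<open>X \<ge> u\<close>, which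
  equals \<open>std_normal_density u\<close>.\<close>

definition sojourn_remainder :: "real \<Rightarrow> real \<Rightarrow> real" where
  "sojourn_remainder u x = of_bool (x \<ge> u) - (1 - std_normal_cdf u) - std_normal_density u * x"

lemma borel_measurable_sojourn_remainder [measurable]: "sojourn_remainder u \<in> borel_measurable borel"
  unfolding sojourn_remainder_def by measurable

lemma sojourn_remainder_square_le: "(sojourn_remainder u x)\<^sup>2 \<le> 2 + 2 * x\<^sup>2"
proof -
  interpret real_distribution std_normal_distribution by (rule real_dist_normal_dist)
  have p: "0 \<le> 1 - std_normal_cdf u" "1 - std_normal_cdf u \<le> 1"
    unfolding prob_std_normal_atLeast[symmetric] by auto
  define c where "c = of_bool (x \<ge> u) - (1 - std_normal_cdf u)"
  have "\<bar>c\<bar> \<le> 1" using p by (auto simp: c_def)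
  then have "c\<^sup>2 \<le> 1" by (simp add: abs_square_le_1)
  moreover have "(std_normal_density u * x)\<^sup>2 \<le> x\<^sup>2"
  proof -
    have "(std_normal_density u)\<^sup>2 \<le> 1" using std_normal_density_le_1[of u] by (simp add: power_le_one)
    then show ?thesis unfolding power_mult_distrib by (simp add: mult_left_le_one_le)
  qed
  moreover have "(c - y)\<^sup>2 \<le> 2 * c\<^sup>2 + 2 * y\<^sup>2" for y :: real
    using zero_le_power2[of "c + y"] by (simp add: power2_eq_square algebra_simps)
  ultimately show ?thesis
    unfolding sojourn_remainder_def c_def[symmetric] by (smt (verit))
qed

text \<open>Averaging over \<open>x\<close> turns the indicator into the normal tail at the shifted
  level \<open>v\<close>, and the linear term into its value at \<open>sqrt \<rho> * w\<close>. The
  assumption \<open>\<rho> \<le> 1 / 2\<close> keeps the divisor \<open>sqrt (1 - \<rho>)\<close>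
  away from 0, so that \<open>v\<close> differs from \<open>u - sqrt \<rho> * w\<close> only by a
  term of order \<open>\<rho>\<close>.\<close>

lemma smoothed_remainder_bound:
  assumes \<rho>: "0 \<le> \<rho>" "\<rho> \<le> 1 / 2"
  shows "\<bar>\<integral>x. sojourn_remainder u (sqrt \<rho> * w + sqrt (1 - \<rho>) * x) \<partial>std_normal_distribution\<bar>
    \<le> (2 * \<bar>u\<bar> + 8 * u\<^sup>2 + 12) * \<rho> * (1 + w\<^sup>2)"
proof -
  interpret real_distribution std_normal_distribution by (rule real_dist_normal_dist)
  define s where "s = sqrt \<rho>"
  define c where "c = sqrt (1 - \<rho>)"
  define v where "v = (u - s * w) / c"
  have c0: "c > 0" using \<rho> by (simp add: c_def)
  have "(\<integral>x. sojourn_remainder u (s * w + c * x) \<partial>std_normal_distribution)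
      = (\<integral>x. (indicator {v..} x - (1 - std_normal_cdf u) - std_normal_density u * s * w) - std_normal_density u * c * x \<partial>std_normal_distribution)"
  proof (intro Bochner_Integration.integral_cong refl)
    fix x
    have "u \<le> s * w + c * x \<longleftrightarrow> v \<le> x" using c0 by (simp add: v_def field_simps)
    then show "sojourn_remainder u (s * w + c * x) = (indicator {v..} x - (1 - std_normal_cdf u) - std_normal_density u * s * w) - std_normal_density u * c * x"
      by (simp add: sojourn_remainder_def algebra_simps indicator_def)
  qed
  also have "\<dots> = (\<integral>x. indicator {v..} x - (1 - std_normal_cdf u) - std_normal_density u * s * w \<partial>std_normal_distribution)"
    using std_normal_first_moment by (subst Bochner_Integration.integral_diff) (auto simp: has_bochner_integral_iff emeasure_eq_measure)
  also have "\<dots> = measure std_normal_distribution {v..} - (1 - std_normal_cdf u) - std_normal_density u * s * w"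
    using prob_space by (simp add: emeasure_eq_measure)
  \<comment> \<open>A Taylor remainder, quadratic in \<open>v - u\<close>, plus the discrepancy
    between the shift \<open>v - u\<close> and its leading part \<open>- s * w\<close>. Both are of
    order \<open>\<rho>\<close>.\<close>
  also have "\<dots> = - (std_normal_cdf v - std_normal_cdf u - std_normal_density u * (v - u)) + std_normal_density u * (u - v - s * w)"
    unfolding prob_std_normal_atLeast by (simp add: algebra_simps)
  finally have h: "(\<integral>x. sojourn_remainder u (s * w + c * x) \<partial>std_normal_distribution) = \<dots>" .
  \<comment> \<open>The relative change of level caused by the division by \<open>c\<close>. It is
    at most \<open>2 * \<rho>\<close> because \<open>c \<ge> 1 - \<rho>\<close> and
    \<open>1 / (1 - \<rho>) \<le> 1 + 2 * \<rho>\<close> for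
    \<open>\<rho> \<le> 1 / 2\<close>.\<close>
  define k where "k = 1 / c - 1"
  have k: "0 \<le> k" "k \<le> 2 * \<rho>"
  proof -
    have "c \<le> 1" using \<rho> by (simp add: c_def)
    then show "0 \<le> k" using c0 by (simp add: k_def)
    have "(1 - \<rho>) * (1 - \<rho>) \<le> 1 * (1 - \<rho>)" using \<rho> by (intro mult_right_mono) auto
    then have "1 - \<rho> \<le> c" unfolding c_def by (intro real_le_rsqrt) (simp add: power2_eq_square)
    then have "1 / c \<le> 1 / (1 - \<rho>)" using \<rho> by (intro divide_left_mono) auto
    also have "\<dots> \<le> 1 + 2 * \<rho>"
    proof -
      have "\<rho> * \<rho> \<le> 1 / 2 * \<rho>" using \<rho> by (intro mult_right_mono) auto
      then have "1 \<le> (1 + 2 * \<rho>) * (1 - \<rho>)" by (simp add: algebra_simps)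
      then show ?thesis using \<rho> by (simp add: field_simps)
    qed
    finally show "k \<le> 2 * \<rho>" by (simp add: k_def)
  qed
  have s: "0 \<le> s" "s \<le> 1" "s\<^sup>2 = \<rho>" using \<rho> by (auto simp: s_def)
  have v: "v = (u - s * w) * (1 + k)" using c0 by (simp add: v_def k_def)
  have usw: "\<bar>u - s * w\<bar> \<le> \<bar>u\<bar> + \<bar>w\<bar>"
  proof -
    have "\<bar>s * w\<bar> \<le> 1 * \<bar>w\<bar>" unfolding abs_mult using s by (intro mult_right_mono) auto
    then show ?thesis by linarith
  qed
  have A: "\<bar>u - v - s * w\<bar> \<le> 2 * \<rho> * (\<bar>u\<bar> + \<bar>w\<bar>)"
  proof -
    have "u - v - s * w = - (k * (u - s * w))" unfolding v by (simp add: algebra_simps)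
    then have "\<bar>u - v - s * w\<bar> = k * \<bar>u - s * w\<bar>" using k by (simp add: abs_mult)
    also have "\<dots> \<le> 2 * \<rho> * (\<bar>u\<bar> + \<bar>w\<bar>)" using k usw by (intro mult_mono) auto
    finally show ?thesis .
  qed
  have B: "(v - u)\<^sup>2 \<le> \<rho> * (2 * w\<^sup>2 + 8 * u\<^sup>2 + 8 * w\<^sup>2)"
  proof -
    have sq2: "(x + y)\<^sup>2 \<le> 2 * x\<^sup>2 + 2 * y\<^sup>2" for x y :: real
      using zero_le_power2[of "x - y"] by (simp add: power2_eq_square algebra_simps)
    have "v - u = k * (u - s * w) + (- s * w)" unfolding v by (simp add: algebra_simps)
    then have "(v - u)\<^sup>2 \<le> 2 * (k * (u - s * w))\<^sup>2 + 2 * (- s * w)\<^sup>2" by (simp only: sq2)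
    also have "(- s * w)\<^sup>2 = \<rho> * w\<^sup>2" using s(3) by (simp add: power_mult_distrib)
    finally have 1: "(v - u)\<^sup>2 \<le> 2 * (k * (u - s * w))\<^sup>2 + 2 * (\<rho> * w\<^sup>2)" .
    have "(k * (u - s * w))\<^sup>2 = (k * \<bar>u - s * w\<bar>)\<^sup>2" by (simp add: power_mult_distrib)
    also have "\<dots> \<le> (2 * \<rho> * (\<bar>u\<bar> + \<bar>w\<bar>))\<^sup>2"
      using k usw by (intro power_mono mult_mono) auto
    also have "\<dots> = (2 * \<rho>)\<^sup>2 * (\<bar>u\<bar> + \<bar>w\<bar>)\<^sup>2" by (simp only: power_mult_distrib)
    also have "\<dots> \<le> (2 * \<rho>) * (2 * \<bar>u\<bar>\<^sup>2 + 2 * \<bar>w\<bar>\<^sup>2)"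
    proof (rule mult_mono)
      have "2 * \<rho> * (2 * \<rho>) \<le> 1 * (2 * \<rho>)" using \<rho> by (intro mult_right_mono) auto
      then show "(2 * \<rho>)\<^sup>2 \<le> 2 * \<rho>" by (simp add: power2_eq_square)
      show "(\<bar>u\<bar> + \<bar>w\<bar>)\<^sup>2 \<le> 2 * \<bar>u\<bar>\<^sup>2 + 2 * \<bar>w\<bar>\<^sup>2" by (rule sq2)
    qed (use \<rho> in auto)
    finally have "(k * (u - s * w))\<^sup>2 \<le> 2 * \<rho> * (2 * u\<^sup>2 + 2 * w\<^sup>2)" by simp
    then show ?thesis using 1 by (simp add: algebra_simps)
  qed
  have aw: "\<bar>w\<bar> \<le> 1 + w\<^sup>2"
    using zero_le_power2[of "\<bar>w\<bar> - 1"] zero_le_power2[of w] unfolding power2_diff by simp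
  have "\<bar>\<integral>x. sojourn_remainder u (s * w + c * x) \<partial>std_normal_distribution\<bar>
      \<le> \<bar>std_normal_cdf v - std_normal_cdf u - std_normal_density u * (v - u)\<bar> + \<bar>std_normal_density u * (u - v - s * w)\<bar>"
    unfolding h by linarith
  also have "\<dots> \<le> (v - u)\<^sup>2 + 1 * \<bar>u - v - s * w\<bar>"
    unfolding abs_mult using std_normal_density_le_1[of u]
    by (intro add_mono std_normal_cdf_taylor mult_right_mono) auto
  also have "\<dots> \<le> \<rho> * (2 * w\<^sup>2 + 8 * u\<^sup>2 + 8 * w\<^sup>2) + 2 * \<rho> * (\<bar>u\<bar> + \<bar>w\<bar>)"
    using A B by simp
  also have "\<dots> = \<rho> * (10 * w\<^sup>2 + 8 * u\<^sup>2 + 2 * \<bar>u\<bar> + 2 * \<bar>w\<bar>)"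
    by (simp add: algebra_simps)
  also have "\<dots> \<le> \<rho> * ((2 * \<bar>u\<bar> + 8 * u\<^sup>2 + 12) * (1 + w\<^sup>2))"
  proof (rule mult_left_mono)
    \<comment> \<open>The 12 collects the coefficient 10 of \<open>w\<^sup>2\<close> and the 2 from
      \<open>2 * \<bar>w\<bar> \<le> 2 * (1 + w\<^sup>2)\<close>.\<close>
    have "10 * w\<^sup>2 + 8 * u\<^sup>2 + 2 * \<bar>u\<bar> + 2 * \<bar>w\<bar> \<le> (2 * \<bar>u\<bar> + 8 * u\<^sup>2) * 1 + 12 * (1 + w\<^sup>2)"
    proof -
      have "2 * \<bar>w\<bar> \<le> 2 * (1 + w\<^sup>2)" using aw by simp
      then show ?thesis using zero_le_power2[of w] by (simp add: algebra_simps)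
    qed
    also have "\<dots> \<le> (2 * \<bar>u\<bar> + 8 * u\<^sup>2) * (1 + w\<^sup>2) + 12 * (1 + w\<^sup>2)"
      by (intro add_mono mult_left_mono) auto
    finally show "10 * w\<^sup>2 + 8 * u\<^sup>2 + 2 * \<bar>u\<bar> + 2 * \<bar>w\<bar> \<le> (2 * \<bar>u\<bar> + 8 * u\<^sup>2 + 12) * (1 + w\<^sup>2)"
      by (simp add: algebra_simps)
  qed (use \<rho> in auto)
  finally show ?thesis by (simp add: s_def c_def mult_ac)
qed

lemma product_integral:
  fixes f :: "'a \<Rightarrow> 'c::{real_normed_field,banach,second_countable_topology}" and g :: "'b \<Rightarrow> 'c"
  assumes "sigma_finite_measure M1" "sigma_finite_measure M2" and f: "integrable M1 f" and g: "integrable M2 g"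
  shows "has_bochner_integral (M1 \<Otimes>\<^sub>M M2) (\<lambda>(x, y). f x * g y) ((\<integral>x. f x \<partial>M1) * (\<integral>y. g y \<partial>M2))"
proof -
  interpret M1: sigma_finite_measure M1 by fact
  interpret M2: sigma_finite_measure M2 by fact
  interpret pair_sigma_finite M1 M2 ..
  have [measurable]: "f \<in> borel_measurable M1" "g \<in> borel_measurable M2" using f g by auto
  have int: "integrable (M1 \<Otimes>\<^sub>M M2) (\<lambda>(x, y). f x * g y)"
  proof (rule Fubini_integrable)
    show "integrable M1 (\<lambda>x. \<integral>y. norm (case (x, y) of (x, y) \<Rightarrow> f x * g y) \<partial>M2)"
      using f by (simp add: norm_mult)
  qed (use g in auto)
  show ?thesis using integral_fst'[OF int] int f g by (simp add: has_bochner_integral_iff)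
qed


text \<open>For fixed \<open>w\<close> the two factors are independent with the same mean
  \<open>h w\<close>, so the inner integral is \<open>(h w)\<^sup>2\<close>; squaring the bound on
  \<open>h\<close> gives both the rate and the moment factor.\<close>

lemma expectation_sojourn_remainder_model:
  assumes \<rho>: "0 \<le> \<rho>" "\<rho> \<le> 1 / 2"
    and int: "integrable (std_normal_distribution \<Otimes>\<^sub>M (std_normal_distribution \<Otimes>\<^sub>M std_normal_distribution))
      (\<lambda>(w, x, y). sojourn_remainder u (sqrt \<rho> * w + sqrt (1 - \<rho>) * x) * sojourn_remainder u (sqrt \<rho> * w + sqrt (1 - \<rho>) * y))"
  shows "(\<integral>(w, x, y). sojourn_remainder u (sqrt \<rho> * w + sqrt (1 - \<rho>) * x) * sojourn_remainder u (sqrt \<rho> * w + sqrt (1 - \<rho>) * y)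
      \<partial>(std_normal_distribution \<Otimes>\<^sub>M (std_normal_distribution \<Otimes>\<^sub>M std_normal_distribution)))
    \<le> (2 * \<bar>u\<bar> + 8 * u\<^sup>2 + 12)\<^sup>2 * (\<integral>w. (1 + w\<^sup>2)\<^sup>2 \<partial>std_normal_distribution) * \<rho>\<^sup>2"
proof -
  let ?N = std_normal_distribution
  let ?L = "2 * \<bar>u\<bar> + 8 * u\<^sup>2 + 12"
  interpret N: real_distribution ?N by (rule real_dist_normal_dist)
  interpret NN: pair_prob_space ?N ?N ..
  interpret N3: pair_prob_space ?N "?N \<Otimes>\<^sub>M ?N" ..
  define f where "f w x = sojourn_remainder u (sqrt \<rho> * w + sqrt (1 - \<rho>) * x)" for w x
  have [measurable]: "f w \<in> borel_measurable borel" for w unfolding f_def by measurable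
  define h where "h w = (\<integral>x. f w x \<partial>?N)" for w
  have f_int: "integrable ?N (f w)" for w
  proof (rule N.square_integrable_imp_integrable)
    show "integrable ?N (\<lambda>x. (f w x)\<^sup>2)"
    proof (rule Bochner_Integration.integrable_bound)
      show "integrable ?N (\<lambda>x. 2 + 2 * ((sqrt \<rho> * w)\<^sup>2 + 2 * (sqrt \<rho> * w) * (sqrt (1 - \<rho>)) * x ^ 1 + (sqrt (1 - \<rho>))\<^sup>2 * x\<^sup>2))"
        by (intro Bochner_Integration.integrable_add integrable_mult_right impI std_normal_integrable_power N.integrable_const)
      show "AE x in ?N. norm ((f w x)\<^sup>2) \<le> norm (2 + 2 * ((sqrt \<rho> * w)\<^sup>2 + 2 * (sqrt \<rho> * w) * (sqrt (1 - \<rho>)) * x ^ 1 + (sqrt (1 - \<rho>))\<^sup>2 * x\<^sup>2))"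
      proof (rule AE_I2)
        fix x
        have "(f w x)\<^sup>2 \<le> 2 + 2 * (sqrt \<rho> * w + sqrt (1 - \<rho>) * x)\<^sup>2"
          unfolding f_def by (rule sojourn_remainder_square_le)
        also have "(sqrt \<rho> * w + sqrt (1 - \<rho>) * x)\<^sup>2 = (sqrt \<rho> * w)\<^sup>2 + 2 * (sqrt \<rho> * w) * (sqrt (1 - \<rho>)) * x ^ 1 + (sqrt (1 - \<rho>))\<^sup>2 * x\<^sup>2"
          by (simp only: power2_sum power_mult_distrib power_one_right mult.assoc)
        finally show "norm ((f w x)\<^sup>2) \<le> norm (2 + 2 * ((sqrt \<rho> * w)\<^sup>2 + 2 * (sqrt \<rho> * w) * (sqrt (1 - \<rho>)) * x ^ 1 + (sqrt (1 - \<rho>))\<^sup>2 * x\<^sup>2))"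
          by (simp only: real_norm_def abs_power2)
      qed
    qed measurable
  qed measurable
  have "(\<integral>(w, x, y). f w x * f w y \<partial>(?N \<Otimes>\<^sub>M (?N \<Otimes>\<^sub>M ?N))) = (\<integral>w. (\<integral>(x, y). f w x * f w y \<partial>(?N \<Otimes>\<^sub>M ?N)) \<partial>?N)"
    using N3.integral_fst'[OF int] by (simp add: f_def case_prod_beta')
  also have "\<dots> = (\<integral>w. (h w)\<^sup>2 \<partial>?N)"
    unfolding h_def
    using has_bochner_integral_integral_eq[OF product_integral[OF N.sigma_finite_measure_axioms N.sigma_finite_measure_axioms f_int f_int]]
    by (simp add: power2_eq_square)
  also have "\<dots> \<le> (\<integral>w. ?L\<^sup>2 * \<rho>\<^sup>2 * (1 + w\<^sup>2)\<^sup>2 \<partial>?N)"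
  proof (rule integral_mono')
    have "(\<lambda>w::real. (1 + w\<^sup>2)\<^sup>2) = (\<lambda>w. 1 + 2 * w\<^sup>2 + w ^ 4)"
      by (simp add: power2_eq_square algebra_simps fun_eq_iff power4_eq_xxxx)
    then have "integrable ?N (\<lambda>w::real. (1 + w\<^sup>2)\<^sup>2)"
      by (simp only:) (intro integrable_mult_right impI Bochner_Integration.integrable_add std_normal_integrable_power N.integrable_const)
    then show "integrable ?N (\<lambda>w. ?L\<^sup>2 * \<rho>\<^sup>2 * (1 + w\<^sup>2)\<^sup>2)"
      by (intro integrable_mult_right impI)
    fix w
    have "\<bar>h w\<bar>\<^sup>2 \<le> (?L * \<rho> * (1 + w\<^sup>2))\<^sup>2"
      unfolding h_def f_def by (intro power_mono smoothed_remainder_bound \<rho>) simp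
    then show "(h w)\<^sup>2 \<le> ?L\<^sup>2 * \<rho>\<^sup>2 * (1 + w\<^sup>2)\<^sup>2" by (simp add: power_mult_distrib)
  qed simp
  finally show ?thesis by (simp add: f_def mult_ac)
qed

text \<open>A joint law with Gaussian linear combinations is determined by its covariances, and the
  common component with weight \<open>sqrt \<rho>\<close> reproduces them when \<open>\<rho>\<close>
  lies between 0 and 1.\<close>

lemma (in prob_space) gaussian_pair_distr:
  fixes X Y :: "'a \<Rightarrow> real"
  assumes g: "\<And>a b. gaussian_rv M (\<lambda>\<omega>. a * X \<omega> + b * Y \<omega>)"
    and X2: "integrable M (\<lambda>\<omega>. (X \<omega>)\<^sup>2)" and Y2: "integrable M (\<lambda>\<omega>. (Y \<omega>)\<^sup>2)"
    and mean: "expectation X = 0" "expectation Y = 0"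
    and var: "expectation (\<lambda>\<omega>. (X \<omega>)\<^sup>2) = 1" "expectation (\<lambda>\<omega>. (Y \<omega>)\<^sup>2) = 1"
    and cov: "expectation (\<lambda>\<omega>. X \<omega> * Y \<omega>) = \<rho>" and \<rho>: "0 \<le> \<rho>" "\<rho> \<le> 1"
  shows "distr M (borel \<Otimes>\<^sub>M borel) (\<lambda>\<omega>. (X \<omega>, Y \<omega>))
    = distr (std_normal_distribution \<Otimes>\<^sub>M (std_normal_distribution \<Otimes>\<^sub>M std_normal_distribution)) (borel \<Otimes>\<^sub>M borel)
        (\<lambda>(w, x, y). (sqrt \<rho> * w + sqrt (1 - \<rho>) * x, sqrt \<rho> * w + sqrt (1 - \<rho>) * y))"
proof -
  let ?N = std_normal_distribution
  interpret N: real_distribution ?N by (rule real_dist_normal_dist)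
  interpret NN: pair_prob_space ?N ?N ..
  interpret N3: pair_prob_space ?N "?N \<Otimes>\<^sub>M ?N" ..
  define s where "s = sqrt \<rho>"
  define c where "c = sqrt (1 - \<rho>)"
  have X [measurable]: "X \<in> borel_measurable M" and Y [measurable]: "Y \<in> borel_measurable M"
    using g[of 1 0] g[of 0 1] by (auto simp: gaussian_rv_def)
  have iX: "integrable M X" "integrable M Y"
    by (rule square_integrable_imp_integrable; use X2 Y2 in simp)+
  have iXY: "integrable M (\<lambda>\<omega>. X \<omega> * Y \<omega>)"
    by (rule integrable_mult_of_squares) (use X2 Y2 in auto)
  have chN: "(CLINT x|?N. iexp (t * x)) = complex_of_real (exp (- (t\<^sup>2) / 2))" for t
    using char_std_normal_distribution by (simp add: char_def fun_eq_iff)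
  have iN: "integrable ?N (\<lambda>x. iexp (t * x))" for t
    by (rule N.integrable_const_bound[where B=1]) auto
  have "distr M (borel \<Otimes>\<^sub>M borel) (\<lambda>\<omega>. (X \<omega>, Y \<omega>))
    = distr (?N \<Otimes>\<^sub>M (?N \<Otimes>\<^sub>M ?N)) (borel \<Otimes>\<^sub>M borel)
        (\<lambda>p. (s * fst p + c * fst (snd p), s * fst p + c * snd (snd p)))"
  proof (rule distr_pair_eqI_char)
    show "prob_space M" by unfold_locales
    show "prob_space (?N \<Otimes>\<^sub>M (?N \<Otimes>\<^sub>M ?N))" by unfold_locales
    fix a b :: real
    have int: "integrable M (\<lambda>\<omega>. (a * X \<omega> + b * Y \<omega>)\<^sup>2)"
      by (rule integrable_add_squares) (use X2 Y2 in auto)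
    have "expectation (\<lambda>\<omega>. (a * X \<omega> + b * Y \<omega>)\<^sup>2) = expectation (\<lambda>\<omega>. a\<^sup>2 * (X \<omega>)\<^sup>2 + 2 * a * b * (X \<omega> * Y \<omega>) + b\<^sup>2 * (Y \<omega>)\<^sup>2)"
      by (intro Bochner_Integration.integral_cong) (auto simp: power2_eq_square algebra_simps)
    also have "\<dots> = a\<^sup>2 + 2 * a * b * \<rho> + b\<^sup>2"
      using X2 Y2 iXY by (simp add: var cov)
    finally have v: "expectation (\<lambda>\<omega>. (a * X \<omega> + b * Y \<omega>)\<^sup>2) = a\<^sup>2 + 2 * a * b * \<rho> + b\<^sup>2" .
    have m: "expectation (\<lambda>\<omega>. a * X \<omega> + b * Y \<omega>) = 0"
      using iX by (simp add: mean)
    have "(CLINT \<omega>|M. iexp (a * X \<omega> + b * Y \<omega>)) = char (distr M borel (\<lambda>\<omega>. a * X \<omega> + b * Y \<omega>)) 1"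
      by (subst char_distr_eq_expectation) auto
    also have "\<dots> = exp (- (a\<^sup>2 + 2 * a * b * \<rho> + b\<^sup>2) / 2)"
      by (subst gaussian_rv_char[OF g int m]) (simp add: v)
    \<comment> \<open>The quadratic form is a sum of three squares, one for each independent
      component.\<close>
    also have "\<dots> = exp (- (((a + b) * s)\<^sup>2) / 2) * (exp (- ((a * c)\<^sup>2) / 2) * exp (- ((b * c)\<^sup>2) / 2))"
    proof -
      have s2: "s\<^sup>2 = \<rho>" and c2: "c\<^sup>2 = 1 - \<rho>" using \<rho> by (auto simp: s_def c_def)
      have "a\<^sup>2 + 2 * a * b * \<rho> + b\<^sup>2 = ((a + b) * s)\<^sup>2 + ((a * c)\<^sup>2 + (b * c)\<^sup>2)"
        unfolding power_mult_distrib s2 c2 by (simp add: power2_eq_square algebra_simps)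
      then show ?thesis by (simp only: exp_add[symmetric]) (simp add: add_divide_distrib)
    qed
    also have "\<dots> = (CLINT w|?N. iexp ((a + b) * s * w)) * ((CLINT x|?N. iexp (a * c * x)) * (CLINT y|?N. iexp (b * c * y)))"
      by (simp only: chN) (simp only: of_real_mult)
    also have "\<dots> = (CLINT (w, p)|?N \<Otimes>\<^sub>M (?N \<Otimes>\<^sub>M ?N). iexp ((a + b) * s * w) * (case p of (x, y) \<Rightarrow> iexp (a * c * x) * iexp (b * c * y)))"
    proof -
      note p = product_integral[OF N.sigma_finite_measure_axioms N.sigma_finite_measure_axioms iN[of "a * c"] iN[of "b * c"]]
      have p': "integrable (?N \<Otimes>\<^sub>M ?N) (\<lambda>(x, y). iexp (a * c * x) * iexp (b * c * y))"
        using p by (simp add: has_bochner_integral_iff)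
      note q = product_integral[OF N.sigma_finite_measure_axioms NN.sigma_finite_measure_axioms iN[of "(a + b) * s"] p']
      show ?thesis
        using p q by (simp only: has_bochner_integral_iff)
    qed
    also have "\<dots> = (CLINT p|?N \<Otimes>\<^sub>M (?N \<Otimes>\<^sub>M ?N). iexp (a * (s * fst p + c * fst (snd p)) + b * (s * fst p + c * snd (snd p))))"
      by (intro Bochner_Integration.integral_cong) (auto simp: exp_add[symmetric] algebra_simps)
    finally show "(CLINT \<omega>|M. iexp (a * X \<omega> + b * Y \<omega>)) = \<dots>" .
  qed measurable
  then show ?thesis by (simp add: s_def c_def case_prod_beta')
qed

text \<open>For \<open>\<rho> \<le> 1 / 2\<close> the law of the pair is replaced by the model with
  a common component. For larger \<open>\<rho>\<close> the second moment of the remainder, at most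
  \<open>2 + 2 = 4\<close>, is already bounded by \<open>16 * \<rho>\<^sup>2\<close>; this is the
  origin of the summand 16.\<close>

theorem (in prob_space) expectation_sojourn_remainder_le:
  fixes X Y :: "'a \<Rightarrow> real"
  assumes g: "\<And>a b. gaussian_rv M (\<lambda>\<omega>. a * X \<omega> + b * Y \<omega>)"
    and X2: "integrable M (\<lambda>\<omega>. (X \<omega>)\<^sup>2)" and Y2: "integrable M (\<lambda>\<omega>. (Y \<omega>)\<^sup>2)"
    and mean: "expectation X = 0" "expectation Y = 0"
    and var: "expectation (\<lambda>\<omega>. (X \<omega>)\<^sup>2) = 1" "expectation (\<lambda>\<omega>. (Y \<omega>)\<^sup>2) = 1"
    and cov: "expectation (\<lambda>\<omega>. X \<omega> * Y \<omega>) = \<rho>" and \<rho>: "0 \<le> \<rho>" "\<rho> \<le> 1"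
  shows "expectation (\<lambda>\<omega>. sojourn_remainder u (X \<omega>) * sojourn_remainder u (Y \<omega>))
    \<le> ((2 * \<bar>u\<bar> + 8 * u\<^sup>2 + 12)\<^sup>2 * (\<integral>w. (1 + w\<^sup>2)\<^sup>2 \<partial>std_normal_distribution) + 16) * \<rho>\<^sup>2"
proof -
  let ?R = "sojourn_remainder u"
  let ?K = "(2 * \<bar>u\<bar> + 8 * u\<^sup>2 + 12)\<^sup>2 * (\<integral>w. (1 + w\<^sup>2)\<^sup>2 \<partial>std_normal_distribution)"
  have X [measurable]: "X \<in> borel_measurable M" and Y [measurable]: "Y \<in> borel_measurable M"
    using g[of 1 0] g[of 0 1] by (auto simp: gaussian_rv_def)
  have sq: "integrable M (\<lambda>\<omega>. (?R (Z \<omega>))\<^sup>2)" "expectation (\<lambda>\<omega>. (?R (Z \<omega>))\<^sup>2) \<le> 4"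
    if [measurable]: "Z \<in> borel_measurable M" and Z: "integrable M (\<lambda>\<omega>. (Z \<omega>)\<^sup>2)" "expectation (\<lambda>\<omega>. (Z \<omega>)\<^sup>2) = 1" for Z
  proof -
    show i: "integrable M (\<lambda>\<omega>. (?R (Z \<omega>))\<^sup>2)"
    proof (rule Bochner_Integration.integrable_bound)
      show "integrable M (\<lambda>\<omega>. 2 + 2 * (Z \<omega>)\<^sup>2)" using Z by simp
      show "AE \<omega> in M. norm ((?R (Z \<omega>))\<^sup>2) \<le> norm (2 + 2 * (Z \<omega>)\<^sup>2)"
        using sojourn_remainder_square_le by (intro AE_I2) simp
    qed measurable
    have "expectation (\<lambda>\<omega>. (?R (Z \<omega>))\<^sup>2) \<le> expectation (\<lambda>\<omega>. 2 + 2 * (Z \<omega>)\<^sup>2)"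
      using Z by (intro integral_mono i sojourn_remainder_square_le) simp
    also have "\<dots> = 4" using Z by (simp add: prob_space)
    finally show "expectation (\<lambda>\<omega>. (?R (Z \<omega>))\<^sup>2) \<le> 4" .
  qed
  have iRR: "integrable M (\<lambda>\<omega>. ?R (X \<omega>) * ?R (Y \<omega>))"
    by (rule integrable_mult_of_squares) (use sq X2 Y2 var in auto)
  have K0: "?K \<ge> 0" by (intro mult_nonneg_nonneg integral_nonneg) auto
  show ?thesis
  proof (cases "\<rho> \<le> 1 / 2")
    case True
    let ?P = "std_normal_distribution \<Otimes>\<^sub>M (std_normal_distribution \<Otimes>\<^sub>M std_normal_distribution)"
    let ?f = "\<lambda>(w, x, y). (sqrt \<rho> * w + sqrt (1 - \<rho>) * x, sqrt \<rho> * w + sqrt (1 - \<rho>) * y)"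
    let ?g = "\<lambda>(x, y). ?R x * ?R y"
    have f [measurable]: "?f \<in> ?P \<rightarrow>\<^sub>M borel \<Otimes>\<^sub>M borel" by measurable
    have g' [measurable]: "?g \<in> borel_measurable (borel \<Otimes>\<^sub>M borel)" by measurable
    note d = gaussian_pair_distr[OF g X2 Y2 mean var cov \<rho>]
    have "integrable (distr M (borel \<Otimes>\<^sub>M borel) (\<lambda>\<omega>. (X \<omega>, Y \<omega>))) ?g"
      using iRR by (subst integrable_distr_eq) auto
    then have "integrable ?P (\<lambda>p. ?g (?f p))"
      unfolding d by (subst (asm) integrable_distr_eq[OF f g'])
    then have int: "integrable ?P (\<lambda>(w, x, y). ?R (sqrt \<rho> * w + sqrt (1 - \<rho>) * x) * ?R (sqrt \<rho> * w + sqrt (1 - \<rho>) * y))"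
      by (simp add: case_prod_beta')
    have "expectation (\<lambda>\<omega>. ?R (X \<omega>) * ?R (Y \<omega>)) = (\<integral>p. ?g p \<partial>distr M (borel \<Otimes>\<^sub>M borel) (\<lambda>\<omega>. (X \<omega>, Y \<omega>)))"
      by (subst integral_distr) auto
    also have "\<dots> = (\<integral>p. ?g (?f p) \<partial>?P)"
      unfolding d by (rule integral_distr[OF f g'])
    also have "\<dots> = (\<integral>(w, x, y). ?R (sqrt \<rho> * w + sqrt (1 - \<rho>) * x) * ?R (sqrt \<rho> * w + sqrt (1 - \<rho>) * y) \<partial>?P)"
      by (simp add: case_prod_beta')
    also have "\<dots> \<le> ?K * \<rho>\<^sup>2"
      by (rule expectation_sojourn_remainder_model[OF \<rho>(1) True int])
    also have "\<dots> \<le> (?K + 16) * \<rho>\<^sup>2" by (intro mult_right_mono) auto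
    finally show ?thesis .
  next
    case False
    have "expectation (\<lambda>\<omega>. ?R (X \<omega>) * ?R (Y \<omega>)) \<le> expectation (\<lambda>\<omega>. (?R (X \<omega>))\<^sup>2 / 2 + (?R (Y \<omega>))\<^sup>2 / 2)"
    proof (rule integral_mono[OF iRR])
      show "integrable M (\<lambda>\<omega>. (?R (X \<omega>))\<^sup>2 / 2 + (?R (Y \<omega>))\<^sup>2 / 2)"
        using sq(1)[OF X X2 var(1)] sq(1)[OF Y Y2 var(2)] by simp
      show "?R (X \<omega>) * ?R (Y \<omega>) \<le> (?R (X \<omega>))\<^sup>2 / 2 + (?R (Y \<omega>))\<^sup>2 / 2" for \<omega>
        using sum_squares_bound[of "?R (X \<omega>)" "?R (Y \<omega>)"] by simp
    qed
    also have "\<dots> \<le> 4"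
      using sq[OF X X2 var(1)] sq[OF Y Y2 var(2)] by simp
    also have "4 \<le> 16 * \<rho>\<^sup>2"
    proof -
      have "(1 / 2)\<^sup>2 \<le> \<rho>\<^sup>2" using False by (intro power_mono) auto
      then show ?thesis by (simp add: power2_eq_square)
    qed
    also have "\<dots> \<le> (?K + 16) * \<rho>\<^sup>2" using K0 by (intro mult_right_mono) auto
    finally show ?thesis .
  qed
qed

section \<open>Sojourn times\<close>

text \<open>The comparison variables have exactly the law \<open>N\<close>, so their distribution
  function at \<open>x + \<delta>\<close> and \<open>x - \<delta>\<close> is that of
  \<open>N\<close>. Markov's inequality for the squared difference makes the exceptional event
  small, and continuity at \<open>x\<close> closes the sandwich.\<close>

lemma converges_in_distribution_Slutsky:
  fixes X \<xi> :: "'t \<Rightarrow> 'w \<Rightarrow> real"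
  assumes M: "prob_space M"
    and X: "\<forall>\<^sub>F T in F. X T \<in> borel_measurable M"
    and \<xi>: "\<forall>\<^sub>F T in F. \<xi> T \<in> borel_measurable M \<and> distr M borel (\<xi> T) = N"
    and N: "real_distribution N"
    and int: "\<forall>\<^sub>F T in F. integrable M (\<lambda>\<omega>. (X T \<omega> - \<xi> T \<omega>)\<^sup>2)"
    and lim: "((\<lambda>T. \<integral>\<omega>. (X T \<omega> - \<xi> T \<omega>)\<^sup>2 \<partial>M) \<longlongrightarrow> 0) F"
  shows "converges_in_distribution M X N F"
  unfolding converges_in_distribution_def
proof (intro conjI allI impI X)
  interpret M: prob_space M by fact
  interpret N: real_distribution N by fact
  fix x assume cont: "isCont (cdf N) x"
  show "((\<lambda>T. cdf (distr M borel (X T)) x) \<longlongrightarrow> cdf N x) F"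
  proof (rule tendstoI)
    fix e :: real assume e: "e > 0"
    obtain \<delta>0 where \<delta>0: "\<delta>0 > 0" "\<And>y. dist y x < \<delta>0 \<Longrightarrow> dist (cdf N y) (cdf N x) < e / 2"
      using cont[unfolded continuous_at_eps_delta] e half_gt_zero[OF e] by blast
    \<comment> \<open>Halved so that \<open>x + \<delta>\<close> and \<open>x - \<delta>\<close> lie
      strictly inside the neighbourhood given by continuity.\<close>
    define \<delta> where "\<delta> = \<delta>0 / 2"
    have \<delta>: "\<delta> > 0" and near: "\<bar>cdf N (x + \<delta>) - cdf N x\<bar> < e / 2" "\<bar>cdf N (x - \<delta>) - cdf N x\<bar> < e / 2"
      using \<delta>0(1) \<delta>0(2)[of "x + \<delta>"] \<delta>0(2)[of "x - \<delta>"] by (auto simp: \<delta>_def dist_real_def)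
    have small: "\<forall>\<^sub>F T in F. (\<integral>\<omega>. (X T \<omega> - \<xi> T \<omega>)\<^sup>2 \<partial>M) < e / 2 * \<delta>\<^sup>2"
      using order_tendstoD(2)[OF lim, of "e / 2 * \<delta>\<^sup>2"] e \<delta> by simp
    show "\<forall>\<^sub>F T in F. dist (cdf (distr M borel (X T)) x) (cdf N x) < e"
      using X \<xi> int small
    proof eventually_elim
      case (elim T)
      have [measurable]: "X T \<in> borel_measurable M" "\<xi> T \<in> borel_measurable M" using elim by auto
      let ?D = "{\<omega>\<in>space M. (X T \<omega> - \<xi> T \<omega>)\<^sup>2 \<ge> \<delta>\<^sup>2}"
      have "M.prob ?D \<le> (\<integral>\<omega>. (X T \<omega> - \<xi> T \<omega>)\<^sup>2 \<partial>M) / \<delta>\<^sup>2"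
        using elim \<delta> by (intro integral_Markov_inequality_measure[where A="{}"]) auto
      also have "\<dots> < e / 2" using elim(4) \<delta> by (simp add: divide_less_eq)
      finally have D: "M.prob ?D < e / 2" .
      have far: "\<delta>\<^sup>2 \<le> (X T \<omega> - \<xi> T \<omega>)\<^sup>2" if "\<delta> \<le> \<bar>X T \<omega> - \<xi> T \<omega>\<bar>" for \<omega>
        using power_mono[OF that, of 2] \<delta> by simp
      have cX: "cdf (distr M borel (X T)) x = M.prob {\<omega>\<in>space M. X T \<omega> \<le> x}"
        unfolding cdf_def by (subst measure_distr) (auto intro!: arg_cong[where f="M.prob"])
      have c\<xi>: "cdf N y = M.prob {\<omega>\<in>space M. \<xi> T \<omega> \<le> y}" for y
      proof -
        have "cdf N y = cdf (distr M borel (\<xi> T)) y" using elim by simp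
        also have "\<dots> = M.prob {\<omega>\<in>space M. \<xi> T \<omega> \<le> y}"
          unfolding cdf_def by (subst measure_distr) (auto intro!: arg_cong[where f="M.prob"])
        finally show ?thesis .
      qed
      have "M.prob {\<omega>\<in>space M. X T \<omega> \<le> x} \<le> M.prob ({\<omega>\<in>space M. \<xi> T \<omega> \<le> x + \<delta>} \<union> ?D)"
        by (intro M.finite_measure_mono) (auto intro!: far, measurable)
      also have "\<dots> \<le> M.prob {\<omega>\<in>space M. \<xi> T \<omega> \<le> x + \<delta>} + M.prob ?D"
        by (rule measure_Un_le) measurable
      finally have 1: "cdf (distr M borel (X T)) x \<le> cdf N (x + \<delta>) + M.prob ?D"
        unfolding cX c\<xi> .
      have "M.prob {\<omega>\<in>space M. \<xi> T \<omega> \<le> x - \<delta>} \<le> M.prob ({\<omega>\<in>space M. X T \<omega> \<le> x} \<union> ?D)"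
        by (intro M.finite_measure_mono) (auto intro!: far, measurable)
      also have "\<dots> \<le> M.prob {\<omega>\<in>space M. X T \<omega> \<le> x} + M.prob ?D"
        by (rule measure_Un_le) measurable
      finally have 2: "cdf N (x - \<delta>) \<le> cdf (distr M borel (X T)) x + M.prob ?D"
        unfolding cX c\<xi> .
      show "dist (cdf (distr M borel (X T)) x) (cdf N x) < e"
        unfolding dist_real_def using 1 2 D near by linarith
    qed
  qed
qed

text \<open>Time is cut off by a density, not by restricting the space, so that the underlying
  measurable space is the same for all \<open>T\<close>.\<close>

definition time_sphere :: "real \<Rightarrow> ('a::euclidean_space \<times> real) measure" where
  "time_sphere T = sphere_measure \<Otimes>\<^sub>M density lborel (indicator {0..T})"

lemma finite_measure_time: "finite_measure (density lborel (indicator {0..T::real}))"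
  by (rule finite_measureI) (auto simp: emeasure_density emeasure_lborel_Icc_eq)

lemma sets_time_sphere [measurable_cong]:
  "sets (time_sphere T :: ('a::euclidean_space \<times> real) measure) = sets (restrict_space borel (sphere 0 1) \<Otimes>\<^sub>M borel)"
  unfolding time_sphere_def by (intro sets_pair_measure_cong) auto

lemma space_time_sphere: "space (time_sphere T :: ('a::euclidean_space \<times> real) measure) = sphere 0 1 \<times> UNIV"
  by (simp add: time_sphere_def space_pair_measure)

lemma measure_time_sphere:
  assumes "T \<ge> 0"
  shows "emeasure (time_sphere T) (space (time_sphere T :: ('a::euclidean_space \<times> real) measure))
    = ennreal (measure sphere_measure (sphere (0::'a) 1) * T)"
proof -
  interpret S: finite_measure "sphere_measure :: 'a measure" by (rule finite_measure_sphere_measure)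
  interpret L: finite_measure "density lborel (indicator {0..T})" by (rule finite_measure_time)
  have "emeasure (time_sphere T) (sphere (0::'a) 1 \<times> (UNIV::real set))
      = emeasure sphere_measure (sphere (0::'a) 1) * emeasure (density lborel (indicator {0..T})) UNIV"
    unfolding time_sphere_def
    by (rule L.emeasure_pair_measure_Times) (auto intro: sets.top[of "sphere_measure", simplified])
  also have "emeasure (density lborel (indicator {0..T})) UNIV = ennreal T"
    using assms by (simp add: emeasure_density)
  finally show ?thesis
    using assms by (simp add: space_time_sphere S.emeasure_eq_measure ennreal_mult)
qed

lemma finite_measure_time_sphere: "finite_measure (time_sphere T :: ('a::euclidean_space \<times> real) measure)"
proof -
  interpret S: finite_measure "sphere_measure :: 'a measure" by (rule finite_measure_sphere_measure)
  interpret L: finite_measure "density lborel (indicator {0..T})" by (rule finite_measure_time)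
  show ?thesis unfolding time_sphere_def
    by (rule finite_measure_pair_measure) unfold_locales
qed

text \<open>Fubini in the order used by \<open>sojourn\<close>: sphere inside, time outside.\<close>

lemma integral_time_sphere:
  fixes f :: "'a::euclidean_space \<times> real \<Rightarrow> real"
  assumes [measurable]: "f \<in> borel_measurable (restrict_space borel (sphere 0 1) \<Otimes>\<^sub>M borel)"
    and B: "\<And>p. \<bar>f p\<bar> \<le> B"
  shows "integrable (time_sphere T) f"
    and "(\<integral>p. f p \<partial>time_sphere T) = (LINT t:{0..T}|lborel. \<integral>x. f (x, t) \<partial>sphere_measure)"
proof -
  interpret S: finite_measure "sphere_measure :: 'a measure" by (rule finite_measure_sphere_measure)
  interpret L: finite_measure "density lborel (indicator {0..T})" by (rule finite_measure_time)
  interpret pair_sigma_finite "sphere_measure :: 'a measure" "density lborel (indicator {0..T})" ..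
  interpret P: finite_measure "time_sphere T :: ('a \<times> real) measure" by (rule finite_measure_time_sphere)
  show int: "integrable (time_sphere T) f"
    by (rule P.integrable_const_bound[where B=B]) (use B in auto)
  have m: "(\<lambda>t. \<integral>x. f (x, t) \<partial>sphere_measure) \<in> borel_measurable borel" by measurable
  have "(\<integral>p. f p \<partial>time_sphere T) = (\<integral>t. (\<integral>x. f (x, t) \<partial>sphere_measure) \<partial>density lborel (indicator {0..T}))"
    using integral_snd[of "\<lambda>x t. f (x, t)"] int by (simp add: time_sphere_def)
  also have "\<dots> = (LINT t:{0..T}|lborel. \<integral>x. f (x, t) \<partial>sphere_measure)"
  proof -
    have "density lborel (indicator {0..T}) = density lborel (\<lambda>t. ennreal (indicator {0..T} t))"
      by (simp add: ennreal_indicator)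
    then show ?thesis using m
      by (simp only:) (subst integral_density, auto simp: set_lebesgue_integral_def)
  qed
  finally show "(\<integral>p. f p \<partial>time_sphere T) = (LINT t:{0..T}|lborel. \<integral>x. f (x, t) \<partial>sphere_measure)" .
qed

section \<open>The field and its covariance function\<close>

locale stationary_field = prob_space M
  for M :: "'w measure" and Z :: "'a::euclidean_space \<Rightarrow> real \<Rightarrow> 'w \<Rightarrow> real" and C :: "real \<Rightarrow> real \<Rightarrow> real" +
  assumes dim: "DIM('a) \<ge> 2"
    and gauss: "gaussian_field M (\<lambda>(x, t). Z x t)"
    and ms_cont: "mean_square_continuous M (\<lambda>(x, t). Z x t)"
    and meas: "(\<lambda>(\<omega>, x, t). Z x t \<omega>) \<in> borel_measurable (M \<Otimes>\<^sub>M (restrict_space borel (sphere 0 1) \<Otimes>\<^sub>M borel))"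
    and mean: "\<And>x t. expectation (Z x t) = 0"
    and unit_var: "\<And>x t. expectation (\<lambda>\<omega>. (Z x t \<omega>)\<^sup>2) = 1"
    and cov: "\<And>x y t s. expectation (\<lambda>\<omega>. Z x t \<omega> * Z y s \<omega>) = C (norm (x - y)) \<bar>t - s\<bar>"
    and C_nonneg: "\<And>z \<tau>. z \<ge> 0 \<Longrightarrow> \<tau> \<ge> 0 \<Longrightarrow> C z \<tau> \<ge> 0"
begin

lemma gaussian_combination:
  "finite J \<Longrightarrow> gaussian_rv M (\<lambda>\<omega>. \<Sum>i\<in>J. a i * Z (fst i) (snd i) \<omega>)"
  using gauss unfolding gaussian_field_def case_prod_beta by blast

lemma gaussian_rv_pair: "gaussian_rv M (\<lambda>\<omega>. a * Z x t \<omega> + b * Z y s \<omega>)"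
proof (cases "(x, t) = (y, s)")
  case True
  have "gaussian_rv M (\<lambda>\<omega>. \<Sum>i\<in>{(x, t)}. (a + b) * Z (fst i) (snd i) \<omega>)"
    by (rule gaussian_combination) simp
  then show ?thesis using True by (simp add: distrib_right)
next
  case False
  have "gaussian_rv M (\<lambda>\<omega>. \<Sum>i\<in>{(x, t), (y, s)}. (if i = (x, t) then a else b) * Z (fst i) (snd i) \<omega>)"
    by (rule gaussian_combination) simp
  moreover have "(\<Sum>i\<in>{(x, t), (y, s)}. (if i = (x, t) then a else b) * Z (fst i) (snd i) \<omega>) = a * Z x t \<omega> + b * Z y s \<omega>" for \<omega>
    using False by (subst sum.insert) auto
  ultimately show ?thesis by simp
qed

lemma Z_meas [measurable]: "Z x t \<in> borel_measurable M"
  using gaussian_rv_pair[of 1 x t 0 x t] by (simp add: gaussian_rv_def)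

lemma Z_square [simp]: "integrable M (\<lambda>\<omega>. (Z x t \<omega>)\<^sup>2)"
proof -
  have "integrable M (\<lambda>\<omega>. ((case (x, t) of (x, t) \<Rightarrow> Z x t) \<omega>)\<^sup>2)"
    using ms_cont unfolding mean_square_continuous_def by blast
  then show ?thesis by simp
qed

text \<open>Only values of \<open>C\<close> at nonnegative arguments are covariances. Absolute
  values extend these to the whole plane, where nonnegativity, the bound by 1, continuity and
  measurability then hold without side conditions.\<close>

definition cov_fun :: "real \<times> real \<Rightarrow> real" where "cov_fun p = C \<bar>fst p\<bar> \<bar>snd p\<bar>"

lemma cov_fun_nonneg: "cov_fun p \<ge> 0"
  unfolding cov_fun_def by (rule C_nonneg) auto

lemma unit_vector: obtains e :: 'a where "norm e = 1"
  using nonempty_Basis norm_Basis by (metis ex_in_conv)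

text \<open>Every value is attained as a covariance of two unit-variance values of the field, one at
  the origin and one on a fixed line through it, so Cauchy-Schwarz applies.\<close>

lemma cov_fun_le_1: "cov_fun p \<le> 1"
proof -
  obtain e :: 'a where e: "norm e = 1" by (rule unit_vector)
  have cov_fun: "cov_fun p = expectation (\<lambda>\<omega>. Z (fst p *\<^sub>R e) (snd p) \<omega> * Z 0 0 \<omega>)"
    by (simp add: cov cov_fun_def e)
  have "(cov_fun p)\<^sup>2 \<le> 1"
    unfolding cov_fun using expectation_Cauchy_Schwarz[of "Z (fst p *\<^sub>R e) (snd p)" M "Z 0 0"] by (simp add: unit_var)
  then have "\<bar>cov_fun p\<bar> \<le> 1" by (simp add: abs_square_le_1)
  then show ?thesis by simp
qed

text \<open>A difference of two values is the expectation of an increment of the field times its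
  value at the origin; by Cauchy-Schwarz it is at most the mean-square norm of that
  increment.\<close>

lemma continuous_cov_fun: "continuous_on UNIV cov_fun"
proof (rule continuous_at_imp_continuous_on, intro ballI)
  fix p0 :: "real \<times> real"
  obtain e :: 'a where e: "norm e = 1" by (rule unit_vector)
  define h where "h p = (fst p *\<^sub>R e, snd p)" for p :: "real \<times> real"
  define X where "X i = (\<lambda>\<omega>. Z (fst i) (snd i) \<omega>)" for i
  define g where "g j = expectation (\<lambda>\<omega>. (X j \<omega> - X (h p0) \<omega>)\<^sup>2)" for j
  have [measurable]: "X i \<in> borel_measurable M" for i unfolding X_def by measurable
  have X2 [simp]: "integrable M (\<lambda>\<omega>. (X i \<omega>)\<^sup>2)" for i unfolding X_def by simp
  have "(g \<longlongrightarrow> 0) (at (h p0))"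
    using ms_cont unfolding mean_square_continuous_def g_def X_def case_prod_beta by blast
  moreover have "g (h p0) = 0" by (simp add: g_def)
  ultimately have gc: "isCont g (h p0)" by (simp add: isCont_def)
  have "isCont h p0" unfolding h_def by (intro continuous_intros)
  then have "isCont (\<lambda>p. g (h p)) p0" using gc by (rule isCont_o2)
  then have lim: "((\<lambda>p. sqrt (g (h p))) \<longlongrightarrow> sqrt (g (h p0))) (at p0)"
    unfolding isCont_def by (rule tendsto_real_sqrt)
  have le: "\<bar>cov_fun p - cov_fun p0\<bar> \<le> sqrt (g (h p))" for p
  proof -
    have cov_fun: "cov_fun q = expectation (\<lambda>\<omega>. X (h q) \<omega> * X (0, 0) \<omega>)" for q
      by (simp add: cov cov_fun_def e h_def X_def)
    have iX: "integrable M (\<lambda>\<omega>. X i \<omega> * X j \<omega>)" for i j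
      by (rule integrable_mult_of_squares) auto
    have D2: "integrable M (\<lambda>\<omega>. (X (h p) \<omega> - X (h p0) \<omega>)\<^sup>2)"
      using integrable_add_squares[of "X (h p)" M "X (h p0)" 1 "- 1"] by simp
    have "cov_fun p - cov_fun p0 = expectation (\<lambda>\<omega>. (X (h p) \<omega> - X (h p0) \<omega>) * X (0, 0) \<omega>)"
      unfolding cov_fun left_diff_distrib using iX by simp
    also have "\<dots>\<^sup>2 \<le> g (h p) * expectation (\<lambda>\<omega>. (X (0, 0) \<omega>)\<^sup>2)"
      unfolding g_def by (rule expectation_Cauchy_Schwarz) (use D2 in auto)
    finally have "(cov_fun p - cov_fun p0)\<^sup>2 \<le> g (h p)" by (simp add: X_def unit_var)
    then show ?thesis by (intro real_le_rsqrt) simp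
  qed
  have "((\<lambda>p. cov_fun p - cov_fun p0) \<longlongrightarrow> 0) (at p0)"
  proof (rule Lim_null_comparison)
    show "\<forall>\<^sub>F p in at p0. norm (cov_fun p - cov_fun p0) \<le> sqrt (g (h p))" using le by simp
    show "((\<lambda>p. sqrt (g (h p))) \<longlongrightarrow> 0) (at p0)" using lim \<open>g (h p0) = 0\<close> by simp
  qed
  then show "isCont cov_fun p0" unfolding isCont_def by (rule LIM_zero_cancel)
qed

lemma borel_measurable_cov_fun [measurable]: "cov_fun \<in> borel_measurable borel"
  using continuous_cov_fun by (rule borel_measurable_continuous_onI)

lemma pair_meas: "(\<lambda>(p, \<omega>). (case p of (x, t) \<Rightarrow> Z x t) \<omega>) \<in> borel_measurable (time_sphere T \<Otimes>\<^sub>M M)"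
proof -
  have "(\<lambda>q. (\<lambda>(\<omega>, x, t). Z x t \<omega>) (snd q, fst q)) \<in> borel_measurable ((restrict_space borel (sphere 0 1) \<Otimes>\<^sub>M borel) \<Otimes>\<^sub>M M)"
    by (rule measurable_compose[OF _ meas]) measurable
  then show ?thesis
    by (simp add: case_prod_beta' cong: measurable_cong_sets sets_pair_measure_cong[OF sets_time_sphere])
qed

lemma sphere_area: "measure sphere_measure (sphere (0::'a) 1) = 2 * pi powr (real DIM('a) / 2) / Gamma (real DIM('a) / 2)"
  and sphere_area_pos: "measure sphere_measure (sphere (0::'a) 1) > 0"
proof -
  have pos: "2 * pi powr (real DIM('a) / 2) / Gamma (real DIM('a) / 2) > 0"
    using dim by (intro divide_pos_pos Gamma_real_pos) auto
  show "measure sphere_measure (sphere (0::'a) 1) = 2 * pi powr (real DIM('a) / 2) / Gamma (real DIM('a) / 2)"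
    using emeasure_sphere_measure_space[where 'a='a] pos by (simp add: measure_def)
  then show "measure sphere_measure (sphere (0::'a) 1) > 0" using pos by simp
qed

lemma gaussian_integral_field:
  assumes T: "T > 0"
  shows "gaussian_integral M (time_sphere T) (\<lambda>(x, t). Z x t) 1"
proof -
  interpret N: finite_measure "time_sphere T :: ('a \<times> real) measure" by (rule finite_measure_time_sphere)
  have "measure (time_sphere T) (space (time_sphere T :: ('a \<times> real) measure)) = measure sphere_measure (sphere (0::'a) 1) * T"
    using measure_time_sphere[of T, where 'a='a] T by (simp add: measure_def)
  then have pos: "measure (time_sphere T) (space (time_sphere T :: ('a \<times> real) measure)) > 0" using sphere_area_pos T by simp
  show ?thesis
    by unfold_locales (use pos pair_meas gauss mean unit_var in auto)
qed

section \<open>The variance of the linear term\<close>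

definition chord_cov :: "real \<Rightarrow> real" where
  "chord_cov \<tau> = (LINT z:{0..2}|lborel. cov_fun (z, \<tau>) * chord_weight DIM('a) z)"

lemma borel_measurable_chord_cov [measurable]: "chord_cov \<in> borel_measurable borel"
  unfolding chord_cov_def set_lebesgue_integral_def by measurable

lemma set_integrable_chord_cov: "set_integrable lborel {0..2} (\<lambda>z. cov_fun (z, \<tau>) * chord_weight DIM('a) z)"
  by (rule set_integrable_chord_weight_mult[OF dim, where B=1]) (use cov_fun_nonneg cov_fun_le_1 in auto)

lemma chord_cov_nonneg: "0 \<le> chord_cov \<tau>"
  unfolding chord_cov_def set_lebesgue_integral_def
  by (intro Bochner_Integration.integral_nonneg) (auto simp: cov_fun_nonneg chord_weight_nonneg split: split_indicator)

lemma chord_cov_le: "\<bar>chord_cov \<tau>\<bar> \<le> chord_moment DIM('a) 0"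
proof -
  have "chord_cov \<tau> \<le> (LINT z:{0..2}|lborel. (1 - z\<^sup>2 / 2) ^ 0 * chord_weight DIM('a) z)"
    unfolding chord_cov_def
    by (rule set_integral_mono[OF set_integrable_chord_cov set_integrable_chord_moment[OF dim]])
      (use cov_fun_le_1 chord_weight_nonneg in \<open>auto intro!: mult_left_le_one_le simp: cov_fun_nonneg\<close>)
  then show ?thesis using chord_cov_nonneg[of \<tau>] by (simp add: chord_moment_def)
qed

lemma weighted_cov_integral_eq:
  assumes T: "T > 0"
  shows "weighted_cov_integral DIM('a) C T = (LINT \<tau>:{0..T}|lborel. (T - \<tau>) * chord_cov \<tau>) / T"
proof -
  have inner: "(LINT z:{0..2}|lborel. z ^ (DIM('a) - 2) * C z \<tau> * (1 - z\<^sup>2 / 4) powr ((real DIM('a) - 3) / 2)) = chord_cov \<tau>"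
    if "\<tau> \<in> {0..T}" for \<tau>
    unfolding chord_cov_def
    by (intro set_lebesgue_integral_cong) (use that in \<open>auto simp: cov_fun_def chord_weight_def\<close>)
  have "weighted_cov_integral DIM('a) C T = (LINT \<tau>:{0..T}|lborel. (T - \<tau>) * chord_cov \<tau> / T)"
    unfolding weighted_cov_integral_def
    by (intro set_lebesgue_integral_cong) (use T inner in \<open>auto simp: field_simps\<close>)
  then show ?thesis by simp
qed

definition cov_pair :: "('a \<times> real) \<times> ('a \<times> real) \<Rightarrow> real" where
  "cov_pair r = cov_fun (norm (fst (fst r) - fst (snd r)), snd (fst r) - snd (snd r))"

lemma expectation_Z_mult:
  "expectation (\<lambda>\<omega>. (case p of (x, t) \<Rightarrow> Z x t) \<omega> * (case q of (x, t) \<Rightarrow> Z x t) \<omega>) = cov_pair (p, q)"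
  by (cases p; cases q) (simp add: cov cov_pair_def cov_fun_def)

lemma borel_measurable_cov_pair:
  "(\<lambda>q. cov_pair (p, q)) \<in> borel_measurable (restrict_space borel (sphere 0 1) \<Otimes>\<^sub>M borel)"
proof -
  have [measurable]: "fst \<in> borel_measurable (restrict_space borel (sphere (0::'a) 1) \<Otimes>\<^sub>M borel)"
    by (rule measurable_compose[OF measurable_fst, where g="\<lambda>x. x", simplified]) (auto intro: measurable_restrict_space1)
  show ?thesis unfolding cov_pair_def fst_conv snd_conv by measurable
qed

text \<open>By isotropy the sphere integral around \<open>x\<close> does not depend on
  \<open>x\<close>, so the second sphere integral contributes only the total area. The constant is
  the product of the areas of the unit spheres of dimensions \<open>DIM('a) - 1\<close> and
  \<open>DIM('a) - 2\<close> and the factor 2 from folding the time lag.\<close>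

lemma double_integral_cov:
  assumes T: "T > 0"
  shows "(\<integral>p. (\<integral>q. cov_pair (p, q) \<partial>time_sphere T) \<partial>time_sphere T)
    = 8 * pi powr (real DIM('a) - 1 / 2) / (Gamma (real DIM('a) / 2) * Gamma ((real DIM('a) - 1) / 2))
        * T * weighted_cov_integral DIM('a) C T"
proof -
  let ?k = "2 * pi powr ((real DIM('a) - 1) / 2) / Gamma ((real DIM('a) - 1) / 2)"
  have inner: "(\<integral>q. cov_pair ((x, t), q) \<partial>time_sphere T) = ?k * (LINT s:{0..T}|lborel. chord_cov \<bar>t - s\<bar>)"
    if x: "x \<in> sphere 0 1" for x t
  proof -
    have "(\<integral>q. cov_pair ((x, t), q) \<partial>time_sphere T) = (LINT s:{0..T}|lborel. \<integral>y. cov_pair ((x, t), (y, s)) \<partial>sphere_measure)"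
      by (rule integral_time_sphere(2)[OF borel_measurable_cov_pair, where B=1]) (use cov_fun_nonneg cov_fun_le_1 in \<open>auto simp: cov_pair_def\<close>)
    also have "\<dots> = (LINT s:{0..T}|lborel. ?k * chord_cov \<bar>t - s\<bar>)"
    proof (rule arg_cong[where f="set_lebesgue_integral lborel {0..T}"], rule ext)
      fix s :: real
      have "(\<integral>y. cov_pair ((x, t), (y, s)) \<partial>sphere_measure) = (\<integral>y. cov_fun (norm (y - x), \<bar>t - s\<bar>) \<partial>sphere_measure)"
        by (simp add: cov_pair_def norm_minus_commute) (simp add: cov_fun_def)
      also have "\<dots> = ?k * chord_cov \<bar>t - s\<bar>"
        unfolding chord_cov_def
        by (rule sphere_integral_dist[OF dim]) (use x in \<open>auto intro!: continuous_on_compose2[OF continuous_cov_fun] continuous_intros\<close>)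
      finally show "(\<integral>y. cov_pair ((x, t), (y, s)) \<partial>sphere_measure) = ?k * chord_cov \<bar>t - s\<bar>" .
    qed
    finally show ?thesis by simp
  qed
  have "(\<integral>p. (\<integral>q. cov_pair (p, q) \<partial>time_sphere T) \<partial>time_sphere T)
      = (\<integral>p. ?k * (LINT s:{0..T}|lborel. chord_cov \<bar>snd p - s\<bar>) \<partial>(time_sphere T :: ('a \<times> real) measure))"
    by (intro Bochner_Integration.integral_cong) (auto simp: space_time_sphere inner)
  also have "\<dots> = (LINT t:{0..T}|lborel. \<integral>x. ?k * (LINT s:{0..T}|lborel. chord_cov \<bar>snd (x, t) - s\<bar>) \<partial>(sphere_measure :: 'a measure))"
  proof (rule integral_time_sphere(2))
    show "(\<lambda>p. ?k * (LINT s:{0..T}|lborel. chord_cov \<bar>snd p - s\<bar>)) \<in> borel_measurable (restrict_space borel (sphere (0::'a) 1) \<Otimes>\<^sub>M borel)"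
      unfolding set_lebesgue_integral_def by measurable
    show "\<bar>?k * (LINT s:{0..T}|lborel. chord_cov \<bar>snd p - s\<bar>)\<bar> \<le> \<bar>?k\<bar> * (T * chord_moment DIM('a) 0)" for p :: "'a \<times> real"
    proof -
      have si: "set_integrable lborel {0..T} (\<lambda>s. k)" for k :: real
        unfolding set_integrable_def by (intro integrable_scaleR_left impI integrable_real_indicator) (use T in auto)
      have "\<bar>LINT s:{0..T}|lborel. chord_cov \<bar>snd p - s\<bar>\<bar> \<le> (LINT s:{0..T}|lborel. chord_moment DIM('a) 0)"
        unfolding set_lebesgue_integral_def
      proof -
        have i1: "integrable lborel (\<lambda>s. indicator {0..T} s *\<^sub>R chord_moment DIM('a) 0)"
          using si by (simp add: set_integrable_def)
        have i2: "integrable lborel (\<lambda>s. indicator {0..T} s *\<^sub>R chord_cov \<bar>snd p - s\<bar>)"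
          by (rule Bochner_Integration.integrable_bound[OF i1])
            (use order_trans[OF chord_cov_le abs_ge_self] in \<open>auto split: split_indicator\<close>)
        have "\<bar>\<integral>s. indicator {0..T} s *\<^sub>R chord_cov \<bar>snd p - s\<bar> \<partial>lborel\<bar> \<le> (\<integral>s. \<bar>indicator {0..T} s *\<^sub>R chord_cov \<bar>snd p - s\<bar>\<bar> \<partial>lborel)"
          by (rule integral_abs_bound)
        also have "\<dots> \<le> (\<integral>s. indicator {0..T} s *\<^sub>R chord_moment DIM('a) 0 \<partial>lborel)"
          by (rule integral_mono[OF integrable_abs[OF i2] i1]) (use chord_cov_le in \<open>auto split: split_indicator\<close>)
        finally show "\<bar>\<integral>s. indicator {0..T} s *\<^sub>R chord_cov \<bar>snd p - s\<bar> \<partial>lborel\<bar> \<le> \<dots>" .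
      qed
      also have "\<dots> = T * chord_moment DIM('a) 0"
        using T by (simp add: set_lebesgue_integral_def)
      finally show ?thesis unfolding abs_mult by (rule mult_left_mono) simp
    qed
  qed
  also have "\<dots> = measure sphere_measure (sphere (0::'a) 1) * ?k * (LINT t:{0..T}|lborel. LINT s:{0..T}|lborel. chord_cov \<bar>t - s\<bar>)"
    by (simp add: mult_ac)
  also have "\<dots> = measure sphere_measure (sphere (0::'a) 1) * ?k * (2 * (T * weighted_cov_integral DIM('a) C T))"
    using double_integral_abs_diff[OF _ borel_measurable_chord_cov chord_cov_le, of T] T
    by (simp add: weighted_cov_integral_eq)
  also have "\<dots> = 8 * (pi powr (real DIM('a) / 2) * pi powr ((real DIM('a) - 1) / 2)) / (Gamma (real DIM('a) / 2) * Gamma ((real DIM('a) - 1) / 2))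
        * T * weighted_cov_integral DIM('a) C T"
    unfolding sphere_area by (simp add: field_simps)
  also have "pi powr (real DIM('a) / 2) * pi powr ((real DIM('a) - 1) / 2) = pi powr (real DIM('a) - 1 / 2)"
    unfolding powr_add[symmetric] by (rule arg_cong[where f="(powr) pi"]) (simp add: field_simps)
  finally show ?thesis .
qed

text \<open>For a given time the admissible lags fill an interval of length at most
  \<open>2 * \<tau>0\<close>, so the mass of close pairs grows only linearly in
  \<open>T\<close>.\<close>

lemma double_integral_near:
  assumes T: "T > 0" and \<tau>: "\<tau>0 > 0"
  shows "(\<integral>p. (\<integral>q. of_bool (\<bar>snd p - snd q\<bar> \<le> \<tau>0) \<partial>(time_sphere T :: ('a \<times> real) measure)) \<partial>(time_sphere T :: ('a \<times> real) measure))
    \<le> 2 * \<tau>0 * measure sphere_measure (sphere (0::'a) 1) ^ 2 * T"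
proof -
  interpret N: finite_measure "time_sphere T :: ('a \<times> real) measure" by (rule finite_measure_time_sphere)
  have m: "measure (time_sphere T) (space (time_sphere T :: ('a \<times> real) measure)) = measure sphere_measure (sphere (0::'a) 1) * T"
    using measure_time_sphere[of T, where 'a='a] T by (simp add: measure_def)
  have inner: "(\<integral>q. of_bool (\<bar>t - snd q\<bar> \<le> \<tau>0) \<partial>(time_sphere T :: ('a \<times> real) measure)) \<le> measure sphere_measure (sphere (0::'a) 1) * (2 * \<tau>0)" for t
  proof -
    have fm: "(\<lambda>q. of_bool (\<bar>t - snd q\<bar> \<le> \<tau>0) :: real) \<in> borel_measurable (restrict_space borel (sphere (0::'a) 1) \<Otimes>\<^sub>M borel)"
      by measurable
    have "(\<integral>q. of_bool (\<bar>t - snd q\<bar> \<le> \<tau>0) \<partial>(time_sphere T :: ('a \<times> real) measure))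
        = (LINT s:{0..T}|lborel. \<integral>x. (of_bool (\<bar>t - snd (x, s)\<bar> \<le> \<tau>0) :: real) \<partial>(sphere_measure :: 'a measure))"
      by (rule integral_time_sphere(2)[OF fm, where B=1]) simp
    also have "\<dots> = (\<integral>s. measure sphere_measure (sphere (0::'a) 1) * indicator ({0..T} \<inter> {t - \<tau>0..t + \<tau>0}) s \<partial>lborel)"
      unfolding set_lebesgue_integral_def
      by (intro Bochner_Integration.integral_cong) (auto split: split_indicator)
    also have "\<dots> \<le> (\<integral>s. measure sphere_measure (sphere (0::'a) 1) * indicator {t - \<tau>0..t + \<tau>0} s \<partial>lborel)"
      using sphere_area_pos
      by (intro integral_mono integrable_mult_right impI integrable_real_indicator)
        (auto split: split_indicator simp: emeasure_lborel_Icc_eq Int_atLeastAtMost)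
    also have "\<dots> = measure sphere_measure (sphere (0::'a) 1) * (2 * \<tau>0)" using \<tau> by simp
    finally show ?thesis .
  qed
  have "(\<integral>p. (\<integral>q. of_bool (\<bar>snd p - snd q\<bar> \<le> \<tau>0) \<partial>(time_sphere T :: ('a \<times> real) measure)) \<partial>(time_sphere T :: ('a \<times> real) measure))
      \<le> (\<integral>p. measure sphere_measure (sphere (0::'a) 1) * (2 * \<tau>0) \<partial>(time_sphere T :: ('a \<times> real) measure))"
  proof (rule integral_mono')
    show "integrable (time_sphere T) (\<lambda>p :: 'a \<times> real. measure sphere_measure (sphere (0::'a) 1) * (2 * \<tau>0))" by (rule N.integrable_const)
  qed (use inner sphere_area_pos \<tau> in auto)
  also have "\<dots> = 2 * \<tau>0 * measure sphere_measure (sphere (0::'a) 1) ^ 2 * T"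
    by (simp add: m power2_eq_square)
  finally show ?thesis .
qed

definition remainder_const :: "real \<Rightarrow> real" where
  "remainder_const u = (2 * \<bar>u\<bar> + 8 * u\<^sup>2 + 12)\<^sup>2 * (\<integral>w. (1 + w\<^sup>2)\<^sup>2 \<partial>std_normal_distribution) + 16"

lemma remainder_const_nonneg: "0 \<le> remainder_const u"
  unfolding remainder_const_def by (intro add_nonneg_nonneg mult_nonneg_nonneg Bochner_Integration.integral_nonneg) auto

lemma remainder_cov_le:
  "expectation (\<lambda>\<omega>. sojourn_remainder u (Z x t \<omega>) * sojourn_remainder u (Z y s \<omega>)) \<le> remainder_const u * (cov_pair ((x, t), (y, s)))\<^sup>2"
  unfolding remainder_const_def
proof (rule expectation_sojourn_remainder_le)
  show "expectation (\<lambda>\<omega>. Z x t \<omega> * Z y s \<omega>) = cov_pair ((x, t), (y, s))"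
    by (simp add: cov cov_pair_def cov_fun_def)
qed (auto intro: gaussian_rv_pair simp: mean unit_var cov_pair_def cov_fun_nonneg cov_fun_le_1)

lemma remainder_field: "field_integral M (time_sphere T) (\<lambda>p \<omega>. sojourn_remainder u (Z (fst p) (snd p) \<omega>)) 4"
proof -
  interpret N: finite_measure "time_sphere T :: ('a \<times> real) measure" by (rule finite_measure_time_sphere)
  have int: "integrable M (\<lambda>\<omega>. (sojourn_remainder u (Z x t \<omega>))\<^sup>2)" for x t
  proof (rule Bochner_Integration.integrable_bound)
    show "integrable M (\<lambda>\<omega>. 2 + 2 * (Z x t \<omega>)\<^sup>2)" by simp
    show "AE \<omega> in M. norm ((sojourn_remainder u (Z x t \<omega>))\<^sup>2) \<le> norm (2 + 2 * (Z x t \<omega>)\<^sup>2)"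
      using sojourn_remainder_square_le by (intro AE_I2) simp
  qed measurable
  have "expectation (\<lambda>\<omega>. (sojourn_remainder u (Z x t \<omega>))\<^sup>2) \<le> 4" for x t
  proof -
    have "expectation (\<lambda>\<omega>. (sojourn_remainder u (Z x t \<omega>))\<^sup>2) \<le> expectation (\<lambda>\<omega>. 2 + 2 * (Z x t \<omega>)\<^sup>2)"
      by (intro integral_mono int sojourn_remainder_square_le) simp
    also have "\<dots> = 4" by (simp add: unit_var prob_space)
    finally show ?thesis .
  qed
  moreover have "(\<lambda>(p, \<omega>). sojourn_remainder u (Z (fst p) (snd p) \<omega>)) \<in> borel_measurable (time_sphere T \<Otimes>\<^sub>M M)"
    using measurable_compose[OF pair_meas borel_measurable_sojourn_remainder] by (simp add: case_prod_beta')
  ultimately show ?thesis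
    by unfold_locales (use int in auto)
qed

section \<open>The sojourn time over a fixed horizon\<close>

context
  fixes u T :: real
  assumes T: "T > 0"
begin

interpretation G: gaussian_integral M "time_sphere T" "\<lambda>(x, t). Z x t" 1
  by (rule gaussian_integral_field[OF T])

interpretation R: field_integral M "time_sphere T" "\<lambda>p \<omega>. sojourn_remainder u (Z (fst p) (snd p) \<omega>)" 4
  by (rule remainder_field)

definition "linear_part = G.mean_field"
definition "remainder_part = R.mean_field"

lemma linear_part_meas [measurable]: "linear_part \<in> borel_measurable M"
  unfolding linear_part_def by measurable

lemma expectation_linear_part_square:
  "expectation (\<lambda>\<omega>. (linear_part \<omega>)\<^sup>2) = 8 * pi powr (real DIM('a) - 1 / 2) / (Gamma (real DIM('a) / 2) * Gamma ((real DIM('a) - 1) / 2))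
        * T * weighted_cov_integral DIM('a) C T"
  unfolding linear_part_def G.expectation_mean_field_square expectation_Z_mult by (rule double_integral_cov[OF T])

lemma distr_linear_part:
  assumes "expectation (\<lambda>\<omega>. (linear_part \<omega>)\<^sup>2) = \<sigma>\<^sup>2" "\<sigma> > 0"
  shows "distr M borel (\<lambda>\<omega>. linear_part \<omega> / \<sigma>) = std_normal_distribution"
  using assms unfolding linear_part_def by (rule G.mean_field_distr_normal)

text \<open>The decomposition is only almost sure: the indicator is bounded and integrable along
  every path, but the linear term needs \<open>Z\<close> itself to be integrable along the path,
  which holds almost surely by Fubini.\<close>

lemma sojourn_meas [measurable]: "sojourn Z u T \<in> borel_measurable M"
  and sojourn_decomposition: "AE \<omega> in M. sojourn Z u T \<omega> = T * (1 - std_normal_cdf u) * measure sphere_measure (sphere (0::'a) 1)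
    + std_normal_density u * linear_part \<omega> + remainder_part \<omega>"
  and remainder_part_square: "integrable M (\<lambda>\<omega>. (remainder_part \<omega>)\<^sup>2)"
  and remainder_part_meas: "remainder_part \<in> borel_measurable M"
proof -
  have sect: "(\<lambda>p. Z (fst p) (snd p) \<omega>) \<in> borel_measurable (restrict_space borel (sphere 0 1) \<Otimes>\<^sub>M borel)" if "\<omega> \<in> space M" for \<omega>
    using measurable_Pair2[OF meas that] by (simp add: case_prod_beta')
  define V where "V \<omega> p = (of_bool (Z (fst p) (snd p) \<omega> \<ge> u) :: real)" for \<omega> p
  have V_meas: "V \<omega> \<in> borel_measurable (restrict_space borel (sphere 0 1) \<Otimes>\<^sub>M borel)" if "\<omega> \<in> space M" for \<omega>
  proof -
    note [measurable] = sect[OF that]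
    show ?thesis unfolding V_def by measurable
  qed
  have V1: "\<bar>V \<omega> p\<bar> \<le> 1" for \<omega> p by (simp add: V_def)
  have so: "sojourn Z u T \<omega> = (\<integral>p. V \<omega> p \<partial>time_sphere T)" and iV: "integrable (time_sphere T) (V \<omega>)" if "\<omega> \<in> space M" for \<omega>
    using integral_time_sphere(2)[OF V_meas[OF that] V1, of T] integral_time_sphere(1)[OF V_meas[OF that] V1, of T]
    by (simp add: sojourn_def V_def) fact
  have "(\<lambda>(\<omega>, p). V \<omega> p) \<in> borel_measurable (M \<Otimes>\<^sub>M time_sphere T)"
  proof -
    have "(\<lambda>(\<omega>, p). Z (fst p) (snd p) \<omega>) \<in> borel_measurable (M \<Otimes>\<^sub>M time_sphere T)"
      using meas by (simp add: case_prod_beta' cong: measurable_cong_sets sets_pair_measure_cong[OF refl sets_time_sphere])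
    then have [measurable]: "(\<lambda>x. Z (fst (snd x)) (snd (snd x)) (fst x)) \<in> borel_measurable (M \<Otimes>\<^sub>M time_sphere T)"
      by (simp add: case_prod_beta')
    show ?thesis unfolding V_def case_prod_beta' by measurable
  qed
  then have "(\<lambda>\<omega>. \<integral>p. V \<omega> p \<partial>time_sphere T) \<in> borel_measurable M"
    by (rule G.N.borel_measurable_lebesgue_integral)
  then show "sojourn Z u T \<in> borel_measurable M"
    by (rule measurable_cong[THEN iffD2, rotated]) (rule so)
  show "integrable M (\<lambda>\<omega>. (remainder_part \<omega>)\<^sup>2)"
    unfolding remainder_part_def by (rule R.integrable_mean_field_square)
  show "remainder_part \<in> borel_measurable M"
    unfolding remainder_part_def by (rule R.mean_field_meas)
  have m: "measure (time_sphere T) (space (time_sphere T :: ('a \<times> real) measure)) = measure sphere_measure (sphere (0::'a) 1) * T"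
    using measure_time_sphere[of T, where 'a='a] T by (simp add: measure_def)
  show "AE \<omega> in M. sojourn Z u T \<omega> = T * (1 - std_normal_cdf u) * measure sphere_measure (sphere (0::'a) 1)
    + std_normal_density u * linear_part \<omega> + remainder_part \<omega>"
    using G.AE_integrable_section AE_space
  proof eventually_elim
    case (elim \<omega>)
    have iZ: "integrable (time_sphere T) (\<lambda>p. Z (fst p) (snd p) \<omega>)"
      using elim by (simp add: case_prod_beta')
    have lin: "linear_part \<omega> = (\<integral>p. Z (fst p) (snd p) \<omega> \<partial>time_sphere T)"
      unfolding linear_part_def G.mean_field_def by (simp add: case_prod_beta')
    have "remainder_part \<omega> = (\<integral>p. sojourn_remainder u (Z (fst p) (snd p) \<omega>) \<partial>time_sphere T)"
      unfolding remainder_part_def R.mean_field_def ..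
    also have "\<dots> = (\<integral>p. V \<omega> p - (1 - std_normal_cdf u) - std_normal_density u * Z (fst p) (snd p) \<omega> \<partial>time_sphere T)"
      unfolding sojourn_remainder_def V_def ..
    also have "\<dots> = sojourn Z u T \<omega> - (1 - std_normal_cdf u) * (measure sphere_measure (sphere (0::'a) 1) * T) - std_normal_density u * linear_part \<omega>"
      using iZ iV so elim m by (simp add: lin mult.commute)
    finally show ?case by (simp add: mult_ac)
  qed
qed

text \<open>Pairs are split by their time lag. Beyond \<open>\<tau>0\<close> the covariance lies
  between 0 and \<open>\<epsilon>\<close>, so its square is at most \<open>\<epsilon>\<close> times
  itself and integrates to \<open>\<epsilon>\<close> times the variance of the linear term. Up to
  \<open>\<tau>0\<close> its square is bounded by 1.\<close>

lemma expectation_remainder_part_square_le: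
  assumes \<epsilon>: "\<epsilon> \<ge> 0" and \<tau>0: "\<tau>0 > 0" and far: "\<And>z \<tau>. z \<in> {0..2} \<Longrightarrow> \<tau> \<ge> \<tau>0 \<Longrightarrow> C z \<tau> \<le> \<epsilon>"
  shows "expectation (\<lambda>\<omega>. (remainder_part \<omega>)\<^sup>2) \<le> remainder_const u *
    (\<epsilon> * expectation (\<lambda>\<omega>. (linear_part \<omega>)\<^sup>2) + 2 * \<tau>0 * (measure sphere_measure (sphere (0::'a) 1))\<^sup>2 * T)"
proof -
  let ?N = "time_sphere T :: ('a \<times> real) measure"
  let ?K = "remainder_const u"
  let ?near = "\<lambda>p q. of_bool (\<bar>snd p - snd q\<bar> \<le> \<tau>0) :: real"
  let ?r = "\<lambda>p q. expectation (\<lambda>\<omega>. sojourn_remainder u (Z (fst p) (snd p) \<omega>) * sojourn_remainder u (Z (fst q) (snd q) \<omega>))"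
  have near_meas: "(\<lambda>q. ?near p q) \<in> borel_measurable ?N" for p :: "'a \<times> real"
    by measurable
  have i_near: "integrable ?N (\<lambda>q. ?near p q)" for p :: "'a \<times> real"
    by (rule G.N.integrable_const_bound[where B=1]) (use near_meas in auto)
  have i_cov: "integrable ?N (\<lambda>q. cov_pair (p, q))" for p
    by (rule integral_time_sphere(1)[OF borel_measurable_cov_pair, where B=1]) (use cov_fun_nonneg cov_fun_le_1 in \<open>auto simp: cov_pair_def\<close>)
  have pt: "?r p q \<le> ?K * (\<epsilon> * cov_pair (p, q) + ?near p q)" if p: "p \<in> space ?N" and q: "q \<in> space ?N" for p q
  proof -
    have "?r p q \<le> ?K * (cov_pair (p, q))\<^sup>2"
      using remainder_cov_le[of u "fst p" "snd p" "fst q" "snd q"] by simp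
    also have "(cov_pair (p, q))\<^sup>2 \<le> \<epsilon> * cov_pair (p, q) + ?near p q"
    proof (cases "\<bar>snd p - snd q\<bar> \<le> \<tau>0")
      case True
      have "(cov_pair (p, q))\<^sup>2 \<le> 1" by (simp add: cov_pair_def power_le_one cov_fun_nonneg cov_fun_le_1)
      moreover have "0 \<le> \<epsilon> * cov_pair (p, q)" using \<epsilon> by (simp add: cov_pair_def cov_fun_nonneg)
      ultimately show ?thesis using True by simp
    next
      case False
      \<comment> \<open>Points of the unit sphere are at distance at most 2, the range covered by
        the decay assumption.\<close>
      have "norm (fst p - fst q) \<le> norm (fst p) + norm (fst q)" by (rule norm_triangle_ineq4)
      also have "\<dots> \<le> 2" using p q by (auto simp: space_time_sphere)
      finally have "cov_pair (p, q) \<le> \<epsilon>" using False by (simp add: cov_pair_def cov_fun_def far)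
      then have "cov_pair (p, q) * cov_pair (p, q) \<le> \<epsilon> * cov_pair (p, q)"
        by (intro mult_right_mono) (auto simp: cov_pair_def cov_fun_nonneg)
      then show ?thesis using False by (simp add: power2_eq_square)
    qed
    finally show ?thesis using remainder_const_nonneg[of u] by (simp add: mult_left_mono)
  qed
  define f where "f p = (\<integral>q. cov_pair (p, q) \<partial>?N)" for p
  define g where "g p = (\<integral>q. ?near p q \<partial>?N)" for p :: "'a \<times> real"
  \<comment> \<open>\<open>f p\<close> is the expectation of the field at \<open>p\<close> times the
    linear term, so integrability is inherited from the exchange lemmas and no joint measurability
    of the covariance has to be shown.\<close>
  have if': "integrable ?N f"
    unfolding f_def expectation_Z_mult[symmetric]
    using G.integrable_expectation_mult[OF G.mean_field_meas G.integrable_mean_field_square]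
    by (rule Bochner_Integration.integrable_cong[THEN iffD1, OF refl, rotated])
      (use G.expectation_mean_field_mult in \<open>auto simp: mult.commute\<close>)
  have ig: "integrable ?N g"
  proof (rule G.N.integrable_const_bound)
    show "g \<in> borel_measurable ?N" unfolding g_def by measurable
    show "AE p in ?N. norm (g p) \<le> measure ?N (space ?N)"
    proof (intro AE_I2)
      fix p :: "'a \<times> real"
      have "g p \<le> (\<integral>q. 1 \<partial>?N)" unfolding g_def
        by (rule integral_mono[OF i_near]) auto
      moreover have "0 \<le> g p" unfolding g_def by (intro Bochner_Integration.integral_nonneg) auto
      ultimately show "norm (g p) \<le> measure ?N (space ?N)" by simp
    qed
  qed
  have "expectation (\<lambda>\<omega>. (remainder_part \<omega>)\<^sup>2) = (\<integral>p. (\<integral>q. ?r p q \<partial>?N) \<partial>?N)"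
    unfolding remainder_part_def by (rule R.expectation_mean_field_square)
  also have "\<dots> \<le> (\<integral>p. ?K * (\<epsilon> * f p + g p) \<partial>?N)"
  proof (rule integral_mono)
    show "integrable ?N (\<lambda>p. \<integral>q. ?r p q \<partial>?N)"
      using R.integrable_expectation_mult[OF R.mean_field_meas R.integrable_mean_field_square]
      by (rule Bochner_Integration.integrable_cong[THEN iffD1, OF refl, rotated])
        (use R.expectation_mean_field_mult[OF R.X_section R.X_int] in \<open>auto simp: mult.commute\<close>)
    show "integrable ?N (\<lambda>p. ?K * (\<epsilon> * f p + g p))" using if' ig by simp
    fix p assume p: "p \<in> space ?N"
    have "(\<integral>q. ?r p q \<partial>?N) \<le> (\<integral>q. ?K * (\<epsilon> * cov_pair (p, q) + ?near p q) \<partial>?N)"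
    proof (rule integral_mono)
      show "integrable ?N (\<lambda>q. ?r p q)"
        using R.integrable_expectation_mult[OF R.X_section[OF p] R.X_int[OF p]] by (simp add: mult.commute)
      show "integrable ?N (\<lambda>q. ?K * (\<epsilon> * cov_pair (p, q) + ?near p q))" using i_cov i_near by simp
    qed (rule pt[OF p])
    also have "\<dots> = ?K * (\<epsilon> * f p + g p)"
      using i_cov i_near by (simp add: f_def g_def)
    finally show "(\<integral>q. ?r p q \<partial>?N) \<le> ?K * (\<epsilon> * f p + g p)" .
  qed
  also have "\<dots> = ?K * (\<epsilon> * (\<integral>p. f p \<partial>?N) + (\<integral>p. g p \<partial>?N))"
    using if' ig by simp
  also have "(\<integral>p. f p \<partial>?N) = expectation (\<lambda>\<omega>. (linear_part \<omega>)\<^sup>2)"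
    unfolding linear_part_def G.expectation_mean_field_square expectation_Z_mult f_def ..
  also have "?K * (\<epsilon> * expectation (\<lambda>\<omega>. (linear_part \<omega>)\<^sup>2) + (\<integral>p. g p \<partial>?N))
      \<le> ?K * (\<epsilon> * expectation (\<lambda>\<omega>. (linear_part \<omega>)\<^sup>2) + 2 * \<tau>0 * (measure sphere_measure (sphere (0::'a) 1))\<^sup>2 * T)"
    using double_integral_near[OF T \<tau>0] remainder_const_nonneg[of u]
    by (intro mult_left_mono add_left_mono) (auto simp: g_def)
  finally show ?thesis .
qed

end

text \<open>A real supremum dominates its members only for sets bounded above. The bound by 1
  supplies this for nonnegative lags, and \<open>max 1 t\<close> keeps the lags positive.\<close>

lemma uniform_decay:
  assumes i: "((\<lambda>\<tau>. SUP z\<in>{0..2}. C z \<tau>) \<longlongrightarrow> 0) at_top" and \<epsilon>: "\<epsilon> > 0"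
  obtains \<tau>0 where "\<tau>0 > 0" "\<And>z \<tau>. z \<in> {0..2} \<Longrightarrow> \<tau> \<ge> \<tau>0 \<Longrightarrow> C z \<tau> \<le> \<epsilon>"
proof -
  obtain t where t: "\<And>\<tau>. \<tau> \<ge> t \<Longrightarrow> (SUP z\<in>{0..2}. C z \<tau>) < \<epsilon>"
    using order_tendstoD(2)[OF i \<epsilon>] unfolding eventually_at_top_linorder by blast
  have "C z \<tau> \<le> \<epsilon>" if z: "z \<in> {0..2}" and \<tau>: "\<tau> \<ge> max 1 t" for z \<tau>
  proof -
    have "C y \<tau> \<le> 1" if "y \<in> {0..2}" for y
      using cov_fun_le_1[of "(y, \<tau>)"] that \<tau> by (simp add: cov_fun_def)
    then have "bdd_above ((\<lambda>z. C z \<tau>) ` {0..2})" by (intro bdd_aboveI[where M=1]) auto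
    then have "C z \<tau> \<le> (SUP z\<in>{0..2}. C z \<tau>)" using z by (rule cSUP_upper[rotated])
    then show ?thesis using t[of \<tau>] \<tau> by simp
  qed
  then show thesis using that[of "max 1 t"] by simp
qed

text \<open>After standardisation the linear term is exactly standard normal, and the difference is
  almost surely the remainder divided by \<open>std_normal_density u * \<sigma> T\<close>. It
  remains to compare second moments.\<close>

theorem sojourn_clt:
  assumes i: "((\<lambda>\<tau>. SUP z\<in>{0..2}. C z \<tau>) \<longlongrightarrow> 0) at_top"
    and W: "filterlim (weighted_cov_integral DIM('a) C) at_top at_top"
  shows "converges_in_distribution M
    (\<lambda>T \<omega>. (sojourn Z u T \<omega> - T * (1 - std_normal_cdf u) * measure sphere_measure (sphere (0::'a) 1)) /
      (std_normal_density u *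
        sqrt (8 * pi powr (real DIM('a) - 1 / 2) / (Gamma (real DIM('a) / 2) * Gamma ((real DIM('a) - 1) / 2))
          * T * weighted_cov_integral DIM('a) C T)))
    std_normal_distribution at_top" (is "converges_in_distribution M ?X _ _")
proof -
  let ?W = "weighted_cov_integral DIM('a) C"
  let ?S = "measure sphere_measure (sphere (0::'a) 1)"
  let ?\<phi> = "std_normal_density u"
  let ?K = "remainder_const u"
  define k where "k = 8 * pi powr (real DIM('a) - 1 / 2) / (Gamma (real DIM('a) / 2) * Gamma ((real DIM('a) - 1) / 2))"
  define \<sigma> where "\<sigma> T = sqrt (k * T * ?W T)" for T
  let ?\<xi> = "\<lambda>T \<omega>. linear_part T \<omega> / \<sigma> T"
  have k: "k > 0" unfolding k_def using dim by (intro divide_pos_pos mult_pos_pos Gamma_real_pos) auto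
  have \<phi>: "?\<phi> > 0" by (rule normal_density_pos) simp
  have ev: "\<forall>\<^sub>F T in at_top. T > 0 \<and> ?W T > 0"
    using eventually_gt_at_top[of 0] filterlim_at_top_dense[THEN iffD1, OF W, rule_format, of 0]
    by eventually_elim simp
  have var: "expectation (\<lambda>\<omega>. (linear_part T \<omega>)\<^sup>2) = (\<sigma> T)\<^sup>2" "\<sigma> T > 0" if "T > 0" "?W T > 0" for T
  proof -
    have "expectation (\<lambda>\<omega>. (linear_part T \<omega>)\<^sup>2) = k * T * ?W T"
      using expectation_linear_part_square[OF that(1)] unfolding k_def .
    moreover have "k * T * ?W T > 0" using that k by simp
    ultimately show "expectation (\<lambda>\<omega>. (linear_part T \<omega>)\<^sup>2) = (\<sigma> T)\<^sup>2" "\<sigma> T > 0"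
      unfolding \<sigma>_def by simp_all
  qed
  have diff: "AE \<omega> in M. (?X T \<omega> - ?\<xi> T \<omega>)\<^sup>2 = (remainder_part u T \<omega>)\<^sup>2 / (?\<phi>\<^sup>2 * (\<sigma> T)\<^sup>2)" if T: "T > 0" "?W T > 0" for T
    using sojourn_decomposition[OF T(1), of u]
  proof eventually_elim
    case (elim \<omega>)
    have "?X T \<omega> - ?\<xi> T \<omega> = remainder_part u T \<omega> / (?\<phi> * \<sigma> T)"
      unfolding elim k_def[symmetric] \<sigma>_def[symmetric] using var(2)[OF T] \<phi> by (simp add: field_simps)
    then show ?case by (simp add: power_divide power_mult_distrib)
  qed
  have X_meas [measurable]: "?X T \<in> borel_measurable M" if "T > 0" for T
    using sojourn_meas[OF that, of u] by measurable
  have \<xi>_meas: "?\<xi> T \<in> borel_measurable M" if "T > 0" for T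
    using linear_part_meas[OF that] by measurable
  have rem: "integrable M (\<lambda>\<omega>. (?X T \<omega> - ?\<xi> T \<omega>)\<^sup>2)"
    "expectation (\<lambda>\<omega>. (?X T \<omega> - ?\<xi> T \<omega>)\<^sup>2) = expectation (\<lambda>\<omega>. (remainder_part u T \<omega>)\<^sup>2) / (?\<phi>\<^sup>2 * (\<sigma> T)\<^sup>2)"
    if T: "T > 0" "?W T > 0" for T
  proof -
    note [measurable] = X_meas[OF T(1)] \<xi>_meas[OF T(1)] remainder_part_meas[OF T(1), of u]
    have m: "(\<lambda>\<omega>. (?X T \<omega> - ?\<xi> T \<omega>)\<^sup>2) \<in> borel_measurable M"
      "(\<lambda>\<omega>. (remainder_part u T \<omega>)\<^sup>2 / (?\<phi>\<^sup>2 * (\<sigma> T)\<^sup>2)) \<in> borel_measurable M"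
      by measurable
    show "integrable M (\<lambda>\<omega>. (?X T \<omega> - ?\<xi> T \<omega>)\<^sup>2)"
      using remainder_part_square[OF T(1), of u]
      by (subst integrable_cong_AE[OF m diff[OF T]]) simp
    show "expectation (\<lambda>\<omega>. (?X T \<omega> - ?\<xi> T \<omega>)\<^sup>2) = expectation (\<lambda>\<omega>. (remainder_part u T \<omega>)\<^sup>2) / (?\<phi>\<^sup>2 * (\<sigma> T)\<^sup>2)"
      by (subst integral_cong_AE[OF m diff[OF T]]) simp
  qed
  show ?thesis
  proof (rule converges_in_distribution_Slutsky[where \<xi>="?\<xi>"])
    show "prob_space M" by unfold_locales
    show "real_distribution std_normal_distribution" by (rule real_dist_normal_dist)
    show "\<forall>\<^sub>F T in at_top. ?X T \<in> borel_measurable M"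
      using ev by eventually_elim (rule X_meas, simp)
    show "\<forall>\<^sub>F T in at_top. ?\<xi> T \<in> borel_measurable M \<and> distr M borel (?\<xi> T) = std_normal_distribution"
      using ev by eventually_elim (intro conjI \<xi>_meas distr_linear_part var; simp)
    show "\<forall>\<^sub>F T in at_top. integrable M (\<lambda>\<omega>. (?X T \<omega> - ?\<xi> T \<omega>)\<^sup>2)"
      using ev by eventually_elim (rule rem; simp)
    show "((\<lambda>T. expectation (\<lambda>\<omega>. (?X T \<omega> - ?\<xi> T \<omega>)\<^sup>2)) \<longlongrightarrow> 0) at_top"
    proof (rule tendstoI)
      fix e :: real assume e: "e > 0"
      \<comment> \<open>The two contributions to the remainder will each be at most
        \<open>?K * \<epsilon> * (\<sigma> T)\<^sup>2\<close>, hence the factor 2. Using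
        \<open>?K + 1\<close> makes the divisor positive and the final inequality strict.\<close>
      define \<epsilon> where "\<epsilon> = e * ?\<phi>\<^sup>2 / (2 * (?K + 1))"
      have K: "?K \<ge> 0" by (rule remainder_const_nonneg)
      have \<epsilon>: "\<epsilon> > 0" unfolding \<epsilon>_def using e \<phi> K by (intro divide_pos_pos mult_pos_pos) auto
      obtain \<tau>0 where \<tau>0: "\<tau>0 > 0" and far: "\<And>z \<tau>. z \<in> {0..2} \<Longrightarrow> \<tau> \<ge> \<tau>0 \<Longrightarrow> C z \<tau> \<le> \<epsilon>"
        using uniform_decay[OF i \<epsilon>] by blast
      \<comment> \<open>This threshold makes the close pairs, of order \<open>T\<close>, at most
        \<open>\<epsilon> * (\<sigma> T)\<^sup>2\<close>, because
        \<open>(\<sigma> T)\<^sup>2 = k * T * ?W T\<close>.\<close>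
      have big: "\<forall>\<^sub>F T in at_top. 2 * \<tau>0 * ?S\<^sup>2 / (k * \<epsilon>) \<le> ?W T"
        using filterlim_at_top[THEN iffD1, OF W] by blast
      show "\<forall>\<^sub>F T in at_top. dist (expectation (\<lambda>\<omega>. (?X T \<omega> - ?\<xi> T \<omega>)\<^sup>2)) 0 < e"
        using ev big
      proof eventually_elim
        case (elim T)
        then have T: "T > 0" "?W T > 0" by auto
        have "2 * \<tau>0 * ?S\<^sup>2 \<le> \<epsilon> * (k * ?W T)"
          using elim(2) k \<epsilon> by (simp add: divide_le_eq mult_ac)
        then have "2 * \<tau>0 * ?S\<^sup>2 * T \<le> \<epsilon> * (k * ?W T) * T"
          using T by (intro mult_right_mono) auto
        also have "\<dots> = \<epsilon> * (\<sigma> T)\<^sup>2"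
          using T k by (simp add: \<sigma>_def mult_ac)
        finally have n: "2 * \<tau>0 * ?S\<^sup>2 * T \<le> \<epsilon> * (\<sigma> T)\<^sup>2" .
        have "expectation (\<lambda>\<omega>. (remainder_part u T \<omega>)\<^sup>2) \<le> ?K * (\<epsilon> * (\<sigma> T)\<^sup>2 + 2 * \<tau>0 * ?S\<^sup>2 * T)"
          using expectation_remainder_part_square_le[OF T(1) less_imp_le[OF \<epsilon>] \<tau>0 far, of u] var(1)[OF T] by simp
        also have "\<dots> \<le> ?K * (\<epsilon> * (\<sigma> T)\<^sup>2 + \<epsilon> * (\<sigma> T)\<^sup>2)"
          using n K by (intro mult_left_mono add_left_mono) auto
        also have "\<dots> < (?K + 1) * (\<epsilon> * (\<sigma> T)\<^sup>2 + \<epsilon> * (\<sigma> T)\<^sup>2)"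
          using \<epsilon> var(2)[OF T] by (intro mult_strict_right_mono) auto
        also have "\<dots> = (2 * (?K + 1) * \<epsilon>) * (\<sigma> T)\<^sup>2" by (simp add: algebra_simps)
        also have "2 * (?K + 1) * \<epsilon> = e * ?\<phi>\<^sup>2" using K by (simp add: \<epsilon>_def)
        finally have "expectation (\<lambda>\<omega>. (remainder_part u T \<omega>)\<^sup>2) < e * (?\<phi>\<^sup>2 * (\<sigma> T)\<^sup>2)" by (simp add: mult_ac)
        then have "expectation (\<lambda>\<omega>. (remainder_part u T \<omega>)\<^sup>2) / (?\<phi>\<^sup>2 * (\<sigma> T)\<^sup>2) < e"
          using \<phi> var(2)[OF T] by (simp add: divide_less_eq)
        then show ?case unfolding rem(2)[OF T] dist_real_def by simp
      qed
    qed
  qed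
qed

end

theorem theorem5:
  fixes M :: "'w measure"
    and Z :: "real ^ 'n \<Rightarrow> real \<Rightarrow> 'w \<Rightarrow> real"
    and C :: "real \<Rightarrow> real \<Rightarrow> real"
    and G :: "(real \<times> real) measure"
    and d :: nat and u :: real
  assumes prob: "prob_space M"
    and dim: "d = CARD('n)" "d \<ge> 2"
    and gauss: "gaussian_field M (\<lambda>(x, t). Z x t)"
    and ms_cont: "mean_square_continuous M (\<lambda>(x, t). Z x t)"
    and meas: "(\<lambda>(\<omega>, x, t). Z x t \<omega>)
      \<in> borel_measurable (M \<Otimes>\<^sub>M (restrict_space borel (sphere 0 1) \<Otimes>\<^sub>M borel))"
    and mean: "\<And>x t. prob_space.expectation M (Z x t) = 0"
    and unit_var: "\<And>x t. prob_space.expectation M (\<lambda>\<omega>. (Z x t \<omega>)\<^sup>2) = 1"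
    and cov: "\<And>x y t s. prob_space.expectation M (\<lambda>\<omega>. Z x t \<omega> * Z y s \<omega>)
      = C (norm (x - y)) \<bar>t - s\<bar>"
    and C_nonneg: "\<And>z \<tau>. z \<ge> 0 \<Longrightarrow> \<tau> \<ge> 0 \<Longrightarrow> C z \<tau> \<ge> 0"
    and G_sets: "sets G = sets (restrict_space borel ({0..} \<times> {0..}))"
    and G_finite: "finite_measure G"
    and spectral: "\<And>z \<tau>. z \<ge> 0 \<Longrightarrow> \<tau> \<ge> 0 \<Longrightarrow>
      C z \<tau> = 2 powr ((real d - 2) / 2 + 1) * Gamma (real d / 2) *
        (\<integral>(l, m). cos (m * \<tau>) * bessel_ratio ((real d - 2) / 2) (l * z) \<partial>G)"
    and i: "((\<lambda>\<tau>. SUP z\<in>{0..2}. C z \<tau>) \<longlongrightarrow> 0) at_top"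
    and ii: "\<exists>\<delta>\<in>{0<..<1}.
      filterlim (\<lambda>T. 1 / T powr \<delta> * weighted_cov_integral d C T) at_top at_top"
  shows "converges_in_distribution M
    (\<lambda>T \<omega>. (sojourn Z u T \<omega>
              - T * (1 - std_normal_cdf u) * measure sphere_measure (sphere (0 :: real ^ 'n) 1)) /
            (std_normal_density u *
              sqrt (8 * pi powr (real d - 1 / 2) / (Gamma (real d / 2) * Gamma ((real d - 1) / 2))
                    * T * weighted_cov_integral d C T)))
    std_normal_distribution at_top"
proof -
  have d: "d = CARD('n)" by (rule dim(1))
  interpret M: prob_space M by (rule prob)
  interpret stationary_field M Z C
    by unfold_locales (use dim gauss ms_cont meas mean unit_var cov C_nonneg in auto)
  obtain \<delta> where \<delta>: "0 < \<delta>" "\<delta> < 1"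
    and lim: "filterlim (\<lambda>T. 1 / T powr \<delta> * weighted_cov_integral d C T) at_top at_top"
    using ii by auto
  \<comment> \<open>For \<open>T \<ge> 1\<close> the factor \<open>T powr \<delta>\<close> is at
    least 1, so divergence after division by it implies divergence. The bound is replaced by
    \<open>max 0 B\<close> so that multiplication by this factor does not decrease it.\<close>
  have "filterlim (weighted_cov_integral d C) at_top at_top"
    unfolding filterlim_at_top
  proof
    fix B :: real
    have "\<forall>\<^sub>F T in at_top. max 0 B \<le> 1 / T powr \<delta> * weighted_cov_integral d C T"
      using lim unfolding filterlim_at_top by blast
    then show "\<forall>\<^sub>F T in at_top. B \<le> weighted_cov_integral d C T"
      using eventually_ge_at_top[of 1]
    proof eventually_elim
      case (elim T)
      have 1: "1 \<le> T powr \<delta>" using elim(2) \<delta> by (simp add: ge_one_powr_ge_zero)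
      have "B \<le> max 0 B * 1" by simp
      also have "\<dots> \<le> max 0 B * T powr \<delta>" using 1 by (intro mult_left_mono) auto
      also have "\<dots> \<le> weighted_cov_integral d C T" using elim 1 by (simp add: le_divide_eq split: if_splits)
      finally show ?case .
    qed
  qed
  then show ?thesis
    using sojourn_clt[OF i, of u] by (simp add: d)
qed

end
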